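(* Let $t\in\mathbb{R}$, $y\in\mathbb{R}^m$, and suppose that $L=\partial_t+a_0(t)+g(t)L_2$ is locally $C^\infty$ hypoelliptic near $(t_0,y_0)$, where $a_0$ is smooth and real, $g\ge0$ is smooth, and $L_2$ is as in the context. Then $L_2$ satisfies the superlogarithmic estimate of order $\tfrac12$ near $y_0$: there is an open neighborhood $U\subset\mathbb{R}^m$ of $y_0$ such that for every compact $K\subset U$ and every $\varepsilon'>0$ there is a constant $C_{\varepsilon',K}$ with $$\|(\log\langle\xi\rangle)^{1/2}\,\hat u(\xi)\|_{L^2}^2\le\varepsilon'\,\mathrm{Re}(L_2u,u)+C_{\varepsilon',K}\|u\|_{L^2}^2\qquad\text{for all }u\in C_0^\infty(K).$$
   Context: Notation: $\langle\xi\rangle=\sqrt{e^2+|\xi|^2}$; $\hat u$ is the Fourier transform on $\mathbb{R}^m$; $(\cdot,\cdot)$, $\|\cdot\|$ are the $L^2$ inner product and norm; $C_0^\infty(K)$ denotes smooth functions supported in $K$. Operator: $$L_2=-\sum_{j,k=1}^m\partial_{y_j}\big[b_{jk}(y)\partial_{y_k}\,\cdot\,\big]+b_0(y)$$ has smooth real coefficients with $(b_{jk}(y))$ symmetric and non-negative definite for every $y\in\mathbb{R}^m$. Hypoellipticity: $L$ is locally $C^\infty$ hypoelliptic near a point $P$ if for every neighborhood $\Omega$ of $P$ and every $f\in C^\infty(\Omega)$ there is a neighborhood $\Omega'\Subset\Omega$ of $P$ such that every distribution $u$ with $Lu=f$ in $\Omega$ (in the distributional sense) is in $C^\infty(\Omega')$.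 *)

theory Defs
  imports "HOL-Analysis.Analysis"
begin

section \<open>Smooth functions and test functions\<close>

definition dir_deriv :: "'a::real_normed_vector \<Rightarrow> ('a \<Rightarrow> 'b::real_normed_vector) \<Rightarrow> 'a \<Rightarrow> 'b"
  where "dir_deriv v f = (\<lambda>x. frechet_derivative f (at x) v)"

primrec Ck_on :: "nat \<Rightarrow> 'a::euclidean_space set \<Rightarrow> ('a \<Rightarrow> 'b::real_normed_vector) \<Rightarrow> bool"
  where
    "Ck_on 0 S f \<longleftrightarrow> continuous_on S f"
  | "Ck_on (Suc k) S f \<longleftrightarrow> (\<forall>x\<in>S. f differentiable (at x)) \<and> (\<forall>v. Ck_on k S (dir_deriv v f))"

text \<open>Meaningful for open \<open>S\<close> only, since derivatives are taken at \<open>x\<close>, not within \<open>S\<close>.\<close>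

definition smooth_on :: "'a::euclidean_space set \<Rightarrow> ('a \<Rightarrow> 'b::real_normed_vector) \<Rightarrow> bool"
  where "smooth_on S f \<longleftrightarrow> (\<forall>k. Ck_on k S f)"

definition supp :: "('a::topological_space \<Rightarrow> 'b::zero) \<Rightarrow> 'a set"
  where "supp f = closure {x. f x \<noteq> 0}"

text \<open>\<open>C\<^sub>0\<^sup>\<infinity>(S)\<close>, used both for open \<open>S\<close> and for compact \<open>S\<close>; test functions are defined
  on the whole space and vanish outside their support.\<close>

definition test_functions :: "'a::euclidean_space set \<Rightarrow> ('a \<Rightarrow> complex) set"
  where "test_functions S = {\<phi>. smooth_on UNIV \<phi> \<and> compact (supp \<phi>) \<and> supp \<phi> \<subseteq> S}"


section \<open>Distributions\<close>

text \<open>A distribution on \<open>\<Omega>\<close> is a functional of which only the values on \<open>test_functions \<Omega>\<close>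
  matter. A list of basis vectors of length at most \<open>N\<close> plays the role of a multi-index of
  order at most \<open>N\<close>.\<close>

type_synonym 'a functional = "('a \<Rightarrow> complex) \<Rightarrow> complex"

definition distribution_on :: "'a::euclidean_space set \<Rightarrow> 'a functional \<Rightarrow> bool"
  where "distribution_on \<Omega> u \<longleftrightarrow>
    (\<forall>\<phi>\<in>test_functions \<Omega>. \<forall>\<psi>\<in>test_functions \<Omega>. u (\<lambda>x. \<phi> x + \<psi> x) = u \<phi> + u \<psi>) \<and>
    (\<forall>c. \<forall>\<phi>\<in>test_functions \<Omega>. u (\<lambda>x. c * \<phi> x) = c * u \<phi>) \<and>
    (\<forall>K. compact K \<and> K \<subseteq> \<Omega> \<longrightarrow>
      (\<exists>C N. \<forall>\<phi>\<in>test_functions K.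
        cmod (u \<phi>) \<le> C * (\<Sum>vs | set vs \<subseteq> Basis \<and> length vs \<le> N. SUP x. cmod (fold dir_deriv vs \<phi> x))))"

definition dist_of_fun :: "('a::euclidean_space \<Rightarrow> complex) \<Rightarrow> 'a functional"
  where "dist_of_fun f = (\<lambda>\<phi>. LINT x|lborel. f x * \<phi> x)"

definition dist_deriv :: "'a::euclidean_space \<Rightarrow> 'a functional \<Rightarrow> 'a functional"
  where "dist_deriv v u = (\<lambda>\<phi>. - u (dir_deriv v \<phi>))"

definition dist_mult :: "('a::euclidean_space \<Rightarrow> real) \<Rightarrow> 'a functional \<Rightarrow> 'a functional"
  where "dist_mult a u = (\<lambda>\<phi>. u (\<lambda>x. of_real (a x) * \<phi> x))"

definition dist_eq_on :: "'a::euclidean_space set \<Rightarrow> 'a functional \<Rightarrow> 'a functional \<Rightarrow> bool"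
  where "dist_eq_on \<Omega> u v \<longleftrightarrow> (\<forall>\<phi>\<in>test_functions \<Omega>. u \<phi> = v \<phi>)"

definition dist_smooth_on :: "'a::euclidean_space set \<Rightarrow> 'a functional \<Rightarrow> bool"
  where "dist_smooth_on \<Omega> u \<longleftrightarrow> (\<exists>w. smooth_on \<Omega> w \<and> dist_eq_on \<Omega> u (dist_of_fun w))"

definition locally_hypoelliptic_near :: "('a::euclidean_space functional \<Rightarrow> 'a functional) \<Rightarrow> 'a \<Rightarrow> bool"
  where "locally_hypoelliptic_near L P \<longleftrightarrow>
    (\<forall>\<Omega> f. open \<Omega> \<and> P \<in> \<Omega> \<and> smooth_on \<Omega> f \<longrightarrow>
      (\<exists>\<Omega>'. open \<Omega>' \<and> P \<in> \<Omega>' \<and> compact (closure \<Omega>') \<and> closure \<Omega>' \<subseteq> \<Omega> \<and>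
        (\<forall>u. distribution_on \<Omega> u \<and> dist_eq_on \<Omega> (L u) (dist_of_fun f) \<longrightarrow> dist_smooth_on \<Omega>' u)))"


section \<open>The operators\<close>

definition L2_op :: "('m::finite \<Rightarrow> 'm \<Rightarrow> real^'m \<Rightarrow> real) \<Rightarrow> (real^'m \<Rightarrow> real) \<Rightarrow>
    (real^'m \<Rightarrow> complex) \<Rightarrow> real^'m \<Rightarrow> complex"
  where "L2_op b b0 u = (\<lambda>y.
    - (\<Sum>j\<in>UNIV. \<Sum>k\<in>UNIV.
        dir_deriv (axis j 1) (\<lambda>z. of_real (b j k z) * dir_deriv (axis k 1) u z) y)
    + of_real (b0 y) * u y)"

text \<open>The same operator acting in the \<open>y\<close> variables on distributions in \<open>(t, y)\<close>.\<close>

definition L2_dist :: "('m::finite \<Rightarrow> 'm \<Rightarrow> real^'m \<Rightarrow> real) \<Rightarrow> (real^'m \<Rightarrow> real) \<Rightarrow>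
    (real \<times> (real^'m)) functional \<Rightarrow> (real \<times> (real^'m)) functional"
  where "L2_dist b b0 u = (\<lambda>\<phi>.
    - (\<Sum>j\<in>UNIV. \<Sum>k\<in>UNIV.
        dist_deriv (0, axis j 1) (dist_mult (\<lambda>(t, y). b j k y) (dist_deriv (0, axis k 1) u)) \<phi>)
    + dist_mult (\<lambda>(t, y). b0 y) u \<phi>)"

definition L_dist :: "(real \<Rightarrow> real) \<Rightarrow> (real \<Rightarrow> real) \<Rightarrow>
    ('m::finite \<Rightarrow> 'm \<Rightarrow> real^'m \<Rightarrow> real) \<Rightarrow> (real^'m \<Rightarrow> real) \<Rightarrow>
    (real \<times> (real^'m)) functional \<Rightarrow> (real \<times> (real^'m)) functional"
  where "L_dist a0 g b b0 u = (\<lambda>\<phi>.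
    dist_deriv (1, 0) u \<phi>
    + dist_mult (\<lambda>(t, y). a0 t) u \<phi>
    + dist_mult (\<lambda>(t, y). g t) (L2_dist b b0 u) \<phi>)"


section \<open>The superlogarithmic estimate\<close>

definition square_integrable :: "('a::euclidean_space \<Rightarrow> complex) \<Rightarrow> bool"
  where "square_integrable f \<longleftrightarrow>
    f \<in> borel_measurable lborel \<and> integrable lborel (\<lambda>x. (cmod (f x))\<^sup>2)"

definition L2_inner :: "('a::euclidean_space \<Rightarrow> complex) \<Rightarrow> ('a \<Rightarrow> complex) \<Rightarrow> complex"
  where "L2_inner f h = (LINT x|lborel. f x * cnj (h x))"

definition L2_norm :: "('a::euclidean_space \<Rightarrow> complex) \<Rightarrow> real"
  where "L2_norm f = sqrt (LINT x|lborel. (cmod (f x))\<^sup>2)"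

definition fourier :: "('a::euclidean_space \<Rightarrow> complex) \<Rightarrow> 'a \<Rightarrow> complex"
  where "fourier u = (\<lambda>\<xi>. LINT y|lborel. exp (- \<i> * of_real (y \<bullet> \<xi>)) * u y)"

definition bracket :: "'a::euclidean_space \<Rightarrow> real"
  where "bracket \<xi> = sqrt ((exp 1)\<^sup>2 + (norm \<xi>)\<^sup>2)"

text \<open>Square integrability of the weighted Fourier transform is asserted explicitly because
  \<open>L2_norm\<close> is \<open>0\<close> for functions that are not square integrable.\<close>

definition superlogarithmic_estimate_near ::
    "real \<Rightarrow> (('a::euclidean_space \<Rightarrow> complex) \<Rightarrow> 'a \<Rightarrow> complex) \<Rightarrow> 'a \<Rightarrow> bool"
  where "superlogarithmic_estimate_near s A y0 \<longleftrightarrow>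
    (\<exists>U. open U \<and> y0 \<in> U \<and>
      (\<forall>K. compact K \<and> K \<subseteq> U \<longrightarrow>
        (\<forall>\<epsilon>>0. \<exists>C. \<forall>u\<in>test_functions K.
          square_integrable (\<lambda>\<xi>. of_real (ln (bracket \<xi>) powr s) * fourier u \<xi>) \<and>
          (L2_norm (\<lambda>\<xi>. of_real (ln (bracket \<xi>) powr s) * fourier u \<xi>))\<^sup>2
            \<le> \<epsilon> * Re (L2_inner (A u) u) + C * (L2_norm u)\<^sup>2)))"

end

theory Submission
  imports Defs "HOL-Probability.Probability"
begin

text \<open>
  The operator is tested on exact solutions that are spectrally localized in \<open>y\<close>. Suppose that
  \<open>P\<close> were a self-adjoint realization of \<open>L\<^sub>2\<close> on a ball around \<open>y\<^sub>0\<close> and that \<open>w\<close> lay in the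
  spectral subspace \<open>P \<le> R\<close>. With \<open>F' = a\<^sub>0\<close>, \<open>G' = g\<close> and \<open>F t\<^sub>0 = G t\<^sub>0 = 0\<close> the function
  \<open>exp (- F t - G t * P) w\<close> solves \<open>L u = 0\<close> on both sides of \<open>t\<^sub>0\<close>, and its norm is at most
  \<open>exp (c * R)\<close> times that of \<open>w\<close>, where \<open>c\<close> depends only on the cylinder in \<open>(t, y)\<close>. By
  hypoellipticity all these solutions are smooth on one and the same neighbourhood of
  \<open>(t\<^sub>0, y\<^sub>0)\<close>, so by uniform boundedness the Fourier transform of \<open>\<phi> * w\<close>, with a cutoff \<open>\<phi>\<close>
  near \<open>y\<^sub>0\<close>, is \<open>O(\<langle>\<xi>\<rangle> ^ (- 2 k) * exp (c * R))\<close> for every \<open>k\<close>, with the same \<open>c\<close> for all \<open>k\<close>.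

  Now let \<open>M > 0\<close> and compare the frequencies \<open>2 ^ i \<le> log \<langle>\<xi>\<rangle> < 2 ^ (i + 1)\<close> of a function \<open>u\<close>
  with its spectral parts below and above the level \<open>R = M * 2 ^ i\<close>. The lower part contributes
  almost nothing once \<open>k\<close> is large compared with \<open>c * M\<close>. The upper parts, weighted with
  \<open>2 ^ i\<close> and summed over \<open>i\<close>, cost at most \<open>2 / M * (P u, u)\<close>. As \<open>M\<close> is arbitrary, this is the
  superlogarithmic estimate with arbitrarily small \<open>\<epsilon>\<close>. Dyadic levels are essential here: with
  unit shells the same count would produce \<open>P ^ 2\<close> instead of \<open>P\<close>.

  Spectral projections are only taken in finite dimensions. On the span of finitely many test functions
  the compression of \<open>L\<^sub>2\<close> has an eigenbasis (\<open>compression_eigenbasis\<close>), which gives truncated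
  exponentials (\<open>galerkin_flow\<close>); their pairings with test functions converge along a filter
  supplied by Tychonoff's theorem (\<open>spectral_weak_flows\<close>). The limits are weak flows: families of
  functionals on test functions described by inequalities that are stable under pointwise limits.
  The same stability yields a uniform boundedness principle (\<open>weak_flow_uniform_bound\<close>).
  Weak flows are turned into distribution solutions in \<open>flow_functional_solves\<close>, their regularity
  is read off in \<open>hypoelliptic_flow_regular\<close>, and the frequency count is carried out in
  \<open>real_superlogarithmic_estimate\<close>, with an upper Plancherel bound (\<open>plancherel_bound\<close>) and
  integration by parts against plane waves (\<open>wave_integral_decay\<close>) as the Fourier input.
\<close>

section \<open>Rayleigh quotients and eigenbases of compressions\<close>

text \<open>The coefficient cube is a Minkowski sum of segments, one for each vector; this makes bounded parts of finite-dimensional spans accessible to compactness arguments.\<close>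

lemma compact_coordinate_box:
  fixes C :: "'v::real_normed_vector set"
  assumes "finite C"
  shows "compact {v. \<exists>c. v = (\<Sum>e\<in>C. c e *\<^sub>R e) \<and> (\<forall>e. \<bar>c e\<bar> \<le> (r::real))}" (is "compact (?K C)")
  using assms
proof (induction C rule: finite_induct)
  case empty
  have "?K {} \<subseteq> {0}" by auto
  then show ?case by (rule finite_imp_compact[OF finite_subset]) auto
next
  case (insert x F)
  have eq: "?K (insert x F) = {a + b | a b. a \<in> (\<lambda>s. s *\<^sub>R x) ` {-r..r} \<and> b \<in> ?K F}"
  proof (intro equalityI subsetI)
    fix v assume "v \<in> ?K (insert x F)"
    then obtain c where c: "v = (\<Sum>e\<in>insert x F. c e *\<^sub>R e)" "\<forall>e. \<bar>c e\<bar> \<le> r" by auto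
    then have v: "v = c x *\<^sub>R x + (\<Sum>e\<in>F. c e *\<^sub>R e)" using insert by simp
    have "c x *\<^sub>R x \<in> (\<lambda>s. s *\<^sub>R x) ` {-r..r}" using c(2)[rule_format, of x] by (auto simp: abs_le_iff)
    moreover have "(\<Sum>e\<in>F. c e *\<^sub>R e) \<in> ?K F" using c(2) by blast
    ultimately show "v \<in> {a + b | a b. a \<in> (\<lambda>s. s *\<^sub>R x) ` {-r..r} \<and> b \<in> ?K F}"
      using v by blast
  next
    fix v assume "v \<in> {a + b | a b. a \<in> (\<lambda>s. s *\<^sub>R x) ` {-r..r} \<and> b \<in> ?K F}"
    then obtain s c where s: "s \<in> {-r..r}" "v = s *\<^sub>R x + (\<Sum>e\<in>F. c e *\<^sub>R e)" "\<forall>e. \<bar>c e\<bar> \<le> r" by auto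
    let ?c = "c(x := s)"
    have "(\<Sum>e\<in>F. ?c e *\<^sub>R e) = (\<Sum>e\<in>F. c e *\<^sub>R e)" using insert by (intro sum.cong) auto
    then have "v = (\<Sum>e\<in>insert x F. ?c e *\<^sub>R e)" using insert s by simp
    moreover have "\<forall>e. \<bar>?c e\<bar> \<le> r" using s by (auto simp: abs_le_iff)
    ultimately show "v \<in> ?K (insert x F)" by blast
  qed
  have "compact ((\<lambda>s. s *\<^sub>R x) ` {-r..r})"
    by (intro compact_continuous_image continuous_intros) auto
  then show ?case unfolding eq using insert.IH by (rule compact_sums)
qed

lemma orthonormal_coords:
  fixes E :: "'v::real_inner set"
  assumes "finite E" "\<And>e. e \<in> E \<Longrightarrow> inner e e = 1" "\<And>e f. \<lbrakk>e \<in> E; f \<in> E; e \<noteq> f\<rbrakk> \<Longrightarrow> inner e f = 0" "f \<in> E"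
  shows "inner (\<Sum>e\<in>E. c e *\<^sub>R e) f = c f"
proof -
  have "inner (\<Sum>e\<in>E. c e *\<^sub>R e) f = (\<Sum>e\<in>E. c e * inner e f)" by (simp add: inner_sum_left)
  also have "\<dots> = (\<Sum>e\<in>E. if e = f then c f else 0)" by (intro sum.cong) (auto simp: assms)
  also have "\<dots> = c f" using assms by simp
  finally show ?thesis .
qed

lemma orthonormal_expand:
  fixes E :: "'v::real_inner set"
  assumes "finite E" "\<And>e. e \<in> E \<Longrightarrow> inner e e = 1" "\<And>e f. \<lbrakk>e \<in> E; f \<in> E; e \<noteq> f\<rbrakk> \<Longrightarrow> inner e f = 0" "x \<in> span E"
  shows "x = (\<Sum>e\<in>E. inner x e *\<^sub>R e)"
proof -
  obtain c where c: "x = (\<Sum>e\<in>E. c e *\<^sub>R e)"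
    using assms(4) span_finite[OF assms(1)] by auto
  have "\<And>f. f \<in> E \<Longrightarrow> inner x f = c f" unfolding c by (rule orthonormal_coords[OF assms(1,2,3)])
  then show ?thesis using c by (metis (no_types, lifting) sum.cong)
qed

lemma orthonormal_parseval:
  fixes E :: "'v::real_inner set"
  assumes "finite E" "\<And>e. e \<in> E \<Longrightarrow> inner e e = 1" "\<And>e f. \<lbrakk>e \<in> E; f \<in> E; e \<noteq> f\<rbrakk> \<Longrightarrow> inner e f = 0"
  shows "(norm (\<Sum>e\<in>E. c e *\<^sub>R e))\<^sup>2 = (\<Sum>e\<in>E. (c e)\<^sup>2)"
proof -
  have "(norm (\<Sum>e\<in>E. c e *\<^sub>R e))\<^sup>2 = (\<Sum>f\<in>E. c f * inner (\<Sum>e\<in>E. c e *\<^sub>R e) f)"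
    by (simp only: power2_norm_eq_inner inner_sum_right[of _ _ E] inner_scaleR_right)
  also have "\<dots> = (\<Sum>e\<in>E. (c e)\<^sup>2)"
    using orthonormal_coords[OF assms] by (intro sum.cong) (auto simp: power2_eq_square)
  finally show ?thesis .
qed

text \<open>The Rayleigh quotient attains its minimum on the compact unit sphere of the span. At a minimizer \<open>e\<close> the displacement by \<open>s * x\<close> changes the form by \<open>2 * s * p + s\<^sup>2 * q\<close> with \<open>p = (A e, x)\<close>; this stays nonnegative for all \<open>s\<close> only if \<open>p = 0\<close>.\<close>

lemma rayleigh_minimizer:
  fixes A :: "'v::real_inner \<Rightarrow> 'v"
  assumes C: "finite C" "\<And>e. e \<in> C \<Longrightarrow> inner e e = 1" "\<And>e f. \<lbrakk>e \<in> C; f \<in> C; e \<noteq> f\<rbrakk> \<Longrightarrow> inner e f = 0" "C \<noteq> {}"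
    and D: "subspace D" "C \<subseteq> D"
    and A_add: "\<And>x y. \<lbrakk>x \<in> D; y \<in> D\<rbrakk> \<Longrightarrow> A (x + y) = A x + A y"
    and A_scale: "\<And>r x. x \<in> D \<Longrightarrow> A (r *\<^sub>R x) = r *\<^sub>R A x"
    and A_sym: "\<And>x y. \<lbrakk>x \<in> D; y \<in> D\<rbrakk> \<Longrightarrow> inner (A x) y = inner x (A y)"
  obtains e where "e \<in> span C" "inner e e = 1" "\<And>x. \<lbrakk>x \<in> span C; inner x e = 0\<rbrakk> \<Longrightarrow> inner (A e) x = 0"
proof -
  let ?Q = "\<lambda>x. inner (A x) x"
  let ?K = "{v. \<exists>c. v = (\<Sum>e\<in>C. c e *\<^sub>R e) \<and> (\<forall>e. \<bar>c e\<bar> \<le> (1::real))}"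
  have spanD: "span C \<subseteq> D" using D by (simp add: span_minimal)
  have K_span: "?K \<subseteq> span C"
  proof
    fix v assume "v \<in> ?K"
    then obtain c where "v = (\<Sum>e\<in>C. c e *\<^sub>R e)" by blast
    then show "v \<in> span C" by (simp add: span_sum span_scale span_base)
  qed
  have A_zero: "A 0 = 0" using A_scale[of 0 0] D by (simp add: subspace_0)
  have A_sum: "A (\<Sum>e\<in>F. c e *\<^sub>R e) = (\<Sum>e\<in>F. c e *\<^sub>R A e)" if "finite F" "F \<subseteq> D" for c :: "'v \<Rightarrow> real" and F
    using that
  proof (induction F rule: finite_induct)
    case empty then show ?case by (simp add: A_zero)
  next
    case (insert x F)
    have "(\<Sum>e\<in>F. c e *\<^sub>R e) \<in> D" using insert D by (intro subspace_sum subspace_scale) auto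
    then show ?case using insert A_add A_scale D by (simp add: subspace_scale)
  qed
  have Qeq: "?Q x = inner (\<Sum>e\<in>C. inner x e *\<^sub>R A e) x" if "x \<in> span C" for x
    using orthonormal_expand[OF C(1-3) that] A_sum[OF C(1) D(2), of "\<lambda>e. inner x e"] by simp
  have contQ: "continuous_on (span C) ?Q"
    by (subst continuous_on_cong[OF refl Qeq]) (auto intro!: continuous_intros)
  define S where "S = ?K \<inter> {v. inner v v = 1}"
  have "closed {v::'v. inner v v = 1}" by (intro closed_Collect_eq continuous_intros)
  then have "compact S" unfolding S_def using compact_coordinate_box[OF C(1), of 1] by (rule compact_Int_closed[rotated])
  moreover have unit_S: "v \<in> S" if "v \<in> span C" "inner v v = 1" for v
  proof -
    have "norm v = 1" using that by (simp add: norm_eq_1)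
    have "\<bar>inner v (if e \<in> C then e else 0)\<bar> \<le> 1" for e
    proof (cases "e \<in> C")
      case True
      then have "norm e = 1" using C(2) by (simp add: norm_eq_1)
      then show ?thesis using Cauchy_Schwarz_ineq2[of v e] \<open>norm v = 1\<close> True by simp
    qed simp
    moreover have "v = (\<Sum>e\<in>C. inner v (if e \<in> C then e else 0) *\<^sub>R e)"
    proof -
      have "(\<Sum>e\<in>C. inner v (if e \<in> C then e else 0) *\<^sub>R e) = (\<Sum>e\<in>C. inner v e *\<^sub>R e)"
        by (intro sum.cong) auto
      then show ?thesis using orthonormal_expand[OF C(1-3) that(1)] by simp
    qed
    ultimately have "v \<in> ?K" by (intro CollectI exI[of _ "\<lambda>e. inner v (if e \<in> C then e else 0)"] conjI allI)
    then show ?thesis using that by (simp add: S_def)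
  qed
  moreover have "S \<noteq> {}"
  proof -
    obtain e where "e \<in> C" using C(4) by auto
    then show ?thesis using unit_S[of e] C(2) span_base by blast
  qed
  moreover have S_span: "S \<subseteq> span C" using K_span by (auto simp: S_def)
  ultimately obtain e where e: "e \<in> S" "\<And>x. x \<in> S \<Longrightarrow> ?Q e \<le> ?Q x"
    using continuous_attains_inf[of S ?Q] continuous_on_subset[OF contQ, of S] by blast
  have e1: "e \<in> span C" "inner e e = 1" using e S_span by (auto simp: S_def)
  have min: "?Q e * inner x x \<le> ?Q x" if "x \<in> span C" for x
  proof (cases "x = 0")
    case True then show ?thesis by (simp add: A_zero)
  next
    case False
    define y where "y = (1 / norm x) *\<^sub>R x"
    have n: "norm x > 0" using False by simp
    have "y \<in> S" using False unfolding y_def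
      by (intro unit_S span_scale that) (simp add: dot_square_norm power2_eq_square)
    then have "?Q e \<le> ?Q y" by (rule e(2))
    also have "?Q y = ?Q x / (norm x)\<^sup>2" using that spanD A_scale[of x]
      by (auto simp: y_def power2_eq_square)
    finally show ?thesis using n by (simp add: field_simps dot_square_norm)
  qed
  have orth: "inner (A e) x = 0" if x: "x \<in> span C" "inner x e = 0" for x
  proof (rule ccontr)
    assume nz: "inner (A e) x \<noteq> 0"
    define p where "p = inner (A e) x"
    define q where "q = ?Q x - ?Q e * inner x x"
    have q0: "q \<ge> 0" using min[OF x(1)] by (simp add: q_def)
    have xe: "x \<in> D" "e \<in> D" using x e1 spanD by auto
    have ineq: "0 \<le> 2 * s * p + s\<^sup>2 * q" for s
    proof -
      have "?Q e * inner (e + s *\<^sub>R x) (e + s *\<^sub>R x) \<le> ?Q (e + s *\<^sub>R x)"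
        using x e1 by (intro min span_add span_scale)
      moreover have "inner (e + s *\<^sub>R x) (e + s *\<^sub>R x) = 1 + s\<^sup>2 * inner x x"
        using x e1 by (simp add: inner_add inner_commute power2_eq_square)
      moreover have "?Q (e + s *\<^sub>R x) = ?Q e + 2 * s * p + s\<^sup>2 * ?Q x"
        using xe A_add[of e "s *\<^sub>R x"] A_scale[of x s] A_sym[of x e] D(1)
        by (simp add: inner_add subspace_scale p_def power2_eq_square inner_commute algebra_simps)
      ultimately have "?Q e * (1 + s\<^sup>2 * inner x x) \<le> ?Q e + 2 * s * p + s\<^sup>2 * ?Q x" by (simp only:)
      then show ?thesis by (simp add: q_def algebra_simps)
    qed
    \<comment> \<open>the minimum of \<open>2 * s * p + s\<^sup>2 * (q + 1)\<close>; the denominator is positive even if \<open>q = 0\<close>\<close>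
    define s where "s = - p / (q + 1)"
    have p_eq: "p = - (s * (q + 1))" using q0 by (simp add: s_def)
    then have "s \<noteq> 0" using nz by (auto simp: p_def)
    have "2 * s * p + s\<^sup>2 * q = - (s\<^sup>2 * (q + 2))"
      by (subst p_eq) (simp add: power2_eq_square algebra_simps)
    also have "\<dots> < 0" using q0 \<open>s \<noteq> 0\<close> by simp
    finally show False using ineq[of s] by simp
  qed
  show ?thesis using that e1 orth by blast
qed

text \<open>Induction on the number of orthonormal vectors: a Rayleigh minimizer is split off and its orthogonal complement within the span is treated next. Since \<open>A e\<close> may leave the span, the basis diagonalizes the compression of \<open>A\<close> only, and the eigenvalue equation is tested against the span.\<close>

theorem compression_eigenbasis:
  fixes A :: "'v::real_inner \<Rightarrow> 'v"
  assumes D: "subspace D" "finite S" "S \<subseteq> D"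
    and A_add: "\<And>x y. \<lbrakk>x \<in> D; y \<in> D\<rbrakk> \<Longrightarrow> A (x + y) = A x + A y"
    and A_scale: "\<And>r x. x \<in> D \<Longrightarrow> A (r *\<^sub>R x) = r *\<^sub>R A x"
    and A_sym: "\<And>x y. \<lbrakk>x \<in> D; y \<in> D\<rbrakk> \<Longrightarrow> inner (A x) y = inner x (A y)"
  obtains E lam where "finite E" "\<forall>e\<in>E. inner e e = 1"
    "\<forall>e\<in>E. \<forall>f\<in>E. e \<noteq> f \<longrightarrow> inner e f = 0" "span E = span S"
    "\<forall>e\<in>E. \<forall>x\<in>span S. inner (A e) x = lam e * inner e x"
proof -
  have normalize: "\<exists>C. finite C \<and> (\<forall>e\<in>C. inner e e = 1) \<and> (\<forall>e\<in>C. \<forall>f\<in>C. e \<noteq> f \<longrightarrow> inner e f = 0) \<and> span C = span B"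
    if "finite B" for B :: "'v set"
  proof -
    obtain C0 where C0: "finite C0" "span C0 = span B" "pairwise orthogonal C0"
      using basis_orthogonal[OF \<open>finite B\<close>] by blast
    define C where "C = (\<lambda>x. (1 / norm x) *\<^sub>R x) ` (C0 - {0})"
    have "span C = span (C0 - {0})" unfolding C_def
      by (rule span_image_scale) (use C0 in auto)
    also have "\<dots> = span B" using C0 by (simp add: span_delete_0)
    finally have "span C = span B" .
    moreover have "\<forall>e\<in>C. inner e e = 1"
      by (auto simp: C_def dot_square_norm power2_eq_square)
    moreover have "\<forall>e\<in>C. \<forall>f\<in>C. e \<noteq> f \<longrightarrow> inner e f = 0"
      using C0(3) by (auto simp: C_def pairwise_def orthogonal_def)
    ultimately show ?thesis using C0(1) by (intro exI[of _ C]) (auto simp: C_def)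
  qed
  have main: "\<exists>E lam. finite E \<and> (\<forall>e\<in>E. inner e e = 1) \<and> (\<forall>e\<in>E. \<forall>f\<in>E. e \<noteq> f \<longrightarrow> inner e f = 0) \<and> span E = span C
     \<and> (\<forall>e\<in>E. \<forall>x\<in>span C. inner (A e) x = lam e * inner e x)"
    if "finite C" "C \<subseteq> D" "\<forall>e\<in>C. inner e e = 1" "\<forall>e\<in>C. \<forall>f\<in>C. e \<noteq> f \<longrightarrow> inner e f = 0" "card C = n" for C :: "'v set" and n
    using that
  proof (induction n arbitrary: C)
    case 0
    then have "C = {}" by simp
    then show ?case by (intro exI[of _ "{}"]) auto
  next
    case (Suc n)
    have "C \<noteq> {}" using Suc.prems by auto
    obtain e0 where e0: "e0 \<in> span C" "inner e0 e0 = 1"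
      and e0_orth: "\<And>x. \<lbrakk>x \<in> span C; inner x e0 = 0\<rbrakk> \<Longrightarrow> inner (A e0) x = 0"
    proof (rule rayleigh_minimizer[of C D A])
      show "finite C" using Suc.prems(5) card.infinite by fastforce
      show "inner e e = 1" if "e \<in> C" for e using that Suc.prems by blast
      show "inner e f = 0" if "e \<in> C" "f \<in> C" "e \<noteq> f" for e f using that Suc.prems by blast
    qed (use D A_add A_scale A_sym Suc.prems \<open>C \<noteq> {}\<close> in auto)
    have spanD: "span C \<subseteq> D" using D Suc.prems by (simp add: span_minimal)
    define pr where "pr = (\<lambda>x. x - inner x e0 *\<^sub>R e0)"
    have pr_orth: "inner (pr x) e0 = 0" for x using e0 by (simp add: pr_def inner_diff_left)
    obtain C' where C': "finite C'" "\<forall>e\<in>C'. inner e e = 1" "\<forall>e\<in>C'. \<forall>f\<in>C'. e \<noteq> f \<longrightarrow> inner e f = 0"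
      "span C' = span (pr ` C)" using normalize[of "pr ` C"] Suc.prems by auto
    have prC: "pr ` C \<subseteq> span C" using e0(1) by (auto simp: pr_def intro: span_diff span_scale span_base)
    have C'C: "span C' \<subseteq> span C" unfolding C'(4) using prC by (rule span_minimal) simp
    have orthC': "inner x e0 = 0" if "x \<in> span C'" for x
      using that[unfolded C'(4)]
    proof (induction rule: span_induct_alt)
      case base then show ?case by simp
    next
      case (step c x y) then show ?case using pr_orth by (auto simp: inner_add_left)
    qed
    have e0C': "e0 \<notin> C'" using orthC'[OF span_base] e0 by auto
    have span_eq: "span (insert e0 C') = span C"
    proof
      show "span (insert e0 C') \<subseteq> span C" using e0 C'C span_superset[of C'] by (intro span_minimal) auto
      have "c \<in> span (insert e0 C')" if "c \<in> C" for c
      proof -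
        have "pr c \<in> span C'" unfolding C'(4) using that by (intro span_base) auto
        then have "pr c \<in> span (insert e0 C')" using span_mono[of C' "insert e0 C'"] by blast
        moreover have "inner c e0 *\<^sub>R e0 \<in> span (insert e0 C')" by (intro span_scale span_base) auto
        ultimately have "pr c + inner c e0 *\<^sub>R e0 \<in> span (insert e0 C')" by (rule span_add)
        then show ?thesis by (simp add: pr_def)
      qed
      then show "span C \<subseteq> span (insert e0 C')" by (intro span_minimal) auto
    qed
    have orth_ins: "\<forall>e\<in>insert e0 C'. \<forall>f\<in>insert e0 C'. e \<noteq> f \<longrightarrow> inner e f = 0"
      using C'(3) orthC'[OF span_base] by (auto simp: inner_commute)
    have "independent (insert e0 C')"
    proof (rule pairwise_orthogonal_independent)
      show "pairwise orthogonal (insert e0 C')" using orth_ins by (auto simp: pairwise_def orthogonal_def)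
      show "0 \<notin> insert e0 C'" using e0 C'(2) by force
    qed
    then have "card (insert e0 C') \<le> card C"
      using independent_span_bound[of C "insert e0 C'"] Suc.prems(1) span_eq span_superset[of "insert e0 C'"] by simp
    moreover have "independent C"
    proof (rule pairwise_orthogonal_independent)
      show "pairwise orthogonal C" using Suc.prems by (auto simp: pairwise_def orthogonal_def)
      show "0 \<notin> C" using Suc.prems by force
    qed
    then have "card C \<le> card (insert e0 C')"
      using independent_span_bound[of "insert e0 C'" C] C'(1) span_eq span_superset[of C] by simp
    ultimately have "card C' = n" using Suc.prems C'(1) e0C' by simp
    moreover have "C' \<subseteq> D" using C'C spanD span_superset[of C'] by (meson subset_trans)
    ultimately have "\<exists>E lam. finite E \<and> (\<forall>e\<in>E. inner e e = 1) \<and> (\<forall>e\<in>E. \<forall>f\<in>E. e \<noteq> f \<longrightarrow> inner e f = 0) \<and> span E = span C'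
      \<and> (\<forall>e\<in>E. \<forall>x\<in>span C'. inner (A e) x = lam e * inner e x)"
      by (intro Suc.IH C'(1-3))
    then obtain E lam where E: "finite E" "\<forall>e\<in>E. inner e e = 1" "\<forall>e\<in>E. \<forall>f\<in>E. e \<noteq> f \<longrightarrow> inner e f = 0"
      "span E = span C'" "\<forall>e\<in>E. \<forall>x\<in>span C'. inner (A e) x = lam e * inner e x"
      by (elim exE conjE)
    have orthE: "inner e e0 = 0" if "e \<in> E" for e using orthC' E(4) that span_base by blast
    have e0E: "e0 \<notin> E" using orthE e0 by fastforce
    define lam' where "lam' = lam(e0 := inner (A e0) e0)"
    have "inner (A e) x = lam' e * inner e x" if "e \<in> insert e0 E" "x \<in> span C" for e x
    proof -
      have x: "x = pr x + inner x e0 *\<^sub>R e0" by (simp add: pr_def)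
      have prx: "pr x \<in> span C" using that e0 unfolding pr_def by (intro span_diff span_scale) auto
      have Ae0: "inner (A e0) x = inner x e0 * inner (A e0) e0"
        using e0_orth[OF prx pr_orth] by (subst x) (simp add: inner_add_right)
      show ?thesis
      proof (cases "e = e0")
        case True then show ?thesis using Ae0 by (simp add: lam'_def inner_commute)
      next
        case False
        then have e: "e \<in> E" using that by simp
        have eC: "e \<in> span C" using e E(4) C'C span_base by blast
        have "inner (A e) e0 = inner (A e0) e"
          using A_sym[of e e0] spanD eC e0 by (auto simp: inner_commute)
        also have "\<dots> = 0" using e0_orth[OF eC orthE[OF e]] .
        finally have 0: "inner (A e) e0 = 0" .
        have "x \<in> span (insert e0 C')" using that span_eq by simp
        then obtain k where k: "x - k *\<^sub>R e0 \<in> span C'" by (auto simp: span_breakdown_eq)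
        have "inner (A e) (x - k *\<^sub>R e0) = lam e * inner e (x - k *\<^sub>R e0)" using E(5) e k by blast
        then have "inner (A e) x = lam e * inner e x"
          using 0 orthE[OF e] by (simp add: inner_diff_right)
        then show ?thesis using False by (simp add: lam'_def)
      qed
    qed
    moreover have "span (insert e0 E) = span C"
      using E(4) span_eq by (metis span_insert)
    moreover have "\<forall>e\<in>insert e0 E. \<forall>f\<in>insert e0 E. e \<noteq> f \<longrightarrow> inner e f = 0"
      using E(3) orthE by (auto simp: inner_commute)
    ultimately show ?case using E(1,2) e0
      by (intro exI[of _ "insert e0 E"] exI[of _ lam']) simp
  qed
  obtain C where C: "finite C" "\<forall>e\<in>C. inner e e = 1" "\<forall>e\<in>C. \<forall>f\<in>C. e \<noteq> f \<longrightarrow> inner e f = 0" "span C = span S"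
    using normalize[OF D(2)] by auto
  have "C \<subseteq> D" using C(4) span_superset[of C] span_minimal[OF D(3,1)] by simp
  have "\<exists>E lam. finite E \<and> (\<forall>e\<in>E. inner e e = 1) \<and> (\<forall>e\<in>E. \<forall>f\<in>E. e \<noteq> f \<longrightarrow> inner e f = 0) \<and> span E = span C
     \<and> (\<forall>e\<in>E. \<forall>x\<in>span C. inner (A e) x = lam e * inner e x)"
    by (rule main[OF C(1) \<open>C \<subseteq> D\<close> C(2,3) refl])
  then obtain E lam where E: "finite E" "\<forall>e\<in>E. inner e e = 1" "\<forall>e\<in>E. \<forall>f\<in>E. e \<noteq> f \<longrightarrow> inner e f = 0"
      "span E = span C" "\<forall>e\<in>E. \<forall>x\<in>span C. inner (A e) x = lam e * inner e x"
    by (elim exE conjE)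
  show ?thesis
    by (rule that[of E lam]) (use E C(4) in auto)
qed

section \<open>The spectral flow of a finite compression\<close>

text \<open>The exponent \<open>3 * R * S\<close> collects the factor \<open>exp (- lam * t)\<close>, at most \<open>exp (R * S)\<close>, and the Taylor remainder, whose intermediate point is bounded by \<open>lam * \<bar>t' - t\<bar> \<le> 2 * R * S\<close>.\<close>

lemma exp_taylor_bound:
  fixes lam t t' S R :: real
  assumes "0 \<le> lam" "lam \<le> R" "\<bar>t\<bar> \<le> S" "\<bar>t'\<bar> \<le> S"
  shows "\<bar>exp (- lam * t') - exp (- lam * t) + (t' - t) * (lam * exp (- lam * t))\<bar>
    \<le> exp (3 * R * S) * ((t' - t)\<^sup>2 * lam\<^sup>2)"
proof -
  define d where "d = - lam * (t' - t)"
  obtain s where s: "\<bar>s\<bar> \<le> \<bar>d\<bar>" "exp d = (\<Sum>m<2. d ^ m / fact m) + exp s / fact 2 * d ^ 2"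
    using Maclaurin_exp_le[of d 2] by blast
  have e: "exp d - 1 - d = exp s / 2 * d\<^sup>2"
    using s(2) by (simp add: numeral_2_eq_2)
  have "exp (- lam * t') = exp (- lam * t) * exp d"
    by (simp add: d_def exp_add[symmetric] algebra_simps)
  then have "exp (- lam * t') - exp (- lam * t) + (t' - t) * (lam * exp (- lam * t)) = exp (- lam * t) * (exp d - 1 - d)"
    by (simp add: d_def algebra_simps)
  also have "\<dots> = exp (- lam * t + s) / 2 * d\<^sup>2" by (simp only: e exp_add) simp
  finally have "\<bar>exp (- lam * t') - exp (- lam * t) + (t' - t) * (lam * exp (- lam * t))\<bar>
    = \<bar>exp (- lam * t + s) / 2 * d\<^sup>2\<bar>" by (rule arg_cong)
  also have "\<dots> = exp (- lam * t + s) / 2 * d\<^sup>2" by (simp add: abs_mult)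
  also have "\<dots> \<le> exp (3 * R * S) * d\<^sup>2"
  proof (intro mult_right_mono)
    have "- (lam * t) \<le> lam * S" using assms mult_left_mono[of "-t" S lam] by auto
    moreover have "\<bar>t' - t\<bar> \<le> 2 * S" using assms by auto
    then have "s \<le> lam * (2 * S)" using s(1) assms mult_left_mono[of "\<bar>t' - t\<bar>" "2 * S" lam]
      by (auto simp: d_def abs_mult)
    moreover have "lam * S \<le> R * S" using assms by (intro mult_right_mono) auto
    ultimately have "- lam * t + s \<le> 3 * R * S" by (simp add: algebra_simps)
    then have "exp (- lam * t + s) \<le> exp (3 * R * S)" by simp
    then show "exp (- lam * t + s) / 2 \<le> exp (3 * R * S)" using exp_gt_zero[of "- lam * t + s"] by linarith
  qed simp
  finally have bound: "\<bar>exp (- lam * t') - exp (- lam * t) + (t' - t) * (lam * exp (- lam * t))\<bar>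
    \<le> exp (3 * R * S) * d\<^sup>2" .
  have "d\<^sup>2 = (t' - t)\<^sup>2 * lam\<^sup>2" by (simp add: d_def power_mult_distrib)
  then show ?thesis using bound by (simp only:)
qed

text \<open>A geometric sum is at most twice its last term. This linear bound in \<open>lam\<close> is what the dyadic choice of levels is for.\<close>

lemma dyadic_sum_bound:
  fixes lam M :: real
  assumes "M > 0" "lam \<ge> 0"
  shows "(\<Sum>i<I. if M * 2 ^ i < lam then 2 ^ i else (0::real)) \<le> 2 * lam / M"
proof (induction I)
  case 0 then show ?case using assms by simp
next
  case (Suc I)
  show ?case
  proof (cases "M * 2 ^ I < lam")
    case True
    have "(\<Sum>i<Suc I. if M * 2 ^ i < lam then 2 ^ i else (0::real)) \<le> (\<Sum>i<Suc I. 2 ^ i)"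
      by (intro sum_mono) auto
    also have "\<dots> \<le> 2 * 2 ^ I" by (simp add: sum_power2 flip: lessThan_atLeast0) (simp add: geometric_sum)
    also have "\<dots> \<le> 2 * lam / M" using True assms by (simp add: field_simps)
    finally show ?thesis .
  next
    case False then show ?thesis using Suc by simp
  qed
qed

text \<open>The intended case is a differential operator on test functions. Completeness is replaced by taking all limits in the sense of pairings with vectors of \<open>D\<close>.\<close>

locale nonneg_symmetric =
  fixes D :: "'v::real_inner set" and A :: "'v \<Rightarrow> 'v"
  assumes D: "subspace D"
    and A_in: "\<And>x. x \<in> D \<Longrightarrow> A x \<in> D"
    and A_add: "\<And>x y. \<lbrakk>x \<in> D; y \<in> D\<rbrakk> \<Longrightarrow> A (x + y) = A x + A y"
    and A_scale: "\<And>r x. x \<in> D \<Longrightarrow> A (r *\<^sub>R x) = r *\<^sub>R A x"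
    and A_sym: "\<And>x y. \<lbrakk>x \<in> D; y \<in> D\<rbrakk> \<Longrightarrow> inner (A x) y = inner x (A y)"
    and A_nonneg: "\<And>x. x \<in> D \<Longrightarrow> 0 \<le> inner (A x) x"
begin

text \<open>The values \<open>l t x\<close> stand for the pairings of \<open>x\<close> with a solution of \<open>v' = - A v\<close>. The equation is encoded by a first-order Taylor inequality with quadratic remainder, a condition on finitely many values of \<open>l\<close> at a time, so that all conditions pass to pointwise limits.\<close>

definition weak_flow :: "real \<Rightarrow> real \<Rightarrow> (real \<Rightarrow> 'v \<Rightarrow> real) \<Rightarrow> bool" where
  "weak_flow S c l \<longleftrightarrow>
    (\<forall>t. \<forall>x\<in>D. \<forall>y\<in>D. l t (x + y) = l t x + l t y) \<and>
    (\<forall>t r. \<forall>x\<in>D. l t (r *\<^sub>R x) = r * l t x) \<and>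
    (\<forall>t\<in>{-S..S}. \<forall>x\<in>D. \<bar>l t x\<bar> \<le> c * norm x) \<and>
    (\<forall>t\<in>{-S..S}. \<forall>t'\<in>{-S..S}. \<forall>x\<in>D.
      \<bar>l t' x - l t x + (t' - t) * l t (A x)\<bar> \<le> c * ((t' - t)\<^sup>2 * norm (A (A x))))"

text \<open>Exponentials of the compression of \<open>A\<close> to the span of \<open>F\<close>, truncated at the eigenvalue \<open>M * 2 ^ i\<close>. Against vectors \<open>x\<close> with \<open>x\<close> and \<open>A x\<close> in \<open>F\<close> the compression cannot be distinguished from \<open>A\<close>, so the evolution equation holds exactly. In the last property the difference is the pairing of \<open>h i\<close> with the part of \<open>u\<close> above the level \<open>M * 2 ^ i\<close>, and the dyadic sum of the squared norms of these parts is controlled by the quadratic form.\<close>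

lemma galerkin_flow:
  assumes F: "finite F" "F \<subseteq> D" "u \<in> F" and M: "M > 0" and S: "S \<ge> 0"
  obtains l :: "nat \<Rightarrow> real \<Rightarrow> 'v \<Rightarrow> real" where
    "\<And>i t x y. l i t (x + y) = l i t x + l i t y"
    "\<And>i t r x. l i t (r *\<^sub>R x) = r * l i t x"
    "\<And>i t x. \<bar>l i t x\<bar> \<le> exp (M * 2 ^ i * \<bar>t\<bar>) * norm u * norm x"
    "\<And>i t t' x. \<lbrakk>\<bar>t\<bar> \<le> S; \<bar>t'\<bar> \<le> S; x \<in> F; A x \<in> F\<rbrakk> \<Longrightarrow>
      \<bar>l i t' x - l i t x + (t' - t) * l i t (A x)\<bar> \<le> (exp (3 * (M * 2 ^ i) * S) * norm u) * ((t' - t)\<^sup>2 * norm (A (A x)))"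
    "\<And>I h. 2 * (\<Sum>i<I. 2 ^ i * (inner u (h i) - l i 0 (h i))) \<le> 2 / M * inner (A u) u + (\<Sum>i<I. 2 ^ i * (norm (h i))\<^sup>2)"
proof -
  obtain E lam where E0: "finite E" "\<forall>e\<in>E. inner e e = 1"
    "\<forall>e\<in>E. \<forall>f\<in>E. e \<noteq> f \<longrightarrow> inner e f = 0" "span E = span F"
    "\<forall>e\<in>E. \<forall>x\<in>span F. inner (A e) x = lam e * inner e x"
    by (rule compression_eigenbasis[OF D F(1,2) A_add A_scale A_sym])
  have E: "finite E" "\<And>e. e \<in> E \<Longrightarrow> inner e e = 1"
    "\<And>e f. \<lbrakk>e \<in> E; f \<in> E; e \<noteq> f\<rbrakk> \<Longrightarrow> inner e f = 0" "span E = span F"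
    using E0 by blast+
  have eig: "\<And>e x. \<lbrakk>e \<in> E; x \<in> span F\<rbrakk> \<Longrightarrow> inner (A e) x = lam e * inner e x"
    using E0(5) by blast
  note onE = E(1,2,3)
  have FD: "span F \<subseteq> D" using D F by (simp add: span_minimal)
  have ED: "e \<in> D" if "e \<in> E" for e using that E(4) FD span_base by blast
  have eig': "inner e (A x) = lam e * inner e x" if "e \<in> E" "x \<in> F" for e x
    using A_sym[of e x] ED that F eig[of e x] span_base[of x F] by auto
  have lam0: "lam e \<ge> 0" if "e \<in> E" for e
    using A_nonneg[OF ED[OF that]] eig[of e e] that E(2)[of e] E(4) span_base[of e E] by auto
  have uE: "u = (\<Sum>e\<in>E. inner u e *\<^sub>R e)"
    using orthonormal_expand[OF onE, of u] F E(4) span_base[of u F] by auto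
  have bessel: "norm (\<Sum>e\<in>E. (a e * inner u e) *\<^sub>R e) \<le> B * norm u"
    if "\<And>e. e \<in> E \<Longrightarrow> \<bar>a e\<bar> \<le> B" "B \<ge> 0" for a :: "'v \<Rightarrow> real" and B
  proof (rule power2_le_imp_le)
    have "(norm (\<Sum>e\<in>E. (a e * inner u e) *\<^sub>R e))\<^sup>2 = (\<Sum>e\<in>E. (a e * inner u e)\<^sup>2)"
      by (rule orthonormal_parseval[OF onE])
    also have "\<dots> \<le> (\<Sum>e\<in>E. B\<^sup>2 * (inner u e)\<^sup>2)"
      by (intro sum_mono) (auto simp: power_mult_distrib intro!: mult_right_mono abs_le_square_iff[THEN iffD1] that order.trans[OF that(1)])
    also have "\<dots> = B\<^sup>2 * (norm (\<Sum>e\<in>E. inner u e *\<^sub>R e))\<^sup>2"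
      by (simp add: orthonormal_parseval[OF onE] sum_distrib_left)
    also have "\<dots> = (B * norm u)\<^sup>2" using uE by (simp add: power_mult_distrib)
    finally show "(norm (\<Sum>e\<in>E. (a e * inner u e) *\<^sub>R e))\<^sup>2 \<le> (B * norm u)\<^sup>2" .
  qed (use that in auto)
  define R where "R = (\<lambda>i::nat. M * 2 ^ i)"
  have R0: "R i > 0" for i using M by (simp add: R_def)
  define k where "k = (\<lambda>i t e. if lam e \<le> R i then exp (- lam e * t) else 0)"
  define q where "q = (\<lambda>i t. \<Sum>e\<in>E. (k i t e * inner u e) *\<^sub>R e)"
  define l where "l = (\<lambda>i t x. inner (q i t) x)"
  have q_inner: "inner (q i t) x = (\<Sum>e\<in>E. k i t e * inner u e * inner e x)" for i t x
    by (simp add: q_def inner_sum_left)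
  show ?thesis
  proof (rule that[of l])
    fix i t x
    have "\<bar>k i t e\<bar> \<le> exp (M * 2 ^ i * \<bar>t\<bar>)" if "e \<in> E" for e
    proof -
      have "- lam e * t \<le> R i * \<bar>t\<bar>" if "lam e \<le> R i"
      proof -
        have "- lam e * t \<le> lam e * \<bar>t\<bar>" using lam0[OF \<open>e \<in> E\<close>] mult_left_mono[of "-t" "\<bar>t\<bar>" "lam e"] by simp
        also have "\<dots> \<le> R i * \<bar>t\<bar>" using that by (intro mult_right_mono) auto
        finally show ?thesis .
      qed
      then show ?thesis by (auto simp: k_def R_def)
    qed
    then have "norm (q i t) \<le> exp (M * 2 ^ i * \<bar>t\<bar>) * norm u" unfolding q_def by (intro bessel) auto
    then show "\<bar>l i t x\<bar> \<le> exp (M * 2 ^ i * \<bar>t\<bar>) * norm u * norm x"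
      unfolding l_def by (intro order.trans[OF Cauchy_Schwarz_ineq2] mult_right_mono) auto
  next
    fix i t t' x assume tt: "\<bar>t\<bar> \<le> S" "\<bar>t'\<bar> \<le> S" and x: "x \<in> F" "A x \<in> F"
    define B where "B = exp (3 * (M * 2 ^ i) * S) * (t' - t)\<^sup>2"
    \<comment> \<open>the remainder divided by \<open>(lam e)\<^sup>2\<close>, so that the two missing factors can be moved onto \<open>x\<close> as \<open>A (A x)\<close>\<close>
    define a where "a = (\<lambda>e. if lam e = 0 then 0 else (k i t' e - k i t e + (t' - t) * (lam e * k i t e)) / (lam e)\<^sup>2)"
    have ka: "k i t' e - k i t e + (t' - t) * (lam e * k i t e) = a e * (lam e)\<^sup>2" if "e \<in> E" for e
      by (auto simp: a_def k_def)
    have "\<bar>a e\<bar> \<le> B" if "e \<in> E" for e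
    proof (cases "lam e = 0 \<or> \<not> lam e \<le> R i")
      case True then show ?thesis by (auto simp: a_def B_def k_def)
    next
      case False
      define X where "X = exp (- lam e * t') - exp (- lam e * t) + (t' - t) * (lam e * exp (- lam e * t))"
      have "\<bar>X\<bar> \<le> exp (3 * R i * S) * ((t' - t)\<^sup>2 * (lam e)\<^sup>2)"
        unfolding X_def using False by (intro exp_taylor_bound[OF lam0[OF that] _ tt]) auto
      then have X: "\<bar>X\<bar> \<le> B * (lam e)\<^sup>2" by (simp only: B_def R_def mult.assoc)
      have "a e = X / (lam e)\<^sup>2" using False by (simp add: a_def k_def X_def)
      then have "\<bar>a e\<bar> = \<bar>X\<bar> / (lam e)\<^sup>2" by simp
      also have "\<dots> \<le> B * (lam e)\<^sup>2 / (lam e)\<^sup>2" using X by (rule divide_right_mono) simp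
      finally show ?thesis using False by simp
    qed
    moreover have "B \<ge> 0" by (simp add: B_def)
    ultimately have n: "norm (\<Sum>e\<in>E. (a e * inner u e) *\<^sub>R e) \<le> B * norm u" by (rule bessel)
    have lA: "l i t (A x) = (\<Sum>e\<in>E. lam e * k i t e * inner u e * inner e x)"
      unfolding l_def q_inner by (intro sum.cong) (simp_all add: eig' x)
    have "l i t' x - l i t x + (t' - t) * l i t (A x)
        = (\<Sum>e\<in>E. (k i t' e - k i t e + (t' - t) * (lam e * k i t e)) * inner u e * inner e x)"
      unfolding lA by (simp add: l_def q_inner sum_distrib_left left_diff_distrib distrib_right sum_subtractf sum.distrib mult.assoc)
    also have "\<dots> = (\<Sum>e\<in>E. a e * inner u e * inner e (A (A x)))"
      by (intro sum.cong) (simp_all add: ka eig' x power2_eq_square)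
    also have "\<dots> = inner (\<Sum>e\<in>E. (a e * inner u e) *\<^sub>R e) (A (A x))" by (simp add: inner_sum_left)
    also have "\<bar>\<dots>\<bar> \<le> B * norm u * norm (A (A x))"
      using n by (intro order.trans[OF Cauchy_Schwarz_ineq2] mult_right_mono) auto
    finally show "\<bar>l i t' x - l i t x + (t' - t) * l i t (A x)\<bar>
      \<le> (exp (3 * (M * 2 ^ i) * S) * norm u) * ((t' - t)\<^sup>2 * norm (A (A x)))" by (simp add: B_def mult_ac)
  next
    fix I and h :: "nat \<Rightarrow> 'v"
    define p where "p = (\<lambda>i. \<Sum>e\<in>E. (if R i < lam e then inner u e else 0) *\<^sub>R e)"
    have up: "u - q i 0 = p i" for i
      by (subst uE, unfold q_def p_def sum_subtractf[symmetric]) (auto intro!: sum.cong simp: k_def)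
    have "2 * (inner u (h i) - l i 0 (h i)) \<le> (norm (p i))\<^sup>2 + (norm (h i))\<^sup>2" for i
    proof -
      have "inner u (h i) - l i 0 (h i) = inner (p i) (h i)" by (simp add: l_def up[symmetric] inner_diff_left)
      moreover have "0 \<le> (norm (p i - h i))\<^sup>2" by simp
      then have "2 * inner (p i) (h i) \<le> (norm (p i))\<^sup>2 + (norm (h i))\<^sup>2"
        by (simp add: power2_norm_eq_inner inner_diff inner_commute)
      ultimately show ?thesis by simp
    qed
    then have "(\<Sum>i<I. 2 ^ i * (2 * (inner u (h i) - l i 0 (h i)))) \<le> (\<Sum>i<I. 2 ^ i * ((norm (p i))\<^sup>2 + (norm (h i))\<^sup>2))"
      by (intro sum_mono mult_left_mono) auto
    then have 1: "2 * (\<Sum>i<I. 2 ^ i * (inner u (h i) - l i 0 (h i))) \<le> (\<Sum>i<I. 2 ^ i * (norm (p i))\<^sup>2) + (\<Sum>i<I. 2 ^ i * (norm (h i))\<^sup>2)"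
      by (simp add: sum_distrib_left sum.distrib algebra_simps)
    have "(\<Sum>i<I. 2 ^ i * (norm (p i))\<^sup>2) = (\<Sum>i<I. \<Sum>e\<in>E. (if R i < lam e then 2 ^ i else 0) * (inner u e)\<^sup>2)"
    proof (rule sum.cong[OF refl])
      fix i
      have "(norm (p i))\<^sup>2 = (\<Sum>e\<in>E. (if R i < lam e then inner u e else 0)\<^sup>2)"
        unfolding p_def by (rule orthonormal_parseval[OF onE])
      then show "2 ^ i * (norm (p i))\<^sup>2 = (\<Sum>e\<in>E. (if R i < lam e then 2 ^ i else 0) * (inner u e)\<^sup>2)"
        by (simp only: sum_distrib_left) (auto intro!: sum.cong)
    qed
    also have "\<dots> = (\<Sum>e\<in>E. (\<Sum>i<I. if R i < lam e then 2 ^ i else 0) * (inner u e)\<^sup>2)"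
      by (subst sum.swap) (simp add: sum_distrib_right)
    also have "\<dots> \<le> (\<Sum>e\<in>E. (2 * lam e / M) * (inner u e)\<^sup>2)"
      unfolding R_def using lam0 by (intro sum_mono mult_right_mono dyadic_sum_bound[OF M]) auto
    also have "\<dots> = 2 / M * (\<Sum>e\<in>E. inner u e * inner e (A u))"
      unfolding sum_distrib_left by (intro sum.cong) (simp_all add: eig' F power2_eq_square inner_commute)
    also have "(\<Sum>e\<in>E. inner u e * inner e (A u)) = inner (\<Sum>e\<in>E. inner u e *\<^sub>R e) (A u)" by (simp add: inner_sum_left)
    also have "\<dots> = inner (A u) u" using uE by (simp add: inner_commute)
    finally show "2 * (\<Sum>i<I. 2 ^ i * (inner u (h i) - l i 0 (h i))) \<le> 2 / M * inner (A u) u + (\<Sum>i<I. 2 ^ i * (norm (h i))\<^sup>2)"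
      using 1 by simp
  qed (simp_all add: l_def inner_add_right)
qed

end

section \<open>Weak flows\<close>

text \<open>A filter version of the choice of a convergent subnet; the index set of the coordinates may be uncountable.\<close>

lemma tychonoff_cluster_filter:
  fixes x :: "'s \<Rightarrow> 'p \<Rightarrow> real"
  assumes F: "F \<noteq> bot" and bound: "\<And>s p. \<bar>x s p\<bar> \<le> B p"
  shows "\<exists>G z. G \<noteq> bot \<and> G \<le> F \<and> (\<forall>p. ((\<lambda>s. x s p) \<longlongrightarrow> z p) G)"
proof -
  let ?K = "PiE UNIV (\<lambda>p. {-B p..B p})"
  have "compactin (product_topology (\<lambda>i::'p. (euclidean :: real topology)) UNIV) ?K"
    by (subst compactin_PiE) auto
  then have "compact ?K" by (simp only: euclidean_product_topology compactin_euclidean_iff)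
  moreover have "filtermap x F \<noteq> bot" using F by (simp add: filtermap_bot_iff)
  moreover have "eventually (\<lambda>y. y \<in> ?K) (filtermap x F)"
    unfolding eventually_filtermap using bound by (intro always_eventually) (auto simp: abs_le_iff minus_le_iff)
  ultimately obtain z where z: "inf (nhds z) (filtermap x F) \<noteq> bot"
    unfolding compact_filter by blast
  define G where "G = inf (filtercomap x (nhds z)) F"
  have "G \<noteq> bot"
  proof
    assume "G = bot"
    then have "eventually (\<lambda>_. False) G" by simp
    then obtain P Q where PQ: "eventually P (filtercomap x (nhds z))" "eventually Q F" "\<forall>s. P s \<and> Q s \<longrightarrow> False"
      unfolding G_def eventually_inf by blast
    then obtain P' where P': "eventually P' (nhds z)" "\<forall>s. P' (x s) \<longrightarrow> P s"
      unfolding eventually_filtercomap by blast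
    have "eventually (\<lambda>y. \<not> P' y) (filtermap x F)" unfolding eventually_filtermap
      using PQ(2) by eventually_elim (use PQ P' in blast)
    then have "eventually (\<lambda>_. False) (inf (nhds z) (filtermap x F))"
      unfolding eventually_inf using P'(1) by blast
    then show False using z by (simp add: eventually_False)
  qed
  moreover have "G \<le> F" by (simp add: G_def)
  moreover have "((\<lambda>s. x s p) \<longlongrightarrow> z p) G" for p
  proof -
    have xG: "(x \<longlongrightarrow> z) G"
      by (rule filterlim_mono[OF filterlim_filtercomap order_refl]) (simp add: G_def)
    show ?thesis
    proof (rule topological_tendstoI)
      fix U :: "real set" assume U: "open U" "z p \<in> U"
      have "open ((\<lambda>y::'p \<Rightarrow> real. y p) -` U)"
        by (rule open_vimage[OF U(1) continuous_on_product_coordinates])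
      then have "eventually (\<lambda>s. x s \<in> (\<lambda>y. y p) -` U) G" using U(2) by (intro topological_tendstoD[OF xG]) auto
      then show "eventually (\<lambda>s. x s p \<in> U) G" by simp
    qed
  qed
  ultimately show ?thesis by (intro exI[of _ G] exI[of _ z] conjI allI)
qed

context nonneg_symmetric
begin

text \<open>The functional \<open>l i t\<close> plays the role of the pairing with \<open>exp (- t * A)\<close> applied to the part of \<open>u\<close> in the spectral subspace \<open>A \<le> M * 2 ^ i\<close>. It is a limit of Galerkin flows over the finite subsets of \<open>D\<close>: each \<open>x\<close> eventually belongs to them together with \<open>A x\<close>, and the final inequality survives because it is affine in \<open>l\<close>. One filter serves all levels \<open>i\<close> at once, which the sum over \<open>i\<close> requires.\<close>

theorem spectral_weak_flows:
  assumes u: "u \<in> D" and M: "M > 0" and S: "S \<ge> 0"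
  obtains l :: "nat \<Rightarrow> real \<Rightarrow> 'v \<Rightarrow> real" where
    "\<forall>i. weak_flow S (exp (3 * (M * 2 ^ i) * S) * norm u) (l i)"
    "\<forall>I h. (\<forall>i. h i \<in> D) \<longrightarrow>
      2 * (\<Sum>i<I. 2 ^ i * (inner u (h i) - l i 0 (h i))) \<le> 2 / M * inner (A u) u + (\<Sum>i<I. 2 ^ i * (norm (h i))\<^sup>2)"
proof -
  define good where "good = (\<lambda>F (l :: nat \<Rightarrow> real \<Rightarrow> 'v \<Rightarrow> real).
    (\<forall>i t x y. l i t (x + y) = l i t x + l i t y) \<and>
    (\<forall>i t r x. l i t (r *\<^sub>R x) = r * l i t x) \<and>
    (\<forall>i t x. \<bar>l i t x\<bar> \<le> exp (M * 2 ^ i * \<bar>t\<bar>) * norm u * norm x) \<and>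
    (\<forall>i t t' x. \<bar>t\<bar> \<le> S \<longrightarrow> \<bar>t'\<bar> \<le> S \<longrightarrow> x \<in> F \<longrightarrow> A x \<in> F \<longrightarrow>
      \<bar>l i t' x - l i t x + (t' - t) * l i t (A x)\<bar> \<le> (exp (3 * (M * 2 ^ i) * S) * norm u) * ((t' - t)\<^sup>2 * norm (A (A x)))) \<and>
    (\<forall>I h. 2 * (\<Sum>i<I. 2 ^ i * (inner u (h i) - l i 0 (h i))) \<le> 2 / M * inner (A u) u + (\<Sum>i<I. 2 ^ i * (norm (h i))\<^sup>2)))"
  have ex: "\<exists>l. good (F \<inter> D \<union> {u}) l" if "finite F" for F
  proof -
    define F' where "F' = F \<inter> D \<union> {u}"
    have F': "finite F'" "F' \<subseteq> D" "u \<in> F'" using that u by (auto simp: F'_def)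
    have "\<exists>l. good F' l"
    proof (rule galerkin_flow[OF F' M S], goal_cases)
      case (1 l)
      show ?case unfolding good_def
        by (intro exI[of _ l] conjI allI impI 1(1-5))
    qed
    then show ?thesis by (simp only: F'_def)
  qed
  define L where "L = (\<lambda>F. SOME l. good ((if finite F then F \<inter> D else {}) \<union> {u}) l)"
  have L: "good ((if finite F then F \<inter> D else {}) \<union> {u}) (L F)" for F
  proof -
    have "\<exists>l. good ((if finite F then F \<inter> D else {}) \<union> {u}) l" using ex[of F] ex[of "{}"] by (cases "finite F") simp_all
    then show ?thesis unfolding L_def by (rule someI_ex)
  qed
  define Y where "Y = (\<lambda>F p. case p of (i, t, x) \<Rightarrow> L F i t x)"
  define B where "B = (\<lambda>p. case p of (i, t, x) \<Rightarrow> exp (M * 2 ^ i * \<bar>t\<bar>) * norm u * norm (x :: 'v))"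
  have Lb: "\<bar>Y F p\<bar> \<le> B p" for F p
    using L[of F] by (auto simp: good_def Y_def B_def split: prod.splits)
  obtain G z where G: "G \<noteq> bot" "G \<le> finite_subsets_at_top D"
    and z: "\<forall>p. ((\<lambda>F. Y F p) \<longlongrightarrow> z p) G"
    using tychonoff_cluster_filter[of "finite_subsets_at_top D" Y B, OF finite_subsets_at_top_neq_bot Lb] by (elim exE conjE)
  define l where "l = (\<lambda>i t x. z (i, t, x))"
  have lim: "((\<lambda>F. L F i t x) \<longlongrightarrow> l i t x) G" for i t x using z[rule_format, of "(i, t, x)"] by (simp add: l_def Y_def)
  have evG: "eventually P G" if "eventually P (finite_subsets_at_top D)" for P using G(2) that by (rule filter_leD)
  have mem: "eventually (\<lambda>F. x \<in> (if finite F then F \<inter> D else {})) G" if "x \<in> D" for x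
  proof (rule evG, unfold eventually_finite_subsets_at_top, intro exI[of _ "{x}"] conjI allI impI)
    fix Y assume "finite Y \<and> {x} \<subseteq> Y \<and> Y \<subseteq> D"
    then show "x \<in> (if finite Y then Y \<inter> D else {})" using that by auto
  qed (use that in auto)
  have le: "a \<le> b" if "(f \<longlongrightarrow> a) G" "eventually (\<lambda>F. f F \<le> b) G" for f :: "_ \<Rightarrow> real" and a b
    using tendsto_upperbound[OF that G(1)] .
  have wf: "weak_flow S (exp (3 * (M * 2 ^ i) * S) * norm u) (l i)" for i
    unfolding weak_flow_def
  proof (intro conjI ballI allI)
    fix t x y
    have "L F i t (x + y) = L F i t x + L F i t y" for F using L[of F] by (simp add: good_def)
    then show "l i t (x + y) = l i t x + l i t y"
      using lim[of i t "x + y"] tendsto_add[OF lim[of i t x] lim[of i t y]] G(1) tendsto_unique by fastforce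
  next
    fix t r x
    have "L F i t (r *\<^sub>R x) = r * L F i t x" for F using L[of F] by (simp add: good_def)
    then show "l i t (r *\<^sub>R x) = r * l i t x"
      using lim[of i t "r *\<^sub>R x"] tendsto_mult_left[OF lim[of i t x], of r] G(1) tendsto_unique by fastforce
  next
    fix t x assume t: "t \<in> {-S..S}"
    show "\<bar>l i t x\<bar> \<le> exp (3 * (M * 2 ^ i) * S) * norm u * norm x"
    proof (rule le[OF tendsto_rabs[OF lim]], intro always_eventually allI)
      fix F
      have "M * 2 ^ i * \<bar>t\<bar> \<le> M * 2 ^ i * S" using t M by (intro mult_left_mono) auto
      also have "\<dots> \<le> 3 * (M * 2 ^ i) * S" using M S by simp
      finally have "exp (M * 2 ^ i * \<bar>t\<bar>) * norm u * norm x \<le> exp (3 * (M * 2 ^ i) * S) * norm u * norm x"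
        by (intro mult_right_mono) auto
      moreover have "\<bar>L F i t x\<bar> \<le> exp (M * 2 ^ i * \<bar>t\<bar>) * norm u * norm x" using L[of F] by (simp add: good_def)
      ultimately show "\<bar>L F i t x\<bar> \<le> exp (3 * (M * 2 ^ i) * S) * norm u * norm x" by linarith
    qed
  next
    fix t t' x assume t: "t \<in> {-S..S}" "t' \<in> {-S..S}" and x: "x \<in> D"
    show "\<bar>l i t' x - l i t x + (t' - t) * l i t (A x)\<bar> \<le> exp (3 * (M * 2 ^ i) * S) * norm u * ((t' - t)\<^sup>2 * norm (A (A x)))"
    proof (rule le)
      show "((\<lambda>F. \<bar>L F i t' x - L F i t x + (t' - t) * L F i t (A x)\<bar>) \<longlongrightarrow> \<bar>l i t' x - l i t x + (t' - t) * l i t (A x)\<bar>) G"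
        by (intro tendsto_intros lim)
      show "eventually (\<lambda>F. \<bar>L F i t' x - L F i t x + (t' - t) * L F i t (A x)\<bar> \<le> exp (3 * (M * 2 ^ i) * S) * norm u * ((t' - t)\<^sup>2 * norm (A (A x)))) G"
        using mem[OF x] mem[OF A_in[OF x]]
      proof eventually_elim
        case (elim F)
        have "\<bar>t\<bar> \<le> S" "\<bar>t'\<bar> \<le> S" using t by (auto simp: abs_le_iff)
        then show ?case using L[of F] elim unfolding good_def by blast
      qed
    qed
  qed
  have sum: "2 * (\<Sum>i<I. 2 ^ i * (inner u (h i) - l i 0 (h i))) \<le> 2 / M * inner (A u) u + (\<Sum>i<I. 2 ^ i * (norm (h i))\<^sup>2)" for I h
  proof (rule le)
    show "((\<lambda>F. 2 * (\<Sum>i<I. 2 ^ i * (inner u (h i) - L F i 0 (h i)))) \<longlongrightarrow> 2 * (\<Sum>i<I. 2 ^ i * (inner u (h i) - l i 0 (h i)))) G"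
      by (intro tendsto_intros lim)
    show "eventually (\<lambda>F. 2 * (\<Sum>i<I. 2 ^ i * (inner u (h i) - L F i 0 (h i))) \<le> 2 / M * inner (A u) u + (\<Sum>i<I. 2 ^ i * (norm (h i))\<^sup>2)) G"
      by (intro always_eventually allI) (use L in \<open>simp add: good_def\<close>)
  qed
  show ?thesis by (rule that[of l]) (use wf sum in auto)
qed

lemma weak_flow_add:
  assumes "weak_flow S c l" "weak_flow S d m"
  shows "weak_flow S (c + d) (\<lambda>t x. l t x + m t x)"
  unfolding weak_flow_def
proof (intro conjI ballI allI)
  fix t x assume "t \<in> {-S..S}" "x \<in> D"
  then have "\<bar>l t x\<bar> \<le> c * norm x" "\<bar>m t x\<bar> \<le> d * norm x" using assms unfolding weak_flow_def by blast+
  then show "\<bar>l t x + m t x\<bar> \<le> (c + d) * norm x" by (simp add: distrib_right)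
next
  fix t t' x assume "t \<in> {-S..S}" "t' \<in> {-S..S}" "x \<in> D"
  then have "\<bar>l t' x - l t x + (t' - t) * l t (A x)\<bar> \<le> c * ((t' - t)\<^sup>2 * norm (A (A x)))"
    "\<bar>m t' x - m t x + (t' - t) * m t (A x)\<bar> \<le> d * ((t' - t)\<^sup>2 * norm (A (A x)))" using assms unfolding weak_flow_def by blast+
  then show "\<bar>l t' x + m t' x - (l t x + m t x) + (t' - t) * (l t (A x) + m t (A x))\<bar> \<le> (c + d) * ((t' - t)\<^sup>2 * norm (A (A x)))"
    by (simp add: algebra_simps)
qed (use assms in \<open>auto simp: weak_flow_def algebra_simps\<close>)

lemma weak_flow_scale:
  assumes "weak_flow S c l"
  shows "weak_flow S (\<bar>r\<bar> * c) (\<lambda>t x. r * l t x)"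
  unfolding weak_flow_def
proof (intro conjI ballI allI)
  fix t x assume "t \<in> {-S..S}" "x \<in> D"
  then have "\<bar>l t x\<bar> \<le> c * norm x" using assms unfolding weak_flow_def by blast
  then show "\<bar>r * l t x\<bar> \<le> \<bar>r\<bar> * c * norm x" by (simp add: abs_mult mult_left_mono mult.assoc)
next
  fix t t' x assume "t \<in> {-S..S}" "t' \<in> {-S..S}" "x \<in> D"
  then have "\<bar>l t' x - l t x + (t' - t) * l t (A x)\<bar> \<le> c * ((t' - t)\<^sup>2 * norm (A (A x)))" using assms unfolding weak_flow_def by blast
  then have "\<bar>r\<bar> * \<bar>l t' x - l t x + (t' - t) * l t (A x)\<bar> \<le> \<bar>r\<bar> * (c * ((t' - t)\<^sup>2 * norm (A (A x))))" by (rule mult_left_mono) simp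
  then show "\<bar>r * l t' x - r * l t x + (t' - t) * (r * l t (A x))\<bar> \<le> \<bar>r\<bar> * c * ((t' - t)\<^sup>2 * norm (A (A x)))"
    by (simp add: abs_mult[symmetric] algebra_simps)
qed (use assms in \<open>auto simp: weak_flow_def algebra_simps\<close>)

lemma weak_flow_mono:
  assumes "weak_flow S c l" "c \<le> d"
  shows "weak_flow S d l"
proof -
  have "c * norm x \<le> d * norm x" for x :: 'v using assms(2) by (simp add: mult_right_mono)
  moreover have "c * ((t' - t)\<^sup>2 * norm x) \<le> d * ((t' - t)\<^sup>2 * norm x)" for t t' :: real and x :: 'v
    using assms(2) by (intro mult_right_mono) auto
  ultimately show ?thesis using assms(1) unfolding weak_flow_def by (meson order.trans)
qed

lemma weak_flow_limit:
  assumes wf: "\<And>n. weak_flow S (c n) (l n)" and c: "\<And>n. c n \<le> d"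
    and lim: "\<And>t x. \<lbrakk>t \<in> {-S..S}; x \<in> D\<rbrakk> \<Longrightarrow> (\<lambda>n. l n t x) \<longlonglongrightarrow> m t x"
    and out: "\<And>t x. t \<notin> {-S..S} \<Longrightarrow> m t x = 0"
  shows "weak_flow S d m"
proof -
  have wf: "weak_flow S d (l n)" for n using wf c weak_flow_mono by blast
  show ?thesis
    unfolding weak_flow_def
  proof (intro conjI ballI allI)
    fix t x y assume xy: "x \<in> D" "y \<in> D"
    show "m t (x + y) = m t x + m t y"
    proof (cases "t \<in> {-S..S}")
      case True
      have "(\<lambda>n. l n t (x + y)) \<longlonglongrightarrow> m t x + m t y"
        using tendsto_add[OF lim[OF True xy(1)] lim[OF True xy(2)]] wf xy by (simp add: weak_flow_def)
      then show ?thesis using lim[OF True subspace_add[OF D xy]] LIMSEQ_unique by blast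
    qed (simp add: out)
  next
    fix t r x assume x: "x \<in> D"
    show "m t (r *\<^sub>R x) = r * m t x"
    proof (cases "t \<in> {-S..S}")
      case True
      have "(\<lambda>n. l n t (r *\<^sub>R x)) \<longlonglongrightarrow> r * m t x"
        using tendsto_mult_left[OF lim[OF True x], of r] wf x by (simp add: weak_flow_def)
      then show ?thesis using lim[OF True subspace_scale[OF D x]] LIMSEQ_unique by blast
    qed (simp add: out)
  next
    fix t x assume tx: "t \<in> {-S..S}" "x \<in> D"
    have "\<bar>l n t x\<bar> \<le> d * norm x" for n using wf tx unfolding weak_flow_def by blast
    then show "\<bar>m t x\<bar> \<le> d * norm x"
      using tendsto_rabs[OF lim[OF tx]] by (intro LIMSEQ_le_const2) auto
  next
    fix t t' x assume tx: "t \<in> {-S..S}" "t' \<in> {-S..S}" "x \<in> D"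
    have "\<bar>l n t' x - l n t x + (t' - t) * l n t (A x)\<bar> \<le> d * ((t' - t)\<^sup>2 * norm (A (A x)))" for n
      using wf tx unfolding weak_flow_def by blast
    moreover have "(\<lambda>n. \<bar>l n t' x - l n t x + (t' - t) * l n t (A x)\<bar>) \<longlonglongrightarrow> \<bar>m t' x - m t x + (t' - t) * m t (A x)\<bar>"
      by (intro tendsto_intros lim tx A_in)
    ultimately show "\<bar>m t' x - m t x + (t' - t) * m t (A x)\<bar> \<le> d * ((t' - t)\<^sup>2 * norm (A (A x)))"
      by (intro LIMSEQ_le_const2) auto
  qed
qed

text \<open>The uniform boundedness principle for the space of weak flows, by a gliding hump: in a series of flows with weights \<open>3 ^ (- n)\<close> the signs are chosen such that the partial sum with index \<open>n + 1\<close> is large at the vector with index \<open>n\<close>, and the tail, at most half of the last weight times the supremum there, cannot cancel it.\<close>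

theorem weak_flow_uniform_bound:
  assumes psi: "\<And>j. j \<in> J \<Longrightarrow> psi j \<in> D" and S: "S \<ge> 0"
    and bounded: "\<And>c l. weak_flow S c l \<Longrightarrow> \<exists>B. \<forall>j\<in>J. \<bar>l 0 (psi j)\<bar> \<le> B"
  shows "\<exists>C\<ge>0. \<forall>c l. weak_flow S c l \<longrightarrow> c \<ge> 0 \<longrightarrow> (\<forall>j\<in>J. \<bar>l 0 (psi j)\<bar> \<le> C * c)"
proof (rule ccontr)
  assume neg: "\<not> ?thesis"
  have big: "\<exists>j m. j \<in> J \<and> weak_flow S 1 m \<and> \<bar>m 0 (psi j)\<bar> > K" if "K \<ge> 0" for K
  proof -
    have "\<not> (\<forall>c l. weak_flow S c l \<longrightarrow> c \<ge> 0 \<longrightarrow> (\<forall>j\<in>J. \<bar>l 0 (psi j)\<bar> \<le> K * c))"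
    proof
      assume "\<forall>c l. weak_flow S c l \<longrightarrow> c \<ge> 0 \<longrightarrow> (\<forall>j\<in>J. \<bar>l 0 (psi j)\<bar> \<le> K * c)"
      with that have "\<exists>C\<ge>0. \<forall>c l. weak_flow S c l \<longrightarrow> c \<ge> 0 \<longrightarrow> (\<forall>j\<in>J. \<bar>l 0 (psi j)\<bar> \<le> C * c)"
        by (intro exI[of _ K] conjI)
      with neg show False by (rule notE)
    qed
    then have "\<exists>c l. weak_flow S c l \<and> c \<ge> 0 \<and> (\<exists>j. j \<in> J \<and> \<not> \<bar>l 0 (psi j)\<bar> \<le> K * c)"
      by (simp only: not_all not_imp Ball_def simp_thms)
    then obtain c l j where l: "weak_flow S c l" "c \<ge> 0" "j \<in> J" "\<not> \<bar>l 0 (psi j)\<bar> \<le> K * c"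
      by (elim exE conjE)
    have "c \<noteq> 0"
    proof
      assume "c = 0"
      then have "\<bar>l 0 (psi j)\<bar> \<le> 0 * norm (psi j)" using l psi S unfolding weak_flow_def by fastforce
      then show False using l \<open>c = 0\<close> by simp
    qed
    then have "c > 0" using l by simp
    have "weak_flow S 1 (\<lambda>t x. (1 / c) * l t x)" using weak_flow_scale[OF l(1), of "1 / c"] \<open>c > 0\<close> by simp
    moreover have "\<bar>(1 / c) * l 0 (psi j)\<bar> > K" using l \<open>c > 0\<close> by (simp add: field_simps)
    ultimately show ?thesis using l(3) by blast
  qed
  have bdd: "bdd_above ((\<lambda>m. \<bar>m 0 (psi j)\<bar>) ` {m. weak_flow S 1 m})" if "j \<in> J" for j
  proof (rule bdd_aboveI2)
    fix m assume "m \<in> {m. weak_flow S 1 m}"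
    then have "\<forall>t\<in>{-S..S}. \<forall>x\<in>D. \<bar>m t x\<bar> \<le> 1 * norm x" unfolding weak_flow_def by blast
    then show "\<bar>m 0 (psi j)\<bar> \<le> norm (psi j)" using psi[OF that] S by simp
  qed
  define p where "p = (\<lambda>j. SUP m\<in>{m. weak_flow S 1 m}. \<bar>m 0 (psi j)\<bar>)"
  have p_upper: "\<bar>m 0 (psi j)\<bar> \<le> p j" if "j \<in> J" "weak_flow S 1 m" for j m
    unfolding p_def by (rule cSUP_upper[OF _ bdd]) (use that in auto)
  define r where "r = (\<lambda>n::nat. (1 / 3) ^ n :: real)"
  have r0: "r n > 0" for n by (simp add: r_def)
  have r_Suc: "r (Suc n) = r n / 3" for n by (simp add: r_def)
  have "\<exists>j m. j \<in> J \<and> weak_flow S 1 m \<and> 6 * real n / r n < p j \<and> 2 / 3 * p j < \<bar>m 0 (psi j)\<bar>" for n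
  proof -
    have "0 \<le> 6 * real n / r n" using r0[of n] by (simp add: less_imp_le)
    from big[OF this] obtain j m where jm: "j \<in> J" "weak_flow S 1 m" "\<bar>m 0 (psi j)\<bar> > 6 * real n / r n" by blast
    then have pj: "p j > 6 * real n / r n" using p_upper[OF jm(1,2)] by linarith
    then have "2 / 3 * p j < p j" using r0[of n] \<open>0 \<le> 6 * real n / r n\<close> by linarith
    then obtain m' where "weak_flow S 1 m'" "2 / 3 * p j < \<bar>m' 0 (psi j)\<bar>"
      unfolding p_def using less_cSUP_iff[OF _ bdd[OF jm(1)]] jm(2) by blast
    then show ?thesis using jm pj by blast
  qed
  then obtain K m where Km: "\<And>n. K n \<in> J" "\<And>n. weak_flow S 1 (m n)" "\<And>n. 6 * real n / r n < p (K n)"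
    "\<And>n. 2 / 3 * p (K n) < \<bar>m n 0 (psi (K n))\<bar>" by metis
  \<comment> \<open>one of \<open>\<bar>a + b\<bar>\<close> and \<open>\<bar>a - b\<bar>\<close> is at least \<open>\<bar>b\<bar>\<close>; the sign of each summand is chosen accordingly\<close>
  define X where "X = rec_nat (\<lambda>t x. 0) (\<lambda>n l. if \<bar>l 0 (psi (K n)) + r n * m n 0 (psi (K n))\<bar> \<ge> r n * \<bar>m n 0 (psi (K n))\<bar>
      then (\<lambda>t x. l t x + r n * m n t x) else (\<lambda>t x. l t x + (- r n) * m n t x))"
  have X0: "X 0 = (\<lambda>t x. 0)" by (simp add: X_def)
  have X_Suc: "X (Suc n) = (if \<bar>X n 0 (psi (K n)) + r n * m n 0 (psi (K n))\<bar> \<ge> r n * \<bar>m n 0 (psi (K n))\<bar>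
      then (\<lambda>t x. X n t x + r n * m n t x) else (\<lambda>t x. X n t x + (- r n) * m n t x))" for n
    by (simp add: X_def)
  have X_diff: "\<bar>X (Suc n) t x - X n t x\<bar> = r n * \<bar>m n t x\<bar>" for n t x
    using r0[of n] by (simp add: X_Suc abs_mult)
  have X_large: "r n * \<bar>m n 0 (psi (K n))\<bar> \<le> \<bar>X (Suc n) 0 (psi (K n))\<bar>" for n
  proof -
    have "\<bar>a\<bar> \<le> \<bar>b + a\<bar> \<or> \<bar>a\<bar> \<le> \<bar>b - a\<bar>" for a b :: real by linarith
    from this[of "r n * m n 0 (psi (K n))" "X n 0 (psi (K n))"]
    show ?thesis using r0[of n] by (auto simp: X_Suc abs_mult)
  qed
  have X_wf: "weak_flow S (3 / 2 - r n * (3 / 2)) (X n)" for n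
  proof (induction n)
    case 0
    have "weak_flow S 0 (\<lambda>t x. 0)" by (simp add: weak_flow_def)
    then show ?case by (simp add: X0 r_def)
  next
    case (Suc n)
    have eq: "3 / 2 - r n * (3 / 2) + \<bar>r n\<bar> * 1 = 3 / 2 - r (Suc n) * (3 / 2)"
      "3 / 2 - r n * (3 / 2) + \<bar>- r n\<bar> * 1 = 3 / 2 - r (Suc n) * (3 / 2)" using r0[of n] by (simp_all add: r_Suc)
    show ?case
      using weak_flow_add[OF Suc weak_flow_scale[OF Km(2)[of n], of "r n"]]
        weak_flow_add[OF Suc weak_flow_scale[OF Km(2)[of n], of "- r n"]]
      unfolding X_Suc eq by simp
  qed
  have conv: "convergent (\<lambda>n. X n t x)" if "t \<in> {-S..S}" "x \<in> D" for t x
  proof -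
    have "summable (\<lambda>n. X (Suc n) t x - X n t x)"
    proof (rule summable_comparison_test')
      show "summable (\<lambda>n. r n * norm x)" unfolding r_def by (intro summable_mult2 summable_geometric) simp
      fix n
      have "\<bar>m n t x\<bar> \<le> 1 * norm x" using Km(2)[of n] that unfolding weak_flow_def by blast
      then show "norm (X (Suc n) t x - X n t x) \<le> r n * norm x" using r0[of n] X_diff[of n t x] by simp
    qed
    then have "convergent (\<lambda>n. \<Sum>k<n. X (Suc k) t x - X k t x)" by (simp add: summable_iff_convergent)
    moreover have "(\<Sum>k<n. X (Suc k) t x - X k t x) = X n t x" for n
      using sum_lessThan_telescope[of "\<lambda>n. X n t x" n] by (simp add: X0)
    ultimately show ?thesis by simp
  qed
  define L where "L = (\<lambda>t x. if t \<in> {-S..S} then lim (\<lambda>n. X n t x) else 0)"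
  have limL: "(\<lambda>n. X n t x) \<longlonglongrightarrow> L t x" if "t \<in> {-S..S}" "x \<in> D" for t x
    using conv[OF that] that by (simp add: L_def convergent_LIMSEQ_iff)
  have "weak_flow S (3 / 2) L"
  proof (rule weak_flow_limit[where c = "\<lambda>n. 3 / 2 - r n * (3 / 2)" and l = X])
    show "weak_flow S (3 / 2 - r n * (3 / 2)) (X n)" for n by (rule X_wf)
    show "3 / 2 - r n * (3 / 2) \<le> 3 / 2" for n using r0[of n] by simp
  qed (use limL in \<open>auto simp: L_def\<close>)
  from bounded[OF this] obtain B where B: "\<forall>j\<in>J. \<bar>L 0 (psi j)\<bar> \<le> B" by (elim exE)
  have large: "real n \<le> \<bar>L 0 (psi (K n))\<bar>" for n
  proof -
    let ?x = "psi (K n)" let ?p = "p (K n)"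
    have x: "?x \<in> D" "0 \<in> {-S..S}" using psi Km(1) S by auto
    have tail: "\<bar>X (Suc n + N) 0 ?x - X (Suc n) 0 ?x\<bar> \<le> ?p * (r n - r (n + N)) / 2" for N
    proof (induction N)
      case (Suc N)
      have "\<bar>X (Suc (Suc n + N)) 0 ?x - X (Suc n + N) 0 ?x\<bar> \<le> r (Suc n + N) * ?p"
        unfolding X_diff using r0[of "Suc n + N"] p_upper[OF Km(1) Km(2)] by (intro mult_left_mono) auto
      then have "\<bar>X (Suc n + Suc N) 0 ?x - X (Suc n) 0 ?x\<bar> \<le> ?p * (r n - r (n + N)) / 2 + r (Suc n + N) * ?p"
        using Suc by (simp only: add_Suc_right)
      also have "r (Suc n + N) = r (n + N) / 3" using r_Suc[of "n + N"] by simp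
      also have "?p * (r n - r (n + N)) / 2 + r (n + N) / 3 * ?p = ?p * (r n - r (n + N) / 3) / 2" by (simp add: field_simps)
      also have "r (n + N) / 3 = r (n + Suc N)" using r_Suc[of "n + N"] by simp
      finally show ?case .
    qed simp
    have p0: "?p \<ge> 0" using p_upper[OF Km(1)[of n] Km(2)[of n]] by linarith
    have "\<bar>X (N + Suc n) 0 ?x - X (Suc n) 0 ?x\<bar> \<le> ?p * r n / 2" for N
    proof -
      have "?p * (r n - r (n + N)) / 2 \<le> ?p * r n / 2" using p0 r0[of "n + N"]
        by (intro divide_right_mono mult_left_mono) auto
      then show ?thesis using tail[of N] by (simp add: add.commute)
    qed
    moreover have "(\<lambda>N. \<bar>X (N + Suc n) 0 ?x - X (Suc n) 0 ?x\<bar>) \<longlonglongrightarrow> \<bar>L 0 ?x - X (Suc n) 0 ?x\<bar>"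
      by (intro tendsto_intros LIMSEQ_ignore_initial_segment limL x)
    ultimately have "\<bar>L 0 ?x - X (Suc n) 0 ?x\<bar> \<le> ?p * r n / 2" by (intro LIMSEQ_le_const2) auto
    then have 1: "\<bar>L 0 ?x - X (Suc n) 0 ?x\<bar> \<le> (r n * ?p) / 2" by (simp only: mult.commute)
    have "r n * (2 / 3 * ?p) \<le> r n * \<bar>m n 0 ?x\<bar>"
      using Km(4)[of n] r0[of n] by (intro mult_left_mono) auto
    then have 2: "2 / 3 * (r n * ?p) \<le> \<bar>X (Suc n) 0 ?x\<bar>" using X_large[of n] by simp
    have "\<bar>X (Suc n) 0 ?x\<bar> \<le> \<bar>L 0 ?x\<bar> + \<bar>L 0 ?x - X (Suc n) 0 ?x\<bar>" by linarith
    then have "(r n * ?p) / 6 \<le> \<bar>L 0 ?x\<bar>" using 1 2 by linarith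
    moreover have "6 * real n < r n * ?p"
      using Km(3)[of n] r0[of n] by (simp only: pos_divide_less_eq mult.commute)
    then have "real n \<le> (r n * ?p) / 6" by simp
    ultimately show ?thesis by linarith
  qed
  obtain n where "real n > B" using reals_Archimedean2 by blast
  moreover have "\<bar>L 0 (psi (K n))\<bar> \<le> B" using B Km(1)[of n] by blast
  ultimately show False using large[of n] by linarith
qed

end

section \<open>Calculus of smooth functions\<close>

lemma dir_deriv_eq:
  assumes "(f has_derivative f') (at x)"
  shows "dir_deriv v f x = f' v"
  using frechet_derivative_at[OF assms] by (simp add: dir_deriv_def)

lemma Ck_on_SucD: "Ck_on (Suc k) S f \<Longrightarrow> Ck_on k S f"
proof (induction k arbitrary: f)
  case 0
  then have "\<forall>x\<in>S. f differentiable (at x)" by simp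
  then show ?case
    by (auto intro!: continuous_at_imp_continuous_on differentiable_imp_continuous_within)
next
  case (Suc k)
  then show ?case by (metis Ck_on.simps(2))
qed

lemma Ck_on_subset: "Ck_on k S f \<Longrightarrow> T \<subseteq> S \<Longrightarrow> Ck_on k T f"
  by (induction k arbitrary: f) (auto intro: continuous_on_subset)

lemma Ck_on_cong:
  assumes "open S" "\<And>x. x \<in> S \<Longrightarrow> f x = g x" "Ck_on k S f"
  shows "Ck_on k S g"
  using assms(2,3)
proof (induction k arbitrary: f g)
  case 0 then show ?case by (metis Ck_on.simps(1) continuous_on_cong)
next
  case (Suc k)
  have der: "(g has_derivative frechet_derivative f (at x)) (at x)" if x: "x \<in> S" for x
  proof -
    have "(f has_derivative frechet_derivative f (at x)) (at x)"
      using Suc.prems x by (simp add: frechet_derivative_works)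
    then show ?thesis by (rule has_derivative_transform_within_open[OF _ \<open>open S\<close> x]) (use Suc.prems in auto)
  qed
  have "Ck_on k S (dir_deriv v g)" for v
  proof (rule Suc.IH)
    show "dir_deriv v f x = dir_deriv v g x" if "x \<in> S" for x
      using dir_deriv_eq[OF der[OF that], of v] by (simp add: dir_deriv_def)
    show "Ck_on k S (dir_deriv v f)" using Suc.prems by simp
  qed
  then show ?case using der by (auto simp: differentiable_def)
qed

lemma Ck_on_Un:
  assumes "open S" "open T" "Ck_on k S f" "Ck_on k T f"
  shows "Ck_on k (S \<union> T) f"
  using assms(3,4) by (induction k arbitrary: f) (auto intro: continuous_on_open_Un[OF assms(1,2)])

lemma Ck_on_const: "Ck_on k S (\<lambda>x. c)"
proof (induction k arbitrary: c)
  case (Suc k)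
  have "dir_deriv v (\<lambda>x::'a. c) = (\<lambda>x. 0)" for v
    by (rule ext, rule dir_deriv_eq) simp
  then show ?case using Suc[of 0] by simp
qed simp

lemma Ck_on_add:
  assumes "open S" "Ck_on k S f" "Ck_on k S g"
  shows "Ck_on k S (\<lambda>x. f x + g x)"
  using assms(2,3)
proof (induction k arbitrary: f g)
  case 0 then show ?case by (simp add: continuous_on_add)
next
  case (Suc k)
  have der: "((\<lambda>x. f x + g x) has_derivative (\<lambda>v. frechet_derivative f (at x) v + frechet_derivative g (at x) v)) (at x)"
    if "x \<in> S" for x
    using Suc.prems that by (intro has_derivative_add) (simp_all add: frechet_derivative_works)
  have "Ck_on k S (dir_deriv v (\<lambda>x. f x + g x))" for v
  proof (rule Ck_on_cong[OF \<open>open S\<close>])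
    show "Ck_on k S (\<lambda>x. dir_deriv v f x + dir_deriv v g x)" using Suc by simp
    show "dir_deriv v f x + dir_deriv v g x = dir_deriv v (\<lambda>x. f x + g x) x" if "x \<in> S" for x
      using dir_deriv_eq[OF der[OF that], of v] by (simp add: dir_deriv_def)
  qed
  then show ?case using der by (auto simp: differentiable_def)
qed

lemma Ck_on_linear:
  assumes h: "bounded_linear h" and "open S" "Ck_on k S f"
  shows "Ck_on k S (\<lambda>x. h (f x))"
  using assms(3)
proof (induction k arbitrary: f)
  case 0 then show ?case by (simp add: bounded_linear.continuous_on[OF h])
next
  case (Suc k)
  have der: "((\<lambda>x. h (f x)) has_derivative (\<lambda>v. h (frechet_derivative f (at x) v))) (at x)"
    if "x \<in> S" for x
    using Suc.prems that by (intro bounded_linear.has_derivative[OF h]) (simp_all add: frechet_derivative_works)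
  have "Ck_on k S (dir_deriv v (\<lambda>x. h (f x)))" for v
  proof (rule Ck_on_cong[OF \<open>open S\<close>])
    show "Ck_on k S (\<lambda>x. h (dir_deriv v f x))" using Suc by simp
    show "h (dir_deriv v f x) = dir_deriv v (\<lambda>x. h (f x)) x" if "x \<in> S" for x
      using dir_deriv_eq[OF der[OF that], of v] by (simp add: dir_deriv_def)
  qed
  then show ?case using der by (auto simp: differentiable_def)
qed

lemma Ck_on_bilinear:
  assumes b: "bounded_bilinear b" and "open S" "Ck_on k S f" "Ck_on k S g"
  shows "Ck_on k S (\<lambda>x. b (f x) (g x))"
  using assms(3,4)
proof (induction k arbitrary: f g)
  case 0 then show ?case by (simp add: bounded_bilinear.continuous_on[OF b])
next
  case (Suc k)
  have der: "((\<lambda>x. b (f x) (g x)) has_derivative (\<lambda>v. b (f x) (frechet_derivative g (at x) v) + b (frechet_derivative f (at x) v) (g x))) (at x)"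
    if "x \<in> S" for x
    using Suc.prems that by (intro bounded_bilinear.FDERIV[OF b]) (simp_all add: frechet_derivative_works)
  have "Ck_on k S (dir_deriv v (\<lambda>x. b (f x) (g x)))" for v
  proof (rule Ck_on_cong[OF \<open>open S\<close>])
    show "Ck_on k S (\<lambda>x. b (f x) (dir_deriv v g x) + b (dir_deriv v f x) (g x))"
      using Suc.prems by (intro Ck_on_add[OF \<open>open S\<close>] Suc.IH) (auto intro: Ck_on_SucD simp del: Ck_on.simps(2) dest: Ck_on.simps(2)[THEN iffD1])
    show "b (f x) (dir_deriv v g x) + b (dir_deriv v f x) (g x) = dir_deriv v (\<lambda>x. b (f x) (g x)) x" if "x \<in> S" for x
      using dir_deriv_eq[OF der[OF that], of v] by (simp add: dir_deriv_def)
  qed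
  then show ?case using der by (auto simp: differentiable_def)
qed

lemma Ck_on_affine:
  assumes L: "bounded_linear L" and "open S" "Ck_on k S f" and T: "open T" "\<And>x. x \<in> T \<Longrightarrow> a + L x \<in> S"
  shows "Ck_on k T (\<lambda>x. f (a + L x))"
  using assms(3)
proof (induction k arbitrary: f)
  case 0
  have "continuous_on T (\<lambda>x. a + L x)" by (intro continuous_intros bounded_linear.continuous_on[OF L])
  then show ?case using 0 T continuous_on_compose2[of S f T "\<lambda>x. a + L x"] by auto
next
  case (Suc k)
  have der: "((\<lambda>x. f (a + L x)) has_derivative (\<lambda>v. frechet_derivative f (at (a + L x)) (L v))) (at x)"
    if "x \<in> T" for x
  proof -
    have "(f has_derivative frechet_derivative f (at (a + L x))) (at (a + L x))"
      using Suc.prems T(2)[OF that] by (simp add: frechet_derivative_works)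
    moreover have "((\<lambda>x. a + L x) has_derivative L) (at x)"
      using has_derivative_add[OF has_derivative_const bounded_linear_imp_has_derivative[OF L]] by simp
    ultimately show ?thesis by (rule has_derivative_compose[rotated])
  qed
  have "Ck_on k T (dir_deriv v (\<lambda>x. f (a + L x)))" for v
  proof (rule Ck_on_cong[OF \<open>open T\<close>])
    show "Ck_on k T (\<lambda>x. dir_deriv (L v) f (a + L x))" using Suc by simp
    show "dir_deriv (L v) f (a + L x) = dir_deriv v (\<lambda>x. f (a + L x)) x" if "x \<in> T" for x
      using dir_deriv_eq[OF der[OF that], of v] by (simp add: dir_deriv_def)
  qed
  then show ?case using der by (auto simp: differentiable_def)
qed

lemma smooth_on_subset: "smooth_on S f \<Longrightarrow> T \<subseteq> S \<Longrightarrow> smooth_on T f"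
  by (auto simp: smooth_on_def intro: Ck_on_subset)

lemma smooth_on_cong:
  "open S \<Longrightarrow> (\<And>x. x \<in> S \<Longrightarrow> f x = g x) \<Longrightarrow> smooth_on S f \<Longrightarrow> smooth_on S g"
  by (auto simp: smooth_on_def intro: Ck_on_cong)

lemma smooth_on_Un: "open S \<Longrightarrow> open T \<Longrightarrow> smooth_on S f \<Longrightarrow> smooth_on T f \<Longrightarrow> smooth_on (S \<union> T) f"
  by (auto simp: smooth_on_def intro: Ck_on_Un)

lemma smooth_on_const [simp]: "smooth_on S (\<lambda>x. c)"
  by (simp add: smooth_on_def Ck_on_const)

lemma smooth_on_add: "open S \<Longrightarrow> smooth_on S f \<Longrightarrow> smooth_on S g \<Longrightarrow> smooth_on S (\<lambda>x. f x + g x)"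
  by (simp add: smooth_on_def Ck_on_add)

lemma smooth_on_linear: "bounded_linear h \<Longrightarrow> open S \<Longrightarrow> smooth_on S f \<Longrightarrow> smooth_on S (\<lambda>x. h (f x))"
  by (simp add: smooth_on_def Ck_on_linear)

lemma smooth_on_bilinear:
  "bounded_bilinear b \<Longrightarrow> open S \<Longrightarrow> smooth_on S f \<Longrightarrow> smooth_on S g \<Longrightarrow> smooth_on S (\<lambda>x. b (f x) (g x))"
  by (simp add: smooth_on_def Ck_on_bilinear)

lemmas smooth_on_mult = smooth_on_bilinear[OF bounded_bilinear_mult]

lemma smooth_on_minus: "open S \<Longrightarrow> smooth_on S f \<Longrightarrow> smooth_on S (\<lambda>x. - f x)"
  using smooth_on_linear[OF bounded_linear_minus[OF bounded_linear_ident]] by blast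

lemma smooth_on_diff: "open S \<Longrightarrow> smooth_on S f \<Longrightarrow> smooth_on S g \<Longrightarrow> smooth_on S (\<lambda>x. f x - g x)"
  using smooth_on_add[of S f "\<lambda>x. - g x"] smooth_on_minus[of S g] by simp

lemma smooth_on_affine:
  "bounded_linear L \<Longrightarrow> open S \<Longrightarrow> smooth_on S f \<Longrightarrow> open T \<Longrightarrow> (\<And>x. x \<in> T \<Longrightarrow> a + L x \<in> S)
    \<Longrightarrow> smooth_on T (\<lambda>x. f (a + L x))"
  by (simp add: smooth_on_def Ck_on_affine)

lemma smooth_on_dir_deriv: "smooth_on S f \<Longrightarrow> smooth_on S (dir_deriv v f)"
  unfolding smooth_on_def by (metis Ck_on.simps(2))

lemma smooth_on_differentiable: "smooth_on S f \<Longrightarrow> x \<in> S \<Longrightarrow> f differentiable (at x)"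
  unfolding smooth_on_def by (metis Ck_on.simps(2))

lemma smooth_on_has_derivative:
  "smooth_on S f \<Longrightarrow> x \<in> S \<Longrightarrow> (f has_derivative (\<lambda>v. dir_deriv v f x)) (at x)"
  using smooth_on_differentiable[of S f x] by (simp add: dir_deriv_def frechet_derivative_works)

lemma smooth_on_continuous: "smooth_on S f \<Longrightarrow> continuous_on S f"
  unfolding smooth_on_def by (metis Ck_on.simps(1))

text \<open>A coinduction principle: the family takes the place of explicit formulas for the derivatives of all orders.\<close>

lemma smooth_onI_derivs:
  assumes "open S" "f \<in> \<F>"
    "\<And>h. h \<in> \<F> \<Longrightarrow> \<exists>h'\<in>\<F>. \<forall>x\<in>S. (h has_real_derivative h' x) (at x)"
  shows "smooth_on S f"
proof -
  have "\<forall>h\<in>\<F>. Ck_on k S h" for k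
  proof (induction k)
    case 0
    show ?case
    proof
      fix h assume "h \<in> \<F>"
      then obtain h' where "\<forall>x\<in>S. (h has_real_derivative h' x) (at x)" using assms(3) by blast
      then show "Ck_on 0 S h" by (auto intro: DERIV_continuous_on has_field_derivative_at_within)
    qed
  next
    case (Suc k)
    show ?case
    proof
      fix h assume "h \<in> \<F>"
      then obtain h' where h': "h' \<in> \<F>" "\<forall>x\<in>S. (h has_real_derivative h' x) (at x)" using assms(3) by blast
      have "Ck_on k S (dir_deriv v h)" for v
      proof (rule Ck_on_cong[OF \<open>open S\<close>])
        show "Ck_on k S (\<lambda>x. v *\<^sub>R h' x)"
          by (rule Ck_on_linear[OF bounded_linear_scaleR_right \<open>open S\<close>]) (use Suc h' in auto)
        show "v *\<^sub>R h' x = dir_deriv v h x" if "x \<in> S" for x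
          using dir_deriv_eq[of h "(*) (h' x)" x v] h'(2) that by (simp add: has_field_derivative_def)
      qed
      moreover have "\<forall>x\<in>S. h differentiable (at x)"
        using h'(2) by (auto simp: differentiable_def has_field_derivative_def)
      ultimately show "Ck_on (Suc k) S h" by simp
    qed
  qed
  then show ?thesis using assms(2) by (simp add: smooth_on_def)
qed

text \<open>Induction on the order with the outer function left arbitrary, as the chain rule replaces it by its derivative.\<close>

lemma smooth_on_compose_real:
  fixes h :: "real \<Rightarrow> real"
  assumes "open S" "smooth_on S f" "smooth_on UNIV h"
  shows "smooth_on S (\<lambda>x. h (f x))"
proof -
  have "Ck_on k S (\<lambda>x. h (f x))" if "smooth_on UNIV h" "Ck_on k S f" for k and h :: "real \<Rightarrow> real"
    using that
  proof (induction k arbitrary: h)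
    case 0
    then show ?case using continuous_on_compose2[OF smooth_on_continuous[OF 0(1)]] by auto
  next
    case (Suc k)
    have der: "((\<lambda>x. h (f x)) has_derivative (\<lambda>v. dir_deriv (frechet_derivative f (at x) v) h (f x))) (at x)"
      if "x \<in> S" for x
      using Suc.prems that
      by (intro has_derivative_compose[OF _ smooth_on_has_derivative[of UNIV h]]) (simp_all add: frechet_derivative_works)
    have h1: "dir_deriv c h y = dir_deriv 1 h y * c" for c y
    proof -
      have "linear (\<lambda>v. dir_deriv v h y)"
        using smooth_on_has_derivative[OF Suc.prems(1), of y] has_derivative_linear by blast
      then show ?thesis using linear_scale[of "\<lambda>v. dir_deriv v h y" c 1] by simp
    qed
    have "Ck_on k S (dir_deriv v (\<lambda>x. h (f x)))" for v
    proof (rule Ck_on_cong[OF \<open>open S\<close>])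
      show "Ck_on k S (\<lambda>x. dir_deriv 1 h (f x) * dir_deriv v f x)"
      proof (rule Ck_on_bilinear[OF bounded_bilinear_mult \<open>open S\<close>])
        show "Ck_on k S (\<lambda>x. dir_deriv 1 h (f x))"
          by (rule Suc.IH[OF smooth_on_dir_deriv[OF Suc.prems(1)] Ck_on_SucD[OF Suc.prems(2)]])
        show "Ck_on k S (dir_deriv v f)" using Suc.prems by simp
      qed
      show "dir_deriv 1 h (f x) * dir_deriv v f x = dir_deriv v (\<lambda>x. h (f x)) x" if "x \<in> S" for x
        using dir_deriv_eq[OF der[OF that], of v] h1[of "dir_deriv v f x" "f x"] by (simp add: dir_deriv_def)
    qed
    then show ?case using der by (auto simp: differentiable_def)
  qed
  then show ?thesis using assms by (simp add: smooth_on_def)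
qed

definition flat_exp :: "real \<Rightarrow> real" where
  "flat_exp x = (if x > 0 then exp (- 1 / x) else 0)"

lemma poly_inverse_exp_tendsto:
  "((\<lambda>x. x ^ n * exp (- x)) \<longlongrightarrow> 0) (at_top :: real filter)"
  using tendsto_power_div_exp_0[of n] by (simp add: exp_minus divide_inverse)

lemma flat_family_limit:
  "((\<lambda>x::real. if x > 0 then poly p (1 / x) * exp (- 1 / x) else 0) \<longlongrightarrow> 0) (at 0)"
proof -
  have "((\<lambda>y. \<Sum>i\<le>degree p. coeff p i * (y ^ i * exp (- y))) \<longlongrightarrow> (\<Sum>i\<le>degree p. coeff p i * 0)) (at_top :: real filter)"
    by (intro tendsto_intros poly_inverse_exp_tendsto)
  then have top: "((\<lambda>y. poly p y * exp (- y)) \<longlongrightarrow> 0) (at_top :: real filter)"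
    by (simp add: poly_altdef sum_distrib_right mult.assoc)
  have "((\<lambda>x. poly p (1 / x) * exp (- (1 / x))) \<longlongrightarrow> 0) (at_right (0::real))"
    by (rule filterlim_compose[OF top]) (simp add: filterlim_inverse_at_top_right divide_inverse)
  then have r: "((\<lambda>x::real. if x > 0 then poly p (1 / x) * exp (- 1 / x) else 0) \<longlongrightarrow> 0) (at_right 0)"
    by (rule Lim_transform_eventually) (auto simp: eventually_at_filter)
  have l: "((\<lambda>x::real. if x > 0 then poly p (1 / x) * exp (- 1 / x) else 0) \<longlongrightarrow> 0) (at_left 0)"
    by (rule Lim_transform_eventually[of "\<lambda>x. 0"]) (auto simp: eventually_at_filter)
  show ?thesis using filterlim_split_at[OF l r] .
qed

text \<open>The functions \<open>p (1 / x) * exp (- 1 / x)\<close> with a polynomial \<open>p\<close>, continued by \<open>0\<close>, are closed under differentiation; at the origin both the values and the difference quotients tend to \<open>0\<close>.\<close>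

lemma flat_exp_smooth: "smooth_on UNIV flat_exp"
proof (rule smooth_onI_derivs[where \<F> = "range (\<lambda>p x. if x > 0 then poly p (1 / x) * exp (- 1 / x) else 0)"])
  show "flat_exp \<in> range (\<lambda>p x. if x > 0 then poly p (1 / x) * exp (- 1 / x) else 0)"
    by (intro image_eqI[of _ _ "[:1:]"]) (auto simp: flat_exp_def)
next
  fix h :: "real \<Rightarrow> real" assume "h \<in> range (\<lambda>p x. if x > 0 then poly p (1 / x) * exp (- 1 / x) else 0)"
  then obtain p where h: "h = (\<lambda>x. if x > 0 then poly p (1 / x) * exp (- 1 / x) else 0)" by blast
  define q where "q = [:0, 0, 1:] * (p - pderiv p)"
  have "(h has_real_derivative (if x > 0 then poly q (1 / x) * exp (- 1 / x) else 0)) (at x)" for x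
  proof (cases x "0::real" rule: linorder_cases)
    case less
    have "((\<lambda>x. 0) has_real_derivative 0) (at x)" by simp
    then have "(h has_real_derivative 0) (at x)"
      by (rule has_field_derivative_transform_within_open[OF _ open_lessThan[of 0]]) (use less h in auto)
    then show ?thesis using less by simp
  next
    case greater
    have "((\<lambda>x. poly p (1 / x) * exp (- 1 / x)) has_real_derivative
       poly (pderiv p) (1 / x) * (- 1 / x\<^sup>2) * exp (- 1 / x) + poly p (1 / x) * (exp (- 1 / x) * (1 / x\<^sup>2))) (at x)"
      using greater by (auto intro!: derivative_eq_intros DERIV_chain2[OF poly_DERIV] simp: power2_eq_square)
    also have "poly (pderiv p) (1 / x) * (- 1 / x\<^sup>2) * exp (- 1 / x) + poly p (1 / x) * (exp (- 1 / x) * (1 / x\<^sup>2))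
       = poly q (1 / x) * exp (- 1 / x)"
      using greater by (simp add: q_def power2_eq_square field_simps)
    finally have "(h has_real_derivative poly q (1 / x) * exp (- 1 / x)) (at x)"
      by (rule has_field_derivative_transform_within_open[OF _ open_greaterThan[of 0]]) (use greater h in auto)
    then show ?thesis using greater by simp
  next
    case equal
    have "((\<lambda>y. (h y - h 0) / (y - 0)) \<longlongrightarrow> 0) (at 0)"
      using flat_family_limit[of "[:0, 1:] * p"] by (rule Lim_transform_eventually) (auto simp: h eventually_at_filter)
    then show ?thesis using equal by (simp add: has_field_derivative_iff)
  qed
  then show "\<exists>h'\<in>range (\<lambda>p x. if x > 0 then poly p (1 / x) * exp (- 1 / x) else 0). \<forall>x\<in>UNIV. (h has_real_derivative h' x) (at x)"
    by (intro bexI[OF _ rangeI[of _ q]]) simp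
qed simp

text \<open>The composition \<open>flat_exp (c - flat_exp x)\<close> produces a step without a quotient of functions: it is constant where \<open>flat_exp x = 0\<close> and vanishes where \<open>flat_exp x \<ge> c\<close>.\<close>

lemma smooth_step_exists:
  obtains s :: "real \<Rightarrow> real" where "smooth_on UNIV s" "\<And>x. 0 \<le> s x" "\<And>x. s x \<le> 1"
    "\<And>x. x \<le> 0 \<Longrightarrow> s x = 1" "\<And>x. x \<ge> 1 \<Longrightarrow> s x = 0"
proof -
  define c where "c = flat_exp 1"
  have c: "c > 0" by (simp add: c_def flat_exp_def)
  have mono: "flat_exp x \<le> flat_exp y" if "x \<le> y" for x y
    using that by (auto simp: flat_exp_def divide_simps)
  have pos: "flat_exp x \<ge> 0" for x by (simp add: flat_exp_def)
  have fc: "flat_exp c > 0" using c by (simp add: flat_exp_def)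
  define s where "s = (\<lambda>x. flat_exp (c - flat_exp x) * (1 / flat_exp c))"
  show ?thesis
  proof (rule that[of s])
    show "smooth_on UNIV s" unfolding s_def
      by (intro smooth_on_mult smooth_on_compose_real[OF _ _ flat_exp_smooth] smooth_on_diff smooth_on_const flat_exp_smooth open_UNIV)
    show "0 \<le> s x" for x using pos fc by (simp add: s_def)
    show "s x \<le> 1" for x using mono[of "c - flat_exp x" c] pos[of x] fc by (simp add: s_def)
    show "s x = 1" if "x \<le> 0" for x using that fc by (simp add: s_def flat_exp_def[of x])
    show "s x = 0" if "x \<ge> 1" for x using mono[OF that] by (simp add: s_def c_def flat_exp_def[of "flat_exp 1 - flat_exp x"])
  qed
qed

lemma smooth_on_inner_self: "smooth_on S (\<lambda>x::'a::euclidean_space. inner (x - a) (x - a))" if "open S"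
proof -
  have "smooth_on S (\<lambda>x. x)"
  proof -
    have "Ck_on k S (\<lambda>x::'a. x)" for k
    proof (cases k)
      case (Suc j)
      have "dir_deriv v (\<lambda>x::'a. x) = (\<lambda>x. v)" for v by (rule ext, rule dir_deriv_eq) simp
      then show ?thesis by (simp add: Suc Ck_on_const)
    qed simp
    then show ?thesis by (simp add: smooth_on_def)
  qed
  then show ?thesis using that by (intro smooth_on_bilinear[OF bounded_bilinear_inner] smooth_on_diff) auto
qed

lemma cutoff_exists:
  fixes a :: "'a::euclidean_space"
  assumes "0 < r" "r < R"
  obtains \<phi> :: "'a \<Rightarrow> real" where "smooth_on UNIV \<phi>" "\<And>x. 0 \<le> \<phi> x" "\<And>x. \<phi> x \<le> 1"
    "\<And>x. x \<in> cball a r \<Longrightarrow> \<phi> x = 1" "\<And>x. x \<notin> ball a R \<Longrightarrow> \<phi> x = 0"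
proof -
  obtain s :: "real \<Rightarrow> real" where s: "smooth_on UNIV s" "\<And>x. 0 \<le> s x" "\<And>x. s x \<le> 1"
    "\<And>x. x \<le> 0 \<Longrightarrow> s x = 1" "\<And>x. x \<ge> 1 \<Longrightarrow> s x = 0" using smooth_step_exists by blast
  define \<phi> where "\<phi> = (\<lambda>x. s ((inner (x - a) (x - a) - r\<^sup>2) * (1 / (R\<^sup>2 - r\<^sup>2))))"
  have rR: "R\<^sup>2 - r\<^sup>2 > 0" using assms by (simp add: power_strict_mono)
  show ?thesis
  proof (rule that[of \<phi>])
    show "smooth_on UNIV \<phi>" unfolding \<phi>_def
      by (intro smooth_on_compose_real[OF _ _ s(1)] smooth_on_mult smooth_on_diff smooth_on_const smooth_on_inner_self open_UNIV)
    show "\<phi> x = 1" if "x \<in> cball a r" for x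
    proof -
      have "(norm (x - a))\<^sup>2 \<le> r\<^sup>2" using that by (intro power_mono) (auto simp: dist_norm norm_minus_commute)
      then show ?thesis using rR unfolding \<phi>_def by (intro s(4)) (simp add: power2_norm_eq_inner divide_simps)
    qed
    show "\<phi> x = 0" if "x \<notin> ball a R" for x
    proof -
      have "R\<^sup>2 \<le> (norm (x - a))\<^sup>2" using that assms by (intro power_mono) (auto simp: dist_norm norm_minus_commute)
      then show ?thesis using rR unfolding \<phi>_def by (intro s(5)) (simp add: power2_norm_eq_inner field_simps)
    qed
  qed (simp_all add: \<phi>_def s)
qed

section \<open>Real test functions as an inner product space\<close>

lemma supp_subsetI: "closed K \<Longrightarrow> (\<And>x. x \<notin> K \<Longrightarrow> f x = 0) \<Longrightarrow> supp f \<subseteq> K"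
  unfolding supp_def by (rule closure_minimal; blast)

lemma not_in_supp: "x \<notin> supp f \<Longrightarrow> f x = 0"
  using closure_subset[of "{x. f x \<noteq> 0}"] by (auto simp: supp_def)

lemma closed_supp [simp]: "closed (supp f)"
  by (simp add: supp_def)

lemma compact_suppI: "compact K \<Longrightarrow> (\<And>x. x \<notin> K \<Longrightarrow> f x = 0) \<Longrightarrow> compact (supp (f :: 'a::t2_space \<Rightarrow> _))"
  using compact_Int_closed[of K "supp f"] supp_subsetI[of K f] compact_imp_closed[of K] by (simp add: Int_absorb1)

lemma dir_deriv_outside:
  assumes "closed K" "\<And>x. x \<notin> K \<Longrightarrow> f x = 0" "x \<notin> K"
  shows "dir_deriv v f x = 0"
proof -
  have "((\<lambda>x. 0) has_derivative (\<lambda>v. 0)) (at x)" by simp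
  then have "(f has_derivative (\<lambda>v. 0)) (at x)"
    by (rule has_derivative_transform_within_open[of _ _ _ _ "- K"]) (use assms in auto)
  then show ?thesis by (rule dir_deriv_eq)
qed

lemma continuous_compact_support_integrable:
  fixes f :: "'a::euclidean_space \<Rightarrow> 'b::{banach, second_countable_topology}"
  assumes "continuous_on UNIV f" "compact K" "\<And>x. x \<notin> K \<Longrightarrow> f x = 0"
  shows "integrable lborel f"
proof -
  have "integrable lborel (\<lambda>x. indicator K x *\<^sub>R f x)"
    using assms by (intro borel_integrable_compact) (auto intro: continuous_on_subset)
  moreover have "(\<lambda>x. indicator K x *\<^sub>R f x) = f" using assms(3) by (auto simp: indicator_def)
  ultimately show ?thesis by simp
qed

lemma continuous_compact_support_bounded:
  fixes f :: "'a::euclidean_space \<Rightarrow> 'b::real_normed_vector"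
  assumes "continuous_on UNIV f" "compact K" "\<And>x. x \<notin> K \<Longrightarrow> f x = 0"
  shows "\<exists>C\<ge>0. \<forall>x. norm (f x) \<le> C"
proof -
  have "compact (f ` K)" using assms by (intro compact_continuous_image) (auto intro: continuous_on_subset)
  then obtain C where "\<forall>y\<in>f ` K. norm y \<le> C" using compact_imp_bounded bounded_iff by blast
  then have "norm (f x) \<le> max C 0" for x using assms(3)[of x] by (cases "x \<in> K") auto
  then show ?thesis by (intro exI[of _ "max C 0"]) simp
qed

lemma smooth_line_derivative:
  fixes f :: "'a::euclidean_space \<Rightarrow> real"
  assumes "smooth_on UNIV f"
  shows "((\<lambda>s. f (x + s *\<^sub>R v)) has_real_derivative dir_deriv v f (x + s *\<^sub>R v)) (at s)"
proof -
  have "(f has_derivative (\<lambda>w. dir_deriv w f (x + s *\<^sub>R v))) (at (x + s *\<^sub>R v))"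
    by (rule smooth_on_has_derivative[OF assms(1)]) simp
  moreover have "((\<lambda>s. x + s *\<^sub>R v) has_derivative (\<lambda>t. t *\<^sub>R v)) (at s)" by (auto intro!: derivative_eq_intros)
  ultimately have "((\<lambda>s. f (x + s *\<^sub>R v)) has_derivative (\<lambda>t. dir_deriv (t *\<^sub>R v) f (x + s *\<^sub>R v))) (at s)"
    by (rule has_derivative_compose[rotated])
  moreover have "dir_deriv (t *\<^sub>R v) f y = dir_deriv v f y * t" for t y
    using linear_scale[OF has_derivative_linear[OF smooth_on_has_derivative[OF assms(1), of y]], of t v] by simp
  ultimately show ?thesis by (simp add: has_field_derivative_def)
qed

text \<open>By translation invariance the difference quotients have integral \<open>0\<close>; by the mean value theorem they are dominated, so their limit has integral \<open>0\<close> as well.\<close>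

lemma integral_dir_deriv_zero:
  fixes f :: "'a::euclidean_space \<Rightarrow> real"
  assumes "smooth_on UNIV f" "compact (supp f)"
  shows "(LINT x|lborel. dir_deriv v f x) = 0"
proof -
  note f0 = not_in_supp[of _ f]
  have contf: "continuous_on UNIV f" using assms(1) by (rule smooth_on_continuous)
  have contd: "continuous_on UNIV (dir_deriv v f)" using assms by (intro smooth_on_continuous smooth_on_dir_deriv)
  have d0: "dir_deriv v f x = 0" if "x \<notin> supp f" for x
    by (rule dir_deriv_outside[of "supp f"]) (use that f0 in auto)
  obtain C where C: "C \<ge> 0" "\<And>x. norm (dir_deriv v f x) \<le> C"
    using continuous_compact_support_bounded[OF contd assms(2) d0] by blast
  obtain R where R: "\<And>x. x \<in> supp f \<Longrightarrow> norm x \<le> R"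
    using compact_imp_bounded[OF assms(2)] bounded_iff by metis
  have f_int: "integrable lborel f" by (rule continuous_compact_support_integrable[OF contf assms(2) f0])
  define h where "h = (\<lambda>n::nat. 1 / real (Suc n))"
  have h: "h n > 0" "h n \<le> 1" for n by (auto simp: h_def)
  define q where "q = (\<lambda>n x. (f (x + h n *\<^sub>R v) - f x) / h n)"
  have shift_int: "integrable lborel (\<lambda>x. f (x + a))" for a
  proof -
    have "integrable (distr lborel borel ((+) a)) f" using f_int by (simp add: lborel_distr_plus)
    then show ?thesis by (subst (asm) integrable_distr_eq) (use f_int in \<open>auto simp: add.commute\<close>)
  qed
  have shift: "(LINT x|lborel. f (x + a)) = (LINT x|lborel. f x)" for a
  proof -
    have "(LINT x|distr lborel borel ((+) a). f x) = (LINT x|lborel. f (a + x))"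
      using f_int by (intro integral_distr) auto
    then show ?thesis by (simp add: lborel_distr_plus add.commute)
  qed
  have int0: "(LINT x|lborel. q n x) = 0" for n
    unfolding q_def using shift_int[of "h n *\<^sub>R v"] f_int shift[of "h n *\<^sub>R v"] by simp
  have mvt: "\<exists>s. 0 < s \<and> s < h n \<and> q n x = dir_deriv v f (x + s *\<^sub>R v)" for n x
  proof -
    obtain s where "0 < s" "s < h n" "f (x + h n *\<^sub>R v) - f (x + 0 *\<^sub>R v) = (h n - 0) * dir_deriv v f (x + s *\<^sub>R v)"
      using MVT2[OF h(1), of n "\<lambda>s. f (x + s *\<^sub>R v)" "\<lambda>s. dir_deriv v f (x + s *\<^sub>R v)"] smooth_line_derivative[OF assms(1)] by blast
    then show ?thesis using h(1)[of n] unfolding q_def by (intro exI[of _ s]) auto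
  qed
  have lim: "(\<lambda>n. LINT x|lborel. q n x) \<longlonglongrightarrow> (LINT x|lborel. dir_deriv v f x)"
  proof (rule integral_dominated_convergence)
    show "integrable lborel (\<lambda>x. C * indicat_real (cball 0 (R + norm v)) x)"
      by (intro integrable_mult_right integrable_real_indicator emeasure_bounded_finite bounded_cball) simp
    show "dir_deriv v f \<in> borel_measurable lborel" using contd by (simp add: borel_measurable_continuous_onI)
    show "q n \<in> borel_measurable lborel" for n
      unfolding q_def using shift_int[of "h n *\<^sub>R v"] f_int by (auto intro!: borel_measurable_divide borel_measurable_diff)
    show "AE x in lborel. (\<lambda>n. q n x) \<longlonglongrightarrow> dir_deriv v f x"
    proof (rule AE_I2)
      fix x
      obtain s where s: "\<And>n. 0 < s n" "\<And>n. s n < h n" "\<And>n. q n x = dir_deriv v f (x + s n *\<^sub>R v)"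
        using mvt[of _ x] by metis
      have "h \<longlonglongrightarrow> 0" unfolding h_def by (rule LIMSEQ_Suc[OF lim_1_over_n])
      then have "s \<longlonglongrightarrow> 0"
        using s(1,2) by (intro tendsto_sandwich[OF _ _ tendsto_const, of 0 s sequentially h]) (auto simp: less_imp_le)
      then have "(\<lambda>n. x + s n *\<^sub>R v) \<longlonglongrightarrow> x + 0 *\<^sub>R v" by (intro tendsto_intros)
      moreover have "isCont (dir_deriv v f) x" using contd by (simp add: continuous_on_eq_continuous_at)
      ultimately show "(\<lambda>n. q n x) \<longlonglongrightarrow> dir_deriv v f x" unfolding s(3) by (auto intro: isCont_tendsto_compose)
    qed
    show "AE x in lborel. norm (q n x) \<le> C * indicat_real (cball 0 (R + norm v)) x" for n
    proof (rule AE_I2)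
      fix x
      obtain s where s: "0 < s" "s < h n" "q n x = dir_deriv v f (x + s *\<^sub>R v)" using mvt by blast
      show "norm (q n x) \<le> C * indicat_real (cball 0 (R + norm v)) x"
      proof (cases "x \<in> cball 0 (R + norm v)")
        case True then show ?thesis using s C by simp
      next
        case False
        have "x + s *\<^sub>R v \<notin> supp f"
        proof
          assume "x + s *\<^sub>R v \<in> supp f"
          then have "norm (x + s *\<^sub>R v) \<le> R" by (rule R)
          moreover have "norm (s *\<^sub>R v) \<le> norm v" using s h[of n] by (simp add: mult_left_le_one_le)
          ultimately show False using False norm_triangle_ineq4[of "x + s *\<^sub>R v" "s *\<^sub>R v"] by simp
        qed
        then show ?thesis using s d0 False by simp
      qed
    qed
  qed
  show ?thesis using lim by (simp add: int0 LIMSEQ_const_iff)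
qed

definition is_test :: "('a::euclidean_space \<Rightarrow> real) \<Rightarrow> bool" where
  "is_test f \<longleftrightarrow> smooth_on UNIV f \<and> compact (supp f)"

lemma is_testI: "smooth_on UNIV f \<Longrightarrow> compact K \<Longrightarrow> (\<And>x. x \<notin> K \<Longrightarrow> f x = 0) \<Longrightarrow> is_test f"
  unfolding is_test_def by (intro conjI compact_suppI)

lemma is_test_add: "is_test f \<Longrightarrow> is_test g \<Longrightarrow> is_test (\<lambda>x. f x + g x)"
  by (rule is_testI[of _ "supp f \<union> supp g"]) (auto simp: is_test_def not_in_supp intro: smooth_on_add)

lemma is_test_mult: "smooth_on UNIV h \<Longrightarrow> is_test f \<Longrightarrow> is_test (\<lambda>x. h x * f x)"
  by (rule is_testI[of _ "supp f"]) (auto simp: is_test_def not_in_supp intro: smooth_on_mult)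

lemma is_test_dir_deriv: "is_test f \<Longrightarrow> is_test (dir_deriv v f)"
  by (rule is_testI[of _ "supp f"]) (auto simp: is_test_def intro: smooth_on_dir_deriv dir_deriv_outside[of "supp f"] not_in_supp)

lemma is_test_zero: "is_test (\<lambda>x. 0)"
  by (rule is_testI[of _ "{}"]) auto

lemma is_test_sum: "(\<And>i. i \<in> I \<Longrightarrow> is_test (f i)) \<Longrightarrow> is_test (\<lambda>x. \<Sum>i\<in>I. f i x)"
  by (induction I rule: infinite_finite_induct) (auto intro: is_test_add is_test_zero)

lemma is_test_continuous: "is_test f \<Longrightarrow> continuous_on UNIV f"
  by (simp add: is_test_def smooth_on_continuous)

lemma is_test_integrable: "is_test f \<Longrightarrow> integrable lborel f"
  by (rule continuous_compact_support_integrable[of _ "supp f"]) (auto simp: is_test_continuous is_test_def not_in_supp)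

lemma dir_deriv_mult:
  fixes f g :: "'a::euclidean_space \<Rightarrow> real"
  assumes "smooth_on UNIV f" "smooth_on UNIV g"
  shows "dir_deriv v (\<lambda>x. f x * g x) x = f x * dir_deriv v g x + dir_deriv v f x * g x"
  using dir_deriv_eq[OF has_derivative_mult[OF smooth_on_has_derivative[OF assms(1), of x] smooth_on_has_derivative[OF assms(2), of x]], of v]
  by simp

lemma integration_by_parts:
  fixes f h :: "'a::euclidean_space \<Rightarrow> real"
  assumes f: "is_test f" and h: "smooth_on UNIV h"
  shows "(LINT x|lborel. dir_deriv v f x * h x) = - (LINT x|lborel. f x * dir_deriv v h x)"
proof -
  have fh: "is_test (\<lambda>x. h x * f x)" by (rule is_test_mult[OF h f])
  have i1: "integrable lborel (\<lambda>x. h x * dir_deriv v f x)"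
    by (intro is_test_integrable is_test_mult h is_test_dir_deriv f)
  have i2: "integrable lborel (\<lambda>x. dir_deriv v h x * f x)"
    by (intro is_test_integrable is_test_mult smooth_on_dir_deriv h f)
  have "0 = (LINT x|lborel. dir_deriv v (\<lambda>x. h x * f x) x)"
    using integral_dir_deriv_zero[of "\<lambda>x. h x * f x" v] fh unfolding is_test_def by simp
  also have "\<dots> = (LINT x|lborel. h x * dir_deriv v f x + dir_deriv v h x * f x)"
    using dir_deriv_mult[OF h, of f v] f by (simp add: is_test_def)
  also have "\<dots> = (LINT x|lborel. dir_deriv v f x * h x) + (LINT x|lborel. f x * dir_deriv v h x)"
    using i1 i2 by (simp add: mult.commute)
  finally show ?thesis by simp
qed

text \<open>Real test functions become a type of their own so that they can carry the inner product of \<open>L\<^sup>2\<close> and be used with the theorems on \<open>nonneg_symmetric\<close>.\<close>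

typedef (overloaded) 'a tfun = "{f :: 'a::euclidean_space \<Rightarrow> real. is_test f}"
  morphisms ap Abs_tfun
  using is_test_zero by blast

setup_lifting type_definition_tfun

lemma is_test_ap: "is_test (ap f)"
  using ap[of f] by simp

lemma ap_Abs: "is_test f \<Longrightarrow> ap (Abs_tfun f) = f"
  by (simp add: Abs_tfun_inverse)

lemma smooth_ap: "smooth_on UNIV (ap f)"
  using is_test_ap[of f] by (simp add: is_test_def)

lemma tfun_eqI: "(\<And>x. ap f x = ap g x) \<Longrightarrow> f = g"
  by (simp add: ap_inject[symmetric] ext)

lemma ap_mult_integrable: "smooth_on UNIV h \<Longrightarrow> integrable lborel (\<lambda>x. ap f x * h x)"
  using is_test_integrable[OF is_test_mult[OF _ is_test_ap, of h f]] by (simp add: mult.commute)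

text \<open>The inner product is definite because a continuous function that vanishes almost everywhere vanishes.\<close>

lemma is_test_AE_zero:
  assumes "is_test f" "AE x in lborel. f x = 0"
  shows "f x = 0"
proof -
  have "closed {x. f x = 0}"
    using assms(1) by (intro closed_Collect_eq is_test_continuous continuous_on_const)
  moreover have "AE x in lebesgue. x \<in> {x. f x = 0}"
    using assms(2) by (simp add: AE_completion)
  ultimately show ?thesis using mem_closed_if_AE_lebesgue by blast
qed

instantiation tfun :: (euclidean_space) real_vector
begin
lift_definition zero_tfun :: "'a tfun" is "\<lambda>x. 0" by (rule is_test_zero)
lift_definition plus_tfun :: "'a tfun \<Rightarrow> 'a tfun \<Rightarrow> 'a tfun" is "\<lambda>f g x. f x + g x" by (rule is_test_add)
lift_definition uminus_tfun :: "'a tfun \<Rightarrow> 'a tfun" is "\<lambda>f x. - f x"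
  using is_test_mult[OF smooth_on_const[of _ "-1::real"]] by simp
lift_definition minus_tfun :: "'a tfun \<Rightarrow> 'a tfun \<Rightarrow> 'a tfun" is "\<lambda>f g x. f x - g x"
  using is_test_add[OF _ is_test_mult[OF smooth_on_const[of _ "-1::real"]]] by fastforce
lift_definition scaleR_tfun :: "real \<Rightarrow> 'a tfun \<Rightarrow> 'a tfun" is "\<lambda>r f x. r * f x"
  by (rule is_test_mult[OF smooth_on_const])
instance
proof
  fix f g h :: "'a tfun" and r s :: real
  show "f + g + h = f + (g + h)" by transfer (auto simp: algebra_simps)
  show "f + g = g + f" by transfer (auto simp: algebra_simps)
  show "0 + f = f" by transfer (auto simp: algebra_simps)
  show "- f + f = 0" by transfer (auto simp: algebra_simps)
  show "f - g = f + - g" by transfer (auto simp: algebra_simps)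
  show "r *\<^sub>R (f + g) = r *\<^sub>R f + r *\<^sub>R g" by transfer (auto simp: algebra_simps)
  show "(r + s) *\<^sub>R f = r *\<^sub>R f + s *\<^sub>R f" by transfer (auto simp: algebra_simps)
  show "r *\<^sub>R s *\<^sub>R f = (r * s) *\<^sub>R f" by transfer (auto simp: algebra_simps)
  show "1 *\<^sub>R f = f" by transfer (auto simp: algebra_simps)
qed
end

instantiation tfun :: (euclidean_space) real_inner
begin
definition inner_tfun :: "'a tfun \<Rightarrow> 'a tfun \<Rightarrow> real" where
  "inner_tfun f g = (LINT x|lborel. ap f x * ap g x)"
definition norm_tfun :: "'a tfun \<Rightarrow> real" where "norm_tfun f = sqrt (inner f f)"
definition dist_tfun :: "'a tfun \<Rightarrow> 'a tfun \<Rightarrow> real" where "dist_tfun f g = norm (f - g)"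
definition sgn_tfun :: "'a tfun \<Rightarrow> 'a tfun" where "sgn_tfun f = f /\<^sub>R norm f"
definition uniformity_tfun :: "('a tfun \<times> 'a tfun) filter" where
  "uniformity_tfun = (INF e\<in>{0<..}. principal {(x, y). dist x y < e})"
definition open_tfun :: "'a tfun set \<Rightarrow> bool" where
  "open_tfun U \<longleftrightarrow> (\<forall>x\<in>U. eventually (\<lambda>(x', y). x' = x \<longrightarrow> y \<in> U) uniformity)"
instance
proof
  fix f g h :: "'a tfun" and r s :: real
  show "inner f g = inner g f" by (simp add: inner_tfun_def mult.commute)
  show "inner (f + g) h = inner f h + inner g h"
    by (simp add: inner_tfun_def plus_tfun.rep_eq distrib_right ap_mult_integrable smooth_ap)
  show "inner (r *\<^sub>R f) g = r * inner f g"
    by (simp add: inner_tfun_def scaleR_tfun.rep_eq mult.assoc)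
  show "0 \<le> inner f f" by (simp add: inner_tfun_def)
  show "inner f f = 0 \<longleftrightarrow> f = 0"
  proof
    assume "inner f f = 0"
    then have "AE x in lborel. ap f x * ap f x = 0"
      unfolding inner_tfun_def
      by (subst (asm) integral_nonneg_eq_0_iff_AE) (auto simp: ap_mult_integrable smooth_ap)
    then have "AE x in lborel. ap f x = 0" by simp
    then have "ap f x = 0" for x by (rule is_test_AE_zero[OF is_test_ap])
    then show "f = 0" by (intro tfun_eqI) (simp add: zero_tfun.rep_eq)
  next
    assume "f = 0" then show "inner f f = 0" by (simp add: inner_tfun_def zero_tfun.rep_eq)
  qed
qed (simp_all add: norm_tfun_def dist_tfun_def sgn_tfun_def uniformity_tfun_def open_tfun_def)
end

lemmas ap_simps = zero_tfun.rep_eq plus_tfun.rep_eq uminus_tfun.rep_eq minus_tfun.rep_eq scaleR_tfun.rep_eq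

section \<open>Fourier estimates\<close>

text \<open>Separation of variables with respect to the standard basis.\<close>

lemma integral_lborel_prod:
  fixes h :: "'a::euclidean_space \<Rightarrow> real \<Rightarrow> 'b::{real_normed_field,banach,second_countable_topology}"
  assumes "\<And>b. b \<in> Basis \<Longrightarrow> integrable lborel (h b)"
  shows "integrable lborel (\<lambda>x::'a. \<Prod>b\<in>Basis. h b (x \<bullet> b))"
    and "(LINT x|lborel. (\<Prod>b\<in>Basis. h b ((x::'a) \<bullet> b))) = (\<Prod>b\<in>Basis. (LINT s|lborel. h b s))"
proof -
  interpret product_sigma_finite "\<lambda>b::'a. lborel :: real measure" by standard
  let ?P = "\<Pi>\<^sub>M b\<in>(Basis::'a set). (lborel :: real measure)"
  let ?g = "\<lambda>f. \<Sum>b\<in>(Basis::'a set). f b *\<^sub>R b"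
  have hm: "h b \<in> borel_measurable borel" if "b \<in> Basis" for b using assms[OF that] by auto
  have m: "(\<lambda>x::'a. \<Prod>b\<in>Basis. h b (x \<bullet> b)) \<in> borel_measurable borel"
  proof (rule borel_measurable_prod)
    fix b :: 'a assume "b \<in> Basis"
    show "(\<lambda>x. h b (x \<bullet> b)) \<in> borel_measurable borel"
      by (rule measurable_compose[OF _ hm[OF \<open>b \<in> Basis\<close>]]) simp
  qed
  have L: "(lborel :: 'a measure) = distr ?P borel ?g" by (rule lborel_eq)
  have g: "?g \<in> measurable ?P borel" by measurable
  have eq: "(\<lambda>f. \<Prod>b\<in>Basis. h b (?g f \<bullet> b)) = (\<lambda>f. \<Prod>b\<in>Basis. h b (f b))"
    by (intro ext prod.cong) auto
  have "integrable ?P (\<lambda>f. \<Prod>b\<in>Basis. h b (f b))"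
    using assms by (intro product_integrable_prod) auto
  then show "integrable lborel (\<lambda>x::'a. \<Prod>b\<in>Basis. h b (x \<bullet> b))"
    unfolding L by (subst integrable_distr_eq[OF g m]) (simp only: eq)
  have "(LINT x|lborel. (\<Prod>b\<in>Basis. h b ((x::'a) \<bullet> b))) = (LINT f|?P. (\<Prod>b\<in>Basis. h b (f b)))"
    unfolding L by (subst integral_distr[OF g m]) (simp only: eq)
  also have "\<dots> = (\<Prod>b\<in>Basis. (LINT s|lborel. h b s))"
    using assms by (intro product_integral_prod) auto
  finally show "(LINT x|lborel. (\<Prod>b\<in>Basis. h b ((x::'a) \<bullet> b))) = (\<Prod>b\<in>Basis. (LINT s|lborel. h b s))" .
qed

lemma gauss_integrable:
  fixes \<epsilon> :: real assumes "\<epsilon> > 0"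
  shows "integrable lborel (\<lambda>s. exp (- (\<epsilon> * s)\<^sup>2 / 2))"
    and "(LINT s|lborel. exp (- (\<epsilon> * s)\<^sup>2 / 2)) = sqrt (2 * pi) / \<epsilon>"
proof -
  have eq: "exp (- (\<epsilon> * s)\<^sup>2 / 2) = sqrt (2 * pi) / \<epsilon> * normal_density 0 (1 / \<epsilon>) s" for s
    using assms by (simp add: normal_density_def real_sqrt_divide real_sqrt_mult power_mult_distrib field_simps)
  show "integrable lborel (\<lambda>s. exp (- (\<epsilon> * s)\<^sup>2 / 2))" unfolding eq using assms by (intro integrable_mult_right integrable_normal_density) simp
  show "(LINT s|lborel. exp (- (\<epsilon> * s)\<^sup>2 / 2)) = sqrt (2 * pi) / \<epsilon>" unfolding eq using assms by (simp add: integral_normal_density)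
qed

lemma gauss_fourier:
  fixes \<epsilon> z :: real assumes \<epsilon>: "\<epsilon> > 0"
  shows "(LINT s|lborel. exp (- \<i> * of_real (z * s)) * of_real (exp (- (\<epsilon> * s)\<^sup>2 / 2)))
    = of_real (sqrt (2 * pi) / \<epsilon> * exp (- (z / \<epsilon>)\<^sup>2 / 2))"
proof -
  have c: "(LINT x|std_normal_distribution. cis (t * x)) = of_real (exp (- t\<^sup>2 / 2))" for t
    using fun_cong[OF char_std_normal_distribution, of t] by (simp add: char_def cis_conv_exp)
  have d: "(LINT x|std_normal_distribution. cis (t * x)) = (LINT x|lborel. std_normal_density x *\<^sub>R cis (t * x))" for t
    by (subst integral_density) (auto simp: normal_density_nonneg intro!: borel_measurable_continuous_onI continuous_intros)
  have "(LINT s|lborel. exp (- \<i> * of_real (z * s)) * of_real (exp (- (\<epsilon> * s)\<^sup>2 / 2)))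
     = (1 / \<epsilon>) *\<^sub>R (LINT s|lborel. exp (- \<i> * of_real (z * (s / \<epsilon>))) * of_real (exp (- s\<^sup>2 / 2)))"
    using \<epsilon> by (subst lborel_integral_real_affine[where t = 0 and c = "1 / \<epsilon>"]) auto
  also have "(LINT s|lborel. exp (- \<i> * of_real (z * (s / \<epsilon>))) * of_real (exp (- s\<^sup>2 / 2)))
     = (LINT s|lborel. sqrt (2 * pi) *\<^sub>R (std_normal_density s *\<^sub>R cis ((- z / \<epsilon>) * s)))"
    by (intro Bochner_Integration.integral_cong) (auto simp: std_normal_density_def scaleR_conv_of_real cis_conv_exp simp flip: of_real_mult)
  also have "\<dots> = sqrt (2 * pi) *\<^sub>R of_real (exp (- (- z / \<epsilon>)\<^sup>2 / 2))"
    by (simp only: integral_scaleR_right d[symmetric] c)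
  finally show ?thesis by (simp add: scaleR_conv_of_real)
qed

text \<open>A Gaussian of width \<open>1 / \<epsilon>\<close>, written as a product so that its Fourier transform reduces to one variable.\<close>

definition gauss_window :: "real \<Rightarrow> 'a::euclidean_space \<Rightarrow> real" where
  "gauss_window \<epsilon> \<xi> = (\<Prod>b\<in>Basis. exp (- (\<epsilon> * (\<xi> \<bullet> b))\<^sup>2 / 2))"

text \<open>The Fourier transform of the Gaussian window: positive, and of total mass \<open>(2 * pi) ^ DIM\<close> for each \<open>\<epsilon>\<close>.\<close>

definition gauss_kernel :: "real \<Rightarrow> 'a::euclidean_space \<Rightarrow> real" where
  "gauss_kernel \<epsilon> z = (\<Prod>b\<in>Basis. sqrt (2 * pi) / \<epsilon> * exp (- ((z \<bullet> b) / \<epsilon>)\<^sup>2 / 2))"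

lemma gauss_window_integrable: "\<epsilon> > 0 \<Longrightarrow> integrable lborel (gauss_window \<epsilon> :: 'a::euclidean_space \<Rightarrow> real)"
  unfolding gauss_window_def by (rule integral_lborel_prod(1)) (rule gauss_integrable)

lemma gauss_kernel_integral:
  assumes "\<epsilon> > 0"
  shows "integrable lborel (gauss_kernel \<epsilon> :: 'a::euclidean_space \<Rightarrow> real)"
    and "(LINT z|lborel. gauss_kernel \<epsilon> (z::'a::euclidean_space)) = (2 * pi) ^ DIM('a)"
proof -
  have eq: "exp (- (s / \<epsilon>)\<^sup>2 / 2) = exp (- (1 / \<epsilon> * s)\<^sup>2 / 2)" for s by simp
  have i: "integrable lborel (\<lambda>s. sqrt (2 * pi) / \<epsilon> * exp (- (s / \<epsilon>)\<^sup>2 / 2))"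
    unfolding eq using assms by (intro integrable_mult_right gauss_integrable) simp
  show "integrable lborel (gauss_kernel \<epsilon> :: 'a::euclidean_space \<Rightarrow> real)"
    unfolding gauss_kernel_def by (rule integral_lborel_prod(1)[OF i])
  have "(LINT s|lborel. sqrt (2 * pi) / \<epsilon> * exp (- (s / \<epsilon>)\<^sup>2 / 2)) = 2 * pi"
    unfolding eq using assms gauss_integrable(2)[of "1 / \<epsilon>"] by simp
  then show "(LINT z|lborel. gauss_kernel \<epsilon> (z::'a::euclidean_space)) = (2 * pi) ^ DIM('a)"
    unfolding gauss_kernel_def by (subst integral_lborel_prod(2)[OF i]) simp
qed

lemma gauss_window_fourier:
  assumes "\<epsilon> > 0"
  shows "(LINT \<xi>|lborel. exp (- \<i> * of_real (z \<bullet> \<xi>)) * of_real (gauss_window \<epsilon> \<xi>)) = of_real (gauss_kernel \<epsilon> (z::'a::euclidean_space))"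
proof -
  let ?h = "\<lambda>b s. exp (- \<i> * of_real ((z \<bullet> b) * s)) * of_real (exp (- (\<epsilon> * s)\<^sup>2 / 2))"
  have i: "integrable lborel (?h b)" for b
  proof (rule Bochner_Integration.integrable_bound)
    show "integrable lborel (\<lambda>s. exp (- (\<epsilon> * s)\<^sup>2 / 2))" by (rule gauss_integrable[OF assms])
    show "?h b \<in> borel_measurable lborel" by measurable
  qed (auto simp: norm_mult)
  have "exp (- \<i> * of_real (z \<bullet> \<xi>)) = (\<Prod>b\<in>Basis. exp (- \<i> * of_real ((z \<bullet> b) * (\<xi> \<bullet> b))))" for \<xi>
    by (subst euclidean_inner) (simp add: exp_sum[symmetric] sum_distrib_left sum_negf)
  then have "exp (- \<i> * of_real (z \<bullet> \<xi>)) * of_real (gauss_window \<epsilon> \<xi>) = (\<Prod>b\<in>Basis. ?h b (\<xi> \<bullet> b))" for \<xi>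
    by (simp only: prod.distrib gauss_window_def of_real_prod)
  then have "(LINT \<xi>|lborel. exp (- \<i> * of_real (z \<bullet> \<xi>)) * of_real (gauss_window \<epsilon> \<xi>)) = (\<Prod>b\<in>Basis. (LINT s|lborel. ?h b s))"
    by (simp only: integral_lborel_prod(2)[OF i])
  also have "\<dots> = of_real (gauss_kernel \<epsilon> z)"
    unfolding gauss_fourier[OF assms] gauss_kernel_def by simp
  finally show ?thesis .
qed

lemma fourier_measurable [measurable]:
  fixes f :: "'a::euclidean_space \<Rightarrow> complex"
  assumes [measurable]: "f \<in> borel_measurable borel"
  shows "fourier f \<in> borel_measurable borel"
  unfolding fourier_def by measurable

lemma fourier_bound:
  assumes "integrable lborel f"
  shows "cmod (fourier f \<xi>) \<le> (LINT x|lborel. cmod (f x))"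
  unfolding fourier_def by (rule order.trans[OF integral_norm_bound]) (simp add: norm_mult)

text \<open>Fubini for the symmetric kernel \<open>exp (- \<i> * (x \<bullet> \<xi>))\<close>.\<close>

lemma fourier_multiplication_formula:
  fixes f g :: "'a::euclidean_space \<Rightarrow> complex"
  assumes f: "integrable lborel f" and g: "integrable lborel g"
  shows "(LINT \<xi>|lborel. g \<xi> * fourier f \<xi>) = (LINT x|lborel. f x * fourier g x)"
proof -
  have fm [measurable]: "f \<in> borel_measurable borel" and gm [measurable]: "g \<in> borel_measurable borel"
    using f g by auto
  have "integrable (lborel \<Otimes>\<^sub>M lborel) (\<lambda>(\<xi>, x). g \<xi> * (exp (- \<i> * of_real (x \<bullet> \<xi>)) * f x))"
  proof (rule Bochner_Integration.integrable_bound)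
    have "integrable (lborel \<Otimes>\<^sub>M lborel) (\<lambda>(\<xi>, x). cmod (g \<xi>) * cmod (f x))"
    proof (rule lborel_pair.Fubini_integrable)
      show "(\<lambda>(\<xi>, x). cmod (g \<xi>) * cmod (f x)) \<in> borel_measurable (lborel \<Otimes>\<^sub>M lborel)" by measurable
      show "integrable lborel (\<lambda>x. LINT y|lborel. norm (case (x, y) of (\<xi>, x) \<Rightarrow> cmod (g \<xi>) * cmod (f x)))"
        using g by (simp add: abs_mult)
      show "AE x in lborel. integrable lborel (\<lambda>y. case (x, y) of (\<xi>, x) \<Rightarrow> cmod (g \<xi>) * cmod (f x))"
        using f by simp
    qed
    then show "integrable (lborel \<Otimes>\<^sub>M lborel) (\<lambda>p. cmod (g (fst p)) * cmod (f (snd p)))" by (simp add: split_beta')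
    show "(\<lambda>(\<xi>, x). g \<xi> * (exp (- \<i> * of_real (x \<bullet> \<xi>)) * f x)) \<in> borel_measurable (lborel \<Otimes>\<^sub>M lborel)" by measurable
  qed (auto simp: norm_mult)
  then have "(LINT x|lborel. (LINT \<xi>|lborel. g \<xi> * (exp (- \<i> * of_real (x \<bullet> \<xi>)) * f x)))
     = (LINT \<xi>|lborel. (LINT x|lborel. g \<xi> * (exp (- \<i> * of_real (x \<bullet> \<xi>)) * f x)))"
    by (rule lborel_pair.Fubini_integral)
  moreover have "(LINT x|lborel. g \<xi> * (exp (- \<i> * of_real (x \<bullet> \<xi>)) * f x)) = g \<xi> * fourier f \<xi>" for \<xi>
    unfolding fourier_def by (rule integral_mult_right_zero)
  moreover have "(LINT \<xi>|lborel. g \<xi> * (exp (- \<i> * of_real (x \<bullet> \<xi>)) * f x)) = f x * fourier g x" for x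
    by (simp add: fourier_def inner_commute mult_ac flip: integral_mult_right_zero)
  ultimately show ?thesis by (simp only:)
qed

lemma lborel_distr_uminus_euclidean: "distr lborel borel uminus = (lborel :: 'a::euclidean_space measure)"
proof -
  have "(lborel :: 'a measure) = density (distr lborel borel (\<lambda>x. 0 + (-1) *\<^sub>R x)) (\<lambda>_. \<bar>-1 :: real\<bar> ^ DIM('a))"
    by (rule lborel_affine) simp
  also have "\<dots> = distr lborel borel uminus" by (simp add: density_1)
  finally show ?thesis by simp
qed

text \<open>Two applications of the multiplication formula rewrite the left-hand side as the quadratic form of \<open>f\<close> with the convolution kernel \<open>gauss_kernel\<close>. The kernel is positive with mass \<open>(2 * pi) ^ DIM\<close>, so the Schur test bounds the form.\<close>

lemma gaussian_plancherel:
  fixes f :: "'a::euclidean_space \<Rightarrow> real"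
  assumes f: "is_test f" and \<epsilon>: "\<epsilon> > 0"
  shows "(\<integral>\<^sup>+\<xi>. ennreal (gauss_window \<epsilon> \<xi> * (cmod (fourier (\<lambda>x. of_real (f x)) \<xi>))\<^sup>2) \<partial>lborel)
    \<le> ennreal ((2 * pi) ^ DIM('a) * (LINT x|lborel. (f x)\<^sup>2))"
proof -
  let ?F = "\<lambda>x. complex_of_real (f x)" and ?Fm = "\<lambda>x. complex_of_real (f (- x))"
  let ?W = "gauss_window \<epsilon> :: 'a \<Rightarrow> real" and ?V = "gauss_kernel \<epsilon> :: 'a \<Rightarrow> real"
  have fi: "integrable lborel f" by (rule is_test_integrable[OF f])
  have fm [measurable]: "f \<in> borel_measurable borel" using fi by auto
  have Fi: "integrable lborel ?F" using fi by simp
  have "integrable lborel (\<lambda>x. f (- x))"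
  proof -
    have "integrable (distr lborel borel uminus) f" using fi by (simp add: lborel_distr_uminus_euclidean)
    then show ?thesis by (subst (asm) integrable_distr_eq) auto
  qed
  then have Fmi: "integrable lborel ?Fm" by simp
  have Wi: "integrable lborel ?W" by (rule gauss_window_integrable[OF \<epsilon>])
  have Wm [measurable]: "?W \<in> borel_measurable borel" using Wi by auto
  have Vi: "integrable lborel ?V" by (rule gauss_kernel_integral[OF \<epsilon>])
  have Vm [measurable]: "?V \<in> borel_measurable borel" using Vi by auto
  have W0: "?W \<xi> \<ge> 0" for \<xi> by (simp add: gauss_window_def prod_nonneg)
  have V0: "?V \<xi> \<ge> 0" for \<xi> using \<epsilon> by (auto simp: gauss_kernel_def intro!: prod_nonneg)
  have cnjF: "cnj (fourier ?F \<xi>) = fourier ?Fm \<xi>" for \<xi>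
  proof -
    have "fourier ?Fm \<xi> = (LINT x|distr lborel borel uminus. exp (- \<i> * of_real (x \<bullet> \<xi>)) * of_real (f (- x)))"
      by (simp add: fourier_def lborel_distr_uminus_euclidean)
    also have "\<dots> = (LINT x|lborel. cnj (exp (- \<i> * of_real (x \<bullet> \<xi>)) * of_real (f x)))"
      by (subst integral_distr) (auto simp: exp_cnj)
    also have "\<dots> = cnj (LINT x|lborel. exp (- \<i> * of_real (x \<bullet> \<xi>)) * of_real (f x))"
      by (rule Bochner_Integration.integral_cnj)
    finally show ?thesis by (simp only: fourier_def)
  qed
  \<comment> \<open>the complex conjugate of \<open>fourier ?F\<close> is the transform of the reflected function\<close>
  define g where "g = (\<lambda>\<xi>. of_real (?W \<xi>) * fourier ?Fm \<xi>)"
  define C where "C = (LINT x|lborel. cmod (?Fm x))"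
  have gi: "integrable lborel g"
  proof (rule Bochner_Integration.integrable_bound)
    show "integrable lborel (\<lambda>\<xi>. ?W \<xi> * C)" using Wi by simp
    show "g \<in> borel_measurable lborel" unfolding g_def by measurable
    have "cmod (fourier ?Fm \<xi>) \<le> C" for \<xi> unfolding C_def by (rule fourier_bound[OF Fmi])
    then show "AE x in lborel. norm (g x) \<le> norm (?W x * C)"
      using W0 by (auto simp: g_def norm_mult abs_mult intro!: AE_I2 mult_left_mono order.trans[OF _ abs_ge_self])
  qed
  have sq: "of_real (?W \<xi> * (cmod (fourier ?F \<xi>))\<^sup>2) = g \<xi> * fourier ?F \<xi>" for \<xi>
    by (simp add: g_def cnjF[symmetric] complex_norm_square mult_ac del: of_real_power)
  have fg: "fourier g x = of_real (LINT y|lborel. f (- y) * ?V (x + y))" for x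
  proof -
    have "integrable lborel (\<lambda>\<xi>. exp (- \<i> * of_real (x \<bullet> \<xi>)) * of_real (?W \<xi>))"
      by (rule Bochner_Integration.integrable_bound[OF Wi]) (auto simp: norm_mult)
    note mf = fourier_multiplication_formula[OF Fmi this]
    have "fourier g x = (LINT \<xi>|lborel. exp (- \<i> * of_real (x \<bullet> \<xi>)) * of_real (?W \<xi>) * fourier ?Fm \<xi>)"
      unfolding fourier_def[of g] by (simp only: g_def mult.assoc inner_commute[of _ x])
    also have "\<dots> = (LINT y|lborel. ?Fm y * fourier (\<lambda>\<xi>. exp (- \<i> * of_real (x \<bullet> \<xi>)) * of_real (?W \<xi>)) y)"
      by (rule mf)
    finally have g1: "fourier g x = (LINT y|lborel. ?Fm y * fourier (\<lambda>\<xi>. exp (- \<i> * of_real (x \<bullet> \<xi>)) * of_real (?W \<xi>)) y)" .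
    have "fourier (\<lambda>\<xi>. exp (- \<i> * of_real (x \<bullet> \<xi>)) * of_real (?W \<xi>)) y = of_real (?V (x + y))" for y
      unfolding fourier_def gauss_window_fourier[OF \<epsilon>, symmetric]
      by (intro Bochner_Integration.integral_cong) (auto simp: inner_add_left inner_commute exp_diff exp_minus algebra_simps divide_inverse)
    then show ?thesis unfolding g1 by (simp only: of_real_mult[symmetric] integral_complex_of_real)
  qed
  define h where "h = (\<lambda>x. f x * (LINT y|lborel. f (- y) * ?V (x + y)))"
  have int_eq: "(LINT \<xi>|lborel. ?W \<xi> * (cmod (fourier ?F \<xi>))\<^sup>2) = (LINT x|lborel. h x)"
  proof -
    have "complex_of_real (LINT \<xi>|lborel. ?W \<xi> * (cmod (fourier ?F \<xi>))\<^sup>2) = (LINT \<xi>|lborel. g \<xi> * fourier ?F \<xi>)"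
      by (simp only: integral_complex_of_real[symmetric] sq)
    also have "\<dots> = (LINT x|lborel. ?F x * fourier g x)" by (rule fourier_multiplication_formula[OF Fi gi])
    also have "\<dots> = complex_of_real (LINT x|lborel. h x)"
      by (simp only: fg h_def of_real_mult[symmetric] integral_complex_of_real)
    finally show ?thesis by (simp only: of_real_eq_iff)
  qed
  have intW: "integrable lborel (\<lambda>\<xi>. ?W \<xi> * (cmod (fourier ?F \<xi>))\<^sup>2)"
  proof (rule Bochner_Integration.integrable_bound)
    show "integrable lborel (\<lambda>\<xi>. (LINT x|lborel. cmod (?F x)) *\<^sub>R g \<xi>)" using gi by simp
    show "(\<lambda>\<xi>. ?W \<xi> * (cmod (fourier ?F \<xi>))\<^sup>2) \<in> borel_measurable lborel" by measurable
    have "cmod (fourier ?F \<xi>) \<le> (LINT x|lborel. cmod (?F x))" for \<xi> by (rule fourier_bound[OF Fi])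
    then have "norm (?W \<xi> * (cmod (fourier ?F \<xi>))\<^sup>2) \<le> (LINT x|lborel. cmod (?F x)) * norm (g \<xi>)" for \<xi>
    proof -
      have "norm (?W \<xi> * (cmod (fourier ?F \<xi>))\<^sup>2) = cmod (fourier ?F \<xi>) * (?W \<xi> * cmod (fourier ?F \<xi>))"
        using W0[of \<xi>] by (simp add: power2_eq_square mult_ac)
      also have "\<dots> \<le> (LINT x|lborel. cmod (?F x)) * (?W \<xi> * cmod (fourier ?F \<xi>))"
        using W0[of \<xi>] fourier_bound[OF Fi, of \<xi>] by (intro mult_right_mono) auto
      also have "?W \<xi> * cmod (fourier ?F \<xi>) = norm (g \<xi>)"
        unfolding g_def cnjF[symmetric] using W0[of \<xi>] by (simp add: norm_mult)
      finally show ?thesis .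
    qed
    then show "AE \<xi> in lborel. norm (?W \<xi> * (cmod (fourier ?F \<xi>))\<^sup>2) \<le> norm ((LINT x|lborel. cmod (?F x)) *\<^sub>R g \<xi>)"
      by (simp add: abs_of_nonneg)
  qed
  have "(\<integral>\<^sup>+\<xi>. ennreal (?W \<xi> * (cmod (fourier ?F \<xi>))\<^sup>2) \<partial>lborel) = ennreal (LINT x|lborel. h x)"
    by (subst nn_integral_eq_integral[OF intW]) (use W0 in \<open>auto simp: int_eq\<close>)
  also have "\<dots> \<le> (\<integral>\<^sup>+x. ennreal \<bar>h x\<bar> \<partial>lborel)"
    by (cases "integrable lborel h")
      (auto simp: not_integrable_integral_eq intro: order.trans[OF ennreal_leI[OF abs_ge_self] integral_norm_bound_ennreal[of lborel h, simplified]])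
  also have "\<dots> \<le> (\<integral>\<^sup>+x. (\<integral>\<^sup>+y. (ennreal ((f x)\<^sup>2 / 2) * ennreal (?V (x + y)) + ennreal ((f (- y))\<^sup>2 / 2) * ennreal (?V (x + y))) \<partial>lborel) \<partial>lborel)"
  proof (intro nn_integral_mono)
    fix x
    have "ennreal \<bar>h x\<bar> = ennreal \<bar>LINT y|lborel. f x * (f (- y) * ?V (x + y))\<bar>" by (simp add: h_def)
    also have "\<dots> \<le> (\<integral>\<^sup>+y. ennreal \<bar>f x * (f (- y) * ?V (x + y))\<bar> \<partial>lborel)"
      by (cases "integrable lborel (\<lambda>y. f x * (f (- y) * ?V (x + y)))")
        (auto simp: not_integrable_integral_eq simp del: integral_mult_right_zero intro: integral_norm_bound_ennreal[of lborel "\<lambda>y. f x * (f (- y) * ?V (x + y))", simplified])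
    also have "\<dots> \<le> (\<integral>\<^sup>+y. (ennreal ((f x)\<^sup>2 / 2) * ennreal (?V (x + y)) + ennreal ((f (- y))\<^sup>2 / 2) * ennreal (?V (x + y))) \<partial>lborel)"
    proof (intro nn_integral_mono)
      fix y
      have "0 \<le> (\<bar>f x\<bar> - \<bar>f (- y)\<bar>)\<^sup>2" by simp
      then have "\<bar>f x\<bar> * \<bar>f (- y)\<bar> \<le> (f x)\<^sup>2 / 2 + (f (- y))\<^sup>2 / 2" by (simp add: power2_diff)
      then have "\<bar>f x * (f (- y) * ?V (x + y))\<bar> \<le> ((f x)\<^sup>2 / 2 + (f (- y))\<^sup>2 / 2) * ?V (x + y)"
        using V0[of "x + y"] by (simp add: abs_mult mult.assoc[symmetric] mult_right_mono)
      then have "ennreal \<bar>f x * (f (- y) * ?V (x + y))\<bar> \<le> ennreal (((f x)\<^sup>2 / 2 + (f (- y))\<^sup>2 / 2) * ?V (x + y))"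
        by (rule ennreal_leI)
      then show "ennreal \<bar>f x * (f (- y) * ?V (x + y))\<bar> \<le> ennreal ((f x)\<^sup>2 / 2) * ennreal (?V (x + y)) + ennreal ((f (- y))\<^sup>2 / 2) * ennreal (?V (x + y))"
        using V0[of "x + y"] by (simp only: ennreal_mult ennreal_plus distrib_right[of "ennreal _"] zero_le_power2
          divide_nonneg_pos zero_less_numeral add_nonneg_nonneg)
    qed
    finally show "ennreal \<bar>h x\<bar> \<le> (\<integral>\<^sup>+y. (ennreal ((f x)\<^sup>2 / 2) * ennreal (?V (x + y)) + ennreal ((f (- y))\<^sup>2 / 2) * ennreal (?V (x + y))) \<partial>lborel)" .
  qed
  also have "\<dots> = (\<integral>\<^sup>+x. (\<integral>\<^sup>+y. ennreal ((f x)\<^sup>2 / 2) * ennreal (?V (x + y)) \<partial>lborel) \<partial>lborel)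
     + (\<integral>\<^sup>+x. (\<integral>\<^sup>+y. ennreal ((f (- y))\<^sup>2 / 2) * ennreal (?V (x + y)) \<partial>lborel) \<partial>lborel)"
    by (simp add: nn_integral_add)
  also have "(\<integral>\<^sup>+x. (\<integral>\<^sup>+y. ennreal ((f (- y))\<^sup>2 / 2) * ennreal (?V (x + y)) \<partial>lborel) \<partial>lborel)
     = (\<integral>\<^sup>+y. (\<integral>\<^sup>+x. ennreal ((f (- y))\<^sup>2 / 2) * ennreal (?V (x + y)) \<partial>lborel) \<partial>lborel)"
    by (rule lborel_pair.Fubini') measurable
  also have "(\<integral>\<^sup>+x. (\<integral>\<^sup>+y. ennreal ((f x)\<^sup>2 / 2) * ennreal (?V (x + y)) \<partial>lborel) \<partial>lborel)
     = (\<integral>\<^sup>+x. ennreal ((f x)\<^sup>2 / 2) * (\<integral>\<^sup>+y. ennreal (?V y) \<partial>lborel) \<partial>lborel)"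
  proof (intro nn_integral_cong)
    fix x
    have "(\<integral>\<^sup>+y. ennreal (?V y) \<partial>lborel) = (\<integral>\<^sup>+y. ennreal (?V y) \<partial>distr lborel borel ((+) x))" by (simp add: lborel_distr_plus)
    also have "\<dots> = (\<integral>\<^sup>+y. ennreal (?V (x + y)) \<partial>lborel)" by (subst nn_integral_distr) auto
    finally show "(\<integral>\<^sup>+y. ennreal ((f x)\<^sup>2 / 2) * ennreal (?V (x + y)) \<partial>lborel) = ennreal ((f x)\<^sup>2 / 2) * (\<integral>\<^sup>+y. ennreal (?V y) \<partial>lborel)"
      by (simp add: nn_integral_cmult)
  qed
  also have "(\<integral>\<^sup>+y. (\<integral>\<^sup>+x. ennreal ((f (- y))\<^sup>2 / 2) * ennreal (?V (x + y)) \<partial>lborel) \<partial>lborel)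
     = (\<integral>\<^sup>+y. ennreal ((f (- y))\<^sup>2 / 2) * (\<integral>\<^sup>+x. ennreal (?V x) \<partial>lborel) \<partial>lborel)"
  proof (intro nn_integral_cong)
    fix y
    have "(\<integral>\<^sup>+x. ennreal (?V x) \<partial>lborel) = (\<integral>\<^sup>+x. ennreal (?V x) \<partial>distr lborel borel ((+) y))" by (simp add: lborel_distr_plus)
    also have "\<dots> = (\<integral>\<^sup>+x. ennreal (?V (x + y)) \<partial>lborel)" by (subst nn_integral_distr) (auto simp: add.commute)
    finally show "(\<integral>\<^sup>+x. ennreal ((f (- y))\<^sup>2 / 2) * ennreal (?V (x + y)) \<partial>lborel) = ennreal ((f (- y))\<^sup>2 / 2) * (\<integral>\<^sup>+x. ennreal (?V x) \<partial>lborel)"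
      by (simp add: nn_integral_cmult)
  qed
  also have "(\<integral>\<^sup>+y. ennreal ((f (- y))\<^sup>2 / 2) * (\<integral>\<^sup>+x. ennreal (?V x) \<partial>lborel) \<partial>lborel)
     = (\<integral>\<^sup>+y. ennreal ((f y)\<^sup>2 / 2) * (\<integral>\<^sup>+x. ennreal (?V x) \<partial>lborel) \<partial>lborel)"
  proof -
    have "(\<integral>\<^sup>+y. ennreal ((f y)\<^sup>2 / 2) * (\<integral>\<^sup>+x. ennreal (?V x) \<partial>lborel) \<partial>lborel) =
       (\<integral>\<^sup>+y. ennreal ((f y)\<^sup>2 / 2) * (\<integral>\<^sup>+x. ennreal (?V x) \<partial>lborel) \<partial>distr lborel borel uminus)" by (simp add: lborel_distr_uminus_euclidean)
    then show ?thesis by (subst (asm) nn_integral_distr) auto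
  qed
  also have "(\<integral>\<^sup>+x. ennreal (?V x) \<partial>lborel) = ennreal ((2 * pi) ^ DIM('a))"
    by (subst nn_integral_eq_integral[OF Vi]) (auto simp: V0 gauss_kernel_integral[OF \<epsilon>])
  also have "(\<integral>\<^sup>+x. ennreal ((f x)\<^sup>2 / 2) * ennreal ((2 * pi) ^ DIM('a)) \<partial>lborel) + (\<integral>\<^sup>+x. ennreal ((f x)\<^sup>2 / 2) * ennreal ((2 * pi) ^ DIM('a)) \<partial>lborel)
      = (\<integral>\<^sup>+x. ennreal ((f x)\<^sup>2 * (2 * pi) ^ DIM('a)) \<partial>lborel)"
    by (subst nn_integral_add[symmetric]) (auto intro!: nn_integral_cong simp flip: ennreal_mult' ennreal_plus)
  also have "\<dots> = ennreal ((2 * pi) ^ DIM('a) * (LINT x|lborel. (f x)\<^sup>2))"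
  proof (subst nn_integral_eq_integral)
    have "is_test (\<lambda>x. f x * f x)" using f by (intro is_test_mult) (auto simp: is_test_def)
    then have "integrable lborel (\<lambda>x. (f x)\<^sup>2)" using is_test_integrable by (simp add: power2_eq_square)
    then show "integrable lborel (\<lambda>x. (f x)\<^sup>2 * (2 * pi) ^ DIM('a))" by simp
  qed (auto simp: mult.commute)
  finally show ?thesis .
qed

text \<open>The windows tend to \<open>1\<close> as \<open>\<epsilon>\<close> tends to \<open>0\<close>; Fatou removes them.\<close>

theorem plancherel_bound:
  fixes f :: "'a::euclidean_space \<Rightarrow> real"
  assumes f: "is_test f"
  shows "(\<integral>\<^sup>+\<xi>. ennreal ((cmod (fourier (\<lambda>x. of_real (f x)) \<xi>))\<^sup>2) \<partial>lborel)
    \<le> ennreal ((2 * pi) ^ DIM('a) * (LINT x|lborel. (f x)\<^sup>2))"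
proof -
  let ?G = "\<lambda>\<xi>. (cmod (fourier (\<lambda>x. complex_of_real (f x)) \<xi>))\<^sup>2"
  have fm [measurable]: "f \<in> borel_measurable borel" using is_test_integrable[OF f] by auto
  have Wm [measurable]: "(gauss_window \<epsilon> :: 'a \<Rightarrow> real) \<in> borel_measurable borel" for \<epsilon>
    unfolding gauss_window_def by measurable
  have "(\<lambda>n. gauss_window (1 / real (Suc n)) \<xi> * ?G \<xi>) \<longlonglongrightarrow> 1 * ?G \<xi>" for \<xi> :: 'a
  proof (intro tendsto_mult tendsto_const)
    have "(\<lambda>n. gauss_window (1 / real (Suc n)) \<xi>) \<longlonglongrightarrow> (\<Prod>b\<in>(Basis::'a set). exp (- (0 * (\<xi> \<bullet> b))\<^sup>2 / 2))"
      unfolding gauss_window_def by (intro tendsto_intros LIMSEQ_Suc[OF lim_1_over_n])  auto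
    then show "(\<lambda>n. gauss_window (1 / real (Suc n)) \<xi>) \<longlonglongrightarrow> 1" by simp
  qed
  then have "(\<lambda>n. ennreal (gauss_window (1 / real (Suc n)) \<xi> * ?G \<xi>)) \<longlonglongrightarrow> ennreal (?G \<xi>)" for \<xi> :: 'a
    by (auto intro: tendsto_ennrealI)
  then have lim: "ennreal (?G \<xi>) = liminf (\<lambda>n. ennreal (gauss_window (1 / real (Suc n)) \<xi> * ?G \<xi>))" for \<xi> :: 'a
    by (intro lim_imp_Liminf[symmetric]) auto
  have "(\<integral>\<^sup>+\<xi>. ennreal (?G \<xi>) \<partial>lborel) \<le> liminf (\<lambda>n. \<integral>\<^sup>+\<xi>. ennreal (gauss_window (1 / real (Suc n)) \<xi> * ?G \<xi>) \<partial>lborel)"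
    unfolding lim by (rule nn_integral_liminf) measurable
  also have "\<dots> \<le> liminf (\<lambda>n. ennreal ((2 * pi) ^ DIM('a) * (LINT x|lborel. (f x)\<^sup>2)))"
    by (intro Liminf_mono always_eventually allI gaussian_plancherel[OF f]) simp
  also have "\<dots> = ennreal ((2 * pi) ^ DIM('a) * (LINT x|lborel. (f x)\<^sup>2))" by (simp add: Liminf_const)
  finally show ?thesis .
qed

text \<open>The differential operator with symbol \<open>\<langle>\<xi>\<rangle>\<^sup>2\<close>; the constant is the one in the definition of \<open>bracket\<close>.\<close>

definition bessel_op :: "('a::euclidean_space \<Rightarrow> real) \<Rightarrow> 'a \<Rightarrow> real" where
  "bessel_op f = (\<lambda>x. (exp 1)\<^sup>2 * f x - (\<Sum>b\<in>Basis. dir_deriv b (dir_deriv b f) x))"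

lemma is_test_bessel_op: "is_test f \<Longrightarrow> is_test (bessel_op f)"
proof -
  assume f: "is_test f"
  have "is_test (\<lambda>x. (exp 1)\<^sup>2 * f x + (\<Sum>b\<in>Basis. (- 1) * dir_deriv b (dir_deriv b f) x))"
    by (intro is_test_add is_test_sum is_test_mult smooth_on_const is_test_dir_deriv f)
  then show ?thesis by (simp add: bessel_op_def sum_negf)
qed

text \<open>A real plane wave with a phase. The phases \<open>0\<close> and \<open>- pi / 2\<close> give cosine and sine, and differentiation shifts the phase by \<open>pi / 2\<close>.\<close>

definition wave :: "real \<Rightarrow> 'a::euclidean_space \<Rightarrow> 'a \<Rightarrow> real" where
  "wave c \<xi> x = cos (x \<bullet> \<xi> + c)"

lemma smooth_cos: "smooth_on UNIV (cos :: real \<Rightarrow> real)"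
proof (rule smooth_onI_derivs[where \<F> = "range (\<lambda>c x. cos (x + c))"])
  show "cos \<in> range (\<lambda>c x. cos (x + c :: real))" by (rule image_eqI[of _ _ 0]) auto
  fix h assume "h \<in> range (\<lambda>c x. cos (x + c :: real))"
  then obtain c where h: "h = (\<lambda>x. cos (x + c))" by blast
  have "(h has_real_derivative cos (x + (c + pi / 2))) (at x)" for x
  proof -
    have "(h has_real_derivative - sin (x + c)) (at x)" unfolding h by (auto intro!: derivative_eq_intros)
    moreover have "cos (x + (c + pi / 2)) = - sin (x + c)"
      by (simp add: add.assoc[symmetric] cos_add[of "x + c" "pi / 2"])
    ultimately show ?thesis by simp
  qed
  then show "\<exists>h'\<in>range (\<lambda>c x. cos (x + c)). \<forall>x\<in>UNIV. (h has_real_derivative h' x) (at x)"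
    by (intro bexI[OF _ rangeI[of _ "c + pi / 2"]]) simp
qed simp

lemma smooth_wave: "smooth_on UNIV (wave c \<xi>)"
proof -
  have "smooth_on UNIV (\<lambda>x. cos (0 + (\<lambda>y. y) (c + x)))"
    using smooth_on_affine[OF bounded_linear_ident open_UNIV smooth_cos open_UNIV, of c] by simp
  then have "smooth_on UNIV (\<lambda>x. cos (c + (x \<bullet> \<xi>)))"
    using smooth_on_affine[OF bounded_linear_inner_left[of \<xi>] open_UNIV smooth_cos open_UNIV, of c] by simp
  then show ?thesis by (simp add: wave_def[abs_def] add.commute)
qed

lemma dir_deriv_wave: "dir_deriv v (wave c \<xi>) x = (v \<bullet> \<xi>) * wave (c + pi / 2) \<xi> x"
proof -
  have "(wave c \<xi> has_derivative (\<lambda>v. (v \<bullet> \<xi>) * - sin (x \<bullet> \<xi> + c))) (at x)"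
    unfolding wave_def[abs_def] by (auto intro!: derivative_eq_intros simp: mult_ac)
  then have "dir_deriv v (wave c \<xi>) x = (v \<bullet> \<xi>) * - sin (x \<bullet> \<xi> + c)" by (rule dir_deriv_eq)
  moreover have "cos (x \<bullet> \<xi> + (c + pi / 2)) = - sin (x \<bullet> \<xi> + c)"
    by (simp add: add.assoc[symmetric] cos_add[of "x \<bullet> \<xi> + c" "pi / 2"])
  ultimately show ?thesis by (simp add: wave_def)
qed

lemma wave_shift: "wave (c + pi / 2 + pi / 2) \<xi> x = - wave c \<xi> x"
proof -
  have "x \<bullet> \<xi> + (c + pi / 2 + pi / 2) = (x \<bullet> \<xi> + c) + pi" by simp
  then show ?thesis unfolding wave_def by (simp only: cos_periodic_pi)
qed

lemma bessel_op_wave: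
  fixes f :: "'a::euclidean_space \<Rightarrow> real"
  assumes f: "is_test f"
  shows "(LINT x|lborel. bessel_op f x * wave c \<xi> x) = (bracket \<xi>)\<^sup>2 * (LINT x|lborel. f x * wave c \<xi> x)"
proof -
  let ?h = "wave c \<xi>"
  have int: "integrable lborel (\<lambda>x. g x * ?h x)" if "is_test g" for g
    using is_test_integrable[OF is_test_mult[OF smooth_wave that]] by (simp add: mult.commute)
  have d: "(LINT x|lborel. dir_deriv b (dir_deriv b f) x * ?h x) = - (\<xi> \<bullet> b)\<^sup>2 * (LINT x|lborel. f x * ?h x)" for b
  proof -
    have "(LINT x|lborel. dir_deriv b (dir_deriv b f) x * ?h x) = - (LINT x|lborel. dir_deriv b f x * ((b \<bullet> \<xi>) * wave (c + pi / 2) \<xi> x))"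
      using integration_by_parts[OF is_test_dir_deriv[OF f] smooth_wave, of b b] by (simp add: dir_deriv_wave)
    also have "\<dots> = - (b \<bullet> \<xi>) * (LINT x|lborel. dir_deriv b f x * wave (c + pi / 2) \<xi> x)"
      by (simp add: mult.left_commute)
    also have "(LINT x|lborel. dir_deriv b f x * wave (c + pi / 2) \<xi> x) = (b \<bullet> \<xi>) * (LINT x|lborel. f x * ?h x)"
    proof -
      have "dir_deriv b (wave (c + pi / 2) \<xi>) x = - ((b \<bullet> \<xi>) * ?h x)" for x
        by (simp only: dir_deriv_wave wave_shift mult_minus_right)
      then show ?thesis using integration_by_parts[OF f smooth_wave, of b "c + pi / 2" \<xi>]
        by (simp only: minus_mult_right[symmetric] integral_minus minus_minus mult.left_commute[of _ "b \<bullet> \<xi>"] integral_mult_right_zero)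
    qed
    finally show ?thesis by (simp add: power2_eq_square inner_commute)
  qed
  have "(LINT x|lborel. bessel_op f x * ?h x)
     = (LINT x|lborel. (exp 1)\<^sup>2 * (f x * ?h x) - (\<Sum>b\<in>Basis. dir_deriv b (dir_deriv b f) x * ?h x))"
    by (simp add: bessel_op_def left_diff_distrib sum_distrib_right mult.assoc)
  also have "\<dots> = (exp 1)\<^sup>2 * (LINT x|lborel. f x * ?h x) - (\<Sum>b\<in>Basis. (LINT x|lborel. dir_deriv b (dir_deriv b f) x * ?h x))"
  proof -
    have i: "integrable lborel (\<lambda>x. dir_deriv b (dir_deriv b f) x * ?h x)" for b
      by (intro int is_test_dir_deriv f)
    have "(LINT x|lborel. (\<Sum>b\<in>Basis. dir_deriv b (dir_deriv b f) x * ?h x)) = (\<Sum>b\<in>Basis. (LINT x|lborel. dir_deriv b (dir_deriv b f) x * ?h x))"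
      by (rule Bochner_Integration.integral_sum) (rule i)
    moreover have "integrable lborel (\<lambda>x. (\<Sum>b\<in>Basis. dir_deriv b (dir_deriv b f) x * ?h x))"
      by (intro Bochner_Integration.integrable_sum i)
    ultimately show ?thesis by (simp add: int f)
  qed
  also have "\<dots> = ((exp 1)\<^sup>2 + (\<Sum>b\<in>Basis. (\<xi> \<bullet> b)\<^sup>2)) * (LINT x|lborel. f x * ?h x)"
    unfolding d by (simp add: sum_negf sum_distrib_right[symmetric] distrib_right)
  also have "(exp 1)\<^sup>2 + (\<Sum>b\<in>Basis. (\<xi> \<bullet> b)\<^sup>2) = (bracket \<xi>)\<^sup>2"
  proof -
    have "(norm \<xi>)\<^sup>2 = (\<Sum>b\<in>Basis. (\<xi> \<bullet> b)\<^sup>2)"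
      by (simp only: power2_norm_eq_inner euclidean_inner[of \<xi> \<xi>]) (simp add: power2_eq_square)
    then show ?thesis by (simp add: bracket_def sum_nonneg)
  qed
  finally show ?thesis .
qed

text \<open>Integration by parts moves \<open>bessel_op\<close> from the wave to \<open>f\<close>, each time with a gain of \<open>\<langle>\<xi>\<rangle>\<^sup>2\<close>, uniformly in the phase.\<close>

theorem wave_integral_decay:
  fixes f :: "'a::euclidean_space \<Rightarrow> real"
  assumes f: "is_test f"
  shows "\<exists>B. \<forall>c \<xi>. bracket \<xi> ^ (2 * k) * \<bar>LINT x|lborel. f x * wave c \<xi> x\<bar> \<le> B"
proof -
  have t: "is_test ((bessel_op ^^ k) f)" for k by (induction k) (auto simp: f is_test_bessel_op)
  have eq: "(LINT x|lborel. (bessel_op ^^ k) f x * wave c \<xi> x) = bracket \<xi> ^ (2 * k) * (LINT x|lborel. f x * wave c \<xi> x)" for c \<xi> k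
  proof (induction k)
    case (Suc k)
    then show ?case using bessel_op_wave[OF t[of k], of c \<xi>] by (simp add: power_add power2_eq_square mult_ac)
  qed simp
  have "bracket \<xi> ^ (2 * k) * \<bar>LINT x|lborel. f x * wave c \<xi> x\<bar> \<le> (LINT x|lborel. \<bar>(bessel_op ^^ k) f x\<bar>)" for c \<xi>
  proof -
    have "bracket \<xi> ^ (2 * k) * \<bar>LINT x|lborel. f x * wave c \<xi> x\<bar> = \<bar>LINT x|lborel. (bessel_op ^^ k) f x * wave c \<xi> x\<bar>"
      unfolding eq by (simp add: abs_mult bracket_def)
    also have "\<dots> \<le> (LINT x|lborel. \<bar>(bessel_op ^^ k) f x * wave c \<xi> x\<bar>)" by (rule integral_abs_bound)
    also have "\<dots> \<le> (LINT x|lborel. \<bar>(bessel_op ^^ k) f x\<bar>)"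
    proof (rule integral_mono)
      show "integrable lborel (\<lambda>x. \<bar>(bessel_op ^^ k) f x\<bar>)" using is_test_integrable[OF t] by simp
      show "integrable lborel (\<lambda>x. \<bar>(bessel_op ^^ k) f x * wave c \<xi> x\<bar>)"
        using is_test_integrable[OF is_test_mult[OF smooth_wave t]] by (simp add: mult.commute)
      show "\<bar>(bessel_op ^^ k) f x * wave c \<xi> x\<bar> \<le> \<bar>(bessel_op ^^ k) f x\<bar>" for x
        by (simp add: abs_mult wave_def mult_left_le)
    qed
    finally show ?thesis .
  qed
  then show ?thesis by blast
qed

lemma fourier_wave:
  assumes "is_test f"
  shows "fourier (\<lambda>x. of_real (f x)) \<xi> = of_real (LINT x|lborel. f x * wave 0 \<xi> x) - \<i> * of_real (LINT x|lborel. f x * wave (- pi / 2) \<xi> x)"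
proof -
  have int: "integrable lborel (\<lambda>x. complex_of_real (f x * wave c \<xi> x))" for c
    by (intro integrable_of_real)
      (use is_test_integrable[OF is_test_mult[OF smooth_wave assms]] in \<open>simp add: mult.commute\<close>)
  have w: "wave (- pi / 2) \<xi> x = sin (x \<bullet> \<xi>)" for x
    by (simp add: wave_def cos_diff[of "x \<bullet> \<xi>" "pi / 2", simplified])
  have "exp (- \<i> * of_real (x \<bullet> \<xi>)) * of_real (f x) = of_real (f x * wave 0 \<xi> x) - \<i> * of_real (f x * wave (- pi / 2) \<xi> x)" for x
  proof -
    have "exp (- \<i> * of_real (x \<bullet> \<xi>)) = cis (- (x \<bullet> \<xi>))" by (simp add: cis_conv_exp)
    then show ?thesis unfolding w by (simp add: wave_def complex_eq_iff)
  qed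
  then have "fourier (\<lambda>x. of_real (f x)) \<xi> = (LINT x|lborel. of_real (f x * wave 0 \<xi> x) - \<i> * of_real (f x * wave (- pi / 2) \<xi> x))"
    by (simp only: fourier_def)
  also have "\<dots> = (LINT x|lborel. of_real (f x * wave 0 \<xi> x)) - \<i> * (LINT x|lborel. of_real (f x * wave (- pi / 2) \<xi> x))"
    by (subst Bochner_Integration.integral_diff) (use int in \<open>auto simp del: of_real_mult\<close>)
  finally show ?thesis by (simp only: integral_complex_of_real)
qed

section \<open>The spatial operator\<close>

text \<open>The operator \<open>L2_op\<close> on real functions; since its coefficients are real it acts on real and imaginary parts separately.\<close>

definition L2_real :: "('m::finite \<Rightarrow> 'm \<Rightarrow> real^'m \<Rightarrow> real) \<Rightarrow> (real^'m \<Rightarrow> real) \<Rightarrow> (real^'m \<Rightarrow> real) \<Rightarrow> real^'m \<Rightarrow> real" where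
  "L2_real b b0 f y = - (\<Sum>j\<in>UNIV. \<Sum>k\<in>UNIV. dir_deriv (axis j 1) (\<lambda>z. b j k z * dir_deriv (axis k 1) f z) y) + b0 y * f y"

definition supported_in :: "'a::euclidean_space set \<Rightarrow> 'a tfun set" where
  "supported_in U = {f. supp (ap f) \<subseteq> U}"

lemma supported_inI: "closed K \<Longrightarrow> K \<subseteq> U \<Longrightarrow> (\<And>x. x \<notin> K \<Longrightarrow> ap f x = 0) \<Longrightarrow> f \<in> supported_in U"
  unfolding supported_in_def using supp_subsetI[of K "ap f"] by blast

lemma subspace_supported_in: "subspace (supported_in U)"
proof (rule subspaceI)
  show "0 \<in> supported_in U" by (rule supported_inI[of "{}"]) (auto simp: ap_simps)
  fix f g :: "'a tfun" and r :: real assume f: "f \<in> supported_in U"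
  show "r *\<^sub>R f \<in> supported_in U"
    by (rule supported_inI[of "supp (ap f)"]) (use f in \<open>auto simp: ap_simps supported_in_def not_in_supp\<close>)
  assume g: "g \<in> supported_in U"
  show "f + g \<in> supported_in U"
    by (rule supported_inI[of "supp (ap f) \<union> supp (ap g)"]) (use f g in \<open>auto simp: ap_simps supported_in_def not_in_supp\<close>)
qed

lemma supported_in_outside: "f \<in> supported_in U \<Longrightarrow> x \<notin> U \<Longrightarrow> ap f x = 0"
  unfolding supported_in_def by (auto intro: not_in_supp)

lemma dir_deriv_add:
  assumes "smooth_on UNIV f" "smooth_on UNIV g"
  shows "dir_deriv v (\<lambda>x. f x + g x) x = dir_deriv v f x + dir_deriv v g x"
  using dir_deriv_eq[OF has_derivative_add[OF smooth_on_has_derivative[OF assms(1), of x] smooth_on_has_derivative[OF assms(2), of x]], of v]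
  by simp

lemma dir_deriv_linear:
  assumes "bounded_linear h" "smooth_on UNIV f"
  shows "dir_deriv v (\<lambda>x. h (f x)) x = h (dir_deriv v f x)"
  using dir_deriv_eq[OF bounded_linear.has_derivative[OF assms(1) smooth_on_has_derivative[OF assms(2), of x]], of v]
  by simp

lemma dir_deriv_cmult:
  fixes f :: "'a::euclidean_space \<Rightarrow> real"
  assumes "smooth_on UNIV f"
  shows "dir_deriv v (\<lambda>x. r * f x) x = r * dir_deriv v f x"
  by (rule dir_deriv_linear[OF bounded_linear_mult_right assms])

context
  fixes b :: "'m::finite \<Rightarrow> 'm \<Rightarrow> real^'m \<Rightarrow> real" and b0 :: "real^'m \<Rightarrow> real"
  assumes b_smooth: "\<And>j k. smooth_on UNIV (b j k)" and b0_smooth: "smooth_on UNIV b0"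
begin

lemma is_test_flux: "is_test f \<Longrightarrow> is_test (\<lambda>z. b j k z * dir_deriv (axis k 1) f z)"
  by (intro is_test_mult is_test_dir_deriv b_smooth)

lemma is_test_L2_real:
  assumes f: "is_test f" shows "is_test (L2_real b b0 f)"
proof -
  have "is_test (\<lambda>y. (-1) * (\<Sum>j\<in>UNIV. \<Sum>k\<in>UNIV. dir_deriv (axis j 1) (\<lambda>z. b j k z * dir_deriv (axis k 1) f z) y) + b0 y * f y)"
    by (intro is_test_add is_test_mult smooth_on_const is_test_sum is_test_dir_deriv is_test_flux f b0_smooth)
  then show ?thesis by (simp add: L2_real_def[abs_def])
qed

lemma L2_real_add:
  assumes f: "is_test f" and h: "is_test h"
  shows "L2_real b b0 (\<lambda>x. f x + h x) y = L2_real b b0 f y + L2_real b b0 h y"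
proof -
  have fs: "smooth_on UNIV f" "smooth_on UNIV h" using f h by (auto simp: is_test_def)
  have 1: "dir_deriv (axis k 1) (\<lambda>x. f x + h x) = (\<lambda>z. dir_deriv (axis k 1) f z + dir_deriv (axis k 1) h z)" for k
    by (rule ext) (rule dir_deriv_add[OF fs])
  have 2: "dir_deriv (axis j 1) (\<lambda>z. b j k z * dir_deriv (axis k 1) f z + b j k z * dir_deriv (axis k 1) h z) y
     = dir_deriv (axis j 1) (\<lambda>z. b j k z * dir_deriv (axis k 1) f z) y + dir_deriv (axis j 1) (\<lambda>z. b j k z * dir_deriv (axis k 1) h z) y" for j k
    using is_test_flux[OF f, of j k] is_test_flux[OF h, of j k] by (intro dir_deriv_add) (auto simp: is_test_def)
  show ?thesis unfolding L2_real_def 1 distrib_left 2 by (simp add: sum.distrib)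
qed

lemma L2_real_cmult:
  assumes f: "is_test f"
  shows "L2_real b b0 (\<lambda>x. r * f x) y = r * L2_real b b0 f y"
proof -
  have fs: "smooth_on UNIV f" using f by (auto simp: is_test_def)
  have 1: "dir_deriv (axis k 1) (\<lambda>x. r * f x) = (\<lambda>z. r * dir_deriv (axis k 1) f z)" for k
    by (rule ext) (rule dir_deriv_cmult[OF fs])
  have 2: "dir_deriv (axis j 1) (\<lambda>z. b j k z * (r * dir_deriv (axis k 1) f z)) y
     = r * dir_deriv (axis j 1) (\<lambda>z. b j k z * dir_deriv (axis k 1) f z) y" for j k
    using dir_deriv_cmult[of "\<lambda>z. b j k z * dir_deriv (axis k 1) f z" "axis j 1" r y] is_test_flux[OF f, of j k]
    by (simp add: is_test_def mult.left_commute)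
  show ?thesis unfolding L2_real_def 1 2 by (simp add: sum_distrib_left algebra_simps)
qed

lemma L2_real_outside:
  assumes K: "closed K" "\<And>x. x \<notin> K \<Longrightarrow> f x = 0" "x \<notin> K"
  shows "L2_real b b0 f x = 0"
proof -
  have "dir_deriv (axis j 1) (\<lambda>z. b j k z * dir_deriv (axis k 1) f z) x = 0" for j k
    by (rule dir_deriv_outside[OF K(1) _ K(3)]) (simp add: dir_deriv_outside[OF K(1,2)])
  then show ?thesis using K by (simp add: L2_real_def)
qed

lemma L2_real_form:
  assumes f: "is_test f" and h: "is_test h"
  shows "(LINT y|lborel. L2_real b b0 f y * h y)
    = (\<Sum>j\<in>UNIV. \<Sum>k\<in>UNIV. (LINT y|lborel. b j k y * dir_deriv (axis k 1) f y * dir_deriv (axis j 1) h y)) + (LINT y|lborel. b0 y * f y * h y)"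
proof -
  have hs: "smooth_on UNIV h" using h by (simp add: is_test_def)
  let ?d = "\<lambda>j k y. dir_deriv (axis j 1) (\<lambda>z. b j k z * dir_deriv (axis k 1) f z) y * h y"
  have i: "integrable lborel (?d j k)" for j k
    using is_test_integrable[OF is_test_mult[OF hs is_test_dir_deriv[OF is_test_flux[OF f, of j k], of "axis j 1"]]] by (simp add: mult.commute)
  have i0: "integrable lborel (\<lambda>y. b0 y * f y * h y)"
    using is_test_integrable[OF is_test_mult[OF hs is_test_mult[OF b0_smooth f]]] by (simp add: mult.commute)
  have isum: "integrable lborel (\<lambda>y. \<Sum>j\<in>UNIV. \<Sum>k\<in>UNIV. ?d j k y)"
    by (intro Bochner_Integration.integrable_sum i)
  have "(LINT y|lborel. L2_real b b0 f y * h y) = (LINT y|lborel. b0 y * f y * h y - (\<Sum>j\<in>UNIV. \<Sum>k\<in>UNIV. ?d j k y))"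
    by (simp add: L2_real_def left_diff_distrib sum_distrib_right)
  also have "\<dots> = (LINT y|lborel. b0 y * f y * h y) - (LINT y|lborel. (\<Sum>j\<in>UNIV. \<Sum>k\<in>UNIV. ?d j k y))"
    by (rule Bochner_Integration.integral_diff[OF i0 isum])
  also have "(LINT y|lborel. (\<Sum>j\<in>UNIV. \<Sum>k\<in>UNIV. ?d j k y)) = (\<Sum>j\<in>UNIV. (LINT y|lborel. (\<Sum>k\<in>UNIV. ?d j k y)))"
    by (intro Bochner_Integration.integral_sum Bochner_Integration.integrable_sum i)
  also have "\<dots> = (\<Sum>j\<in>UNIV. \<Sum>k\<in>UNIV. (LINT y|lborel. ?d j k y))"
    by (intro sum.cong Bochner_Integration.integral_sum i refl)
  also have "\<dots> = (\<Sum>j\<in>UNIV. \<Sum>k\<in>UNIV. - (LINT y|lborel. b j k y * dir_deriv (axis k 1) f y * dir_deriv (axis j 1) h y))"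
    by (simp add: integration_by_parts[OF is_test_flux[OF f] hs])
  finally show ?thesis by (simp add: sum_negf)
qed

lemma L2_real_symmetric:
  assumes sym: "\<And>j k y. b j k y = b k j y" and f: "is_test f" and h: "is_test h"
  shows "(LINT y|lborel. L2_real b b0 f y * h y) = (LINT y|lborel. f y * L2_real b b0 h y)"
proof -
  have "(\<Sum>j\<in>UNIV. \<Sum>k\<in>UNIV. (LINT y|lborel. b j k y * dir_deriv (axis k 1) f y * dir_deriv (axis j 1) h y))
     = (\<Sum>k\<in>UNIV. \<Sum>j\<in>UNIV. (LINT y|lborel. b j k y * dir_deriv (axis k 1) f y * dir_deriv (axis j 1) h y))"
    by (rule sum.swap)
  also have "\<dots> = (\<Sum>j\<in>UNIV. \<Sum>k\<in>UNIV. (LINT y|lborel. b j k y * dir_deriv (axis k 1) h y * dir_deriv (axis j 1) f y))"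
    by (subst sym) (simp add: mult.assoc mult.commute[of "dir_deriv _ f _"])
  finally have "(LINT y|lborel. L2_real b b0 f y * h y) = (LINT y|lborel. L2_real b b0 h y * f y)"
    unfolding L2_real_form[OF f h] L2_real_form[OF h f] by (simp add: mult.assoc mult.commute[of "f _" "h _"])
  then show ?thesis by (simp add: mult.commute)
qed

lemma L2_real_semibounded:
  assumes nonneg: "\<And>y \<eta>. (\<Sum>j\<in>UNIV. \<Sum>k\<in>UNIV. b j k y * (\<eta> $ j) * (\<eta> $ k)) \<ge> 0" and f: "is_test f"
    and C: "\<And>y. f y \<noteq> 0 \<Longrightarrow> - C \<le> b0 y"
  shows "- C * (LINT y|lborel. f y * f y) \<le> (LINT y|lborel. L2_real b b0 f y * f y)"
proof -
  have fs: "smooth_on UNIV f" using f by (simp add: is_test_def)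
  let ?d = "\<lambda>j k y. b j k y * dir_deriv (axis k 1) f y * dir_deriv (axis j 1) f y"
  have i: "integrable lborel (?d j k)" for j k
    using is_test_integrable[OF is_test_mult[OF smooth_on_dir_deriv[OF fs, of "axis j 1"] is_test_flux[OF f, of j k]]] by (simp add: mult.commute)
  have "(\<Sum>j\<in>UNIV. \<Sum>k\<in>UNIV. (LINT y|lborel. ?d j k y)) = (\<Sum>j\<in>UNIV. (LINT y|lborel. (\<Sum>k\<in>UNIV. ?d j k y)))"
    by (intro sum.cong Bochner_Integration.integral_sum[symmetric] i refl)
  also have "\<dots> = (LINT y|lborel. (\<Sum>j\<in>UNIV. \<Sum>k\<in>UNIV. ?d j k y))"
    by (intro Bochner_Integration.integral_sum[symmetric] Bochner_Integration.integrable_sum i)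
  also have "\<dots> \<ge> 0"
  proof (rule Bochner_Integration.integral_nonneg)
    fix y
    show "0 \<le> (\<Sum>j\<in>UNIV. \<Sum>k\<in>UNIV. ?d j k y)"
    proof -
      have "(\<Sum>j\<in>UNIV. \<Sum>k\<in>UNIV. ?d j k y)
        = (\<Sum>j\<in>UNIV. \<Sum>k\<in>UNIV. b j k y * ((\<chi> j. dir_deriv (axis j 1) f y) $ j) * ((\<chi> j. dir_deriv (axis j 1) f y) $ k))"
        by (intro sum.cong refl) (simp only: vec_lambda_beta mult_ac)
      then show ?thesis using nonneg[of y "\<chi> j. dir_deriv (axis j 1) f y"] by (simp only:)
    qed
  qed
  finally have pos: "0 \<le> (\<Sum>j\<in>UNIV. \<Sum>k\<in>UNIV. (LINT y|lborel. ?d j k y))" .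
  have "(LINT y|lborel. (- C) * (f y * f y)) \<le> (LINT y|lborel. b0 y * f y * f y)"
  proof (rule integral_mono)
    show "integrable lborel (\<lambda>y. (- C) * (f y * f y))" by (intro integrable_mult_right is_test_integrable is_test_mult fs f)
    show "integrable lborel (\<lambda>y. b0 y * f y * f y)"
      unfolding mult.assoc by (intro is_test_integrable is_test_mult fs f b0_smooth)
    show "(- C) * (f y * f y) \<le> b0 y * f y * f y" for y
      using mult_right_mono[OF C[of y], of "f y * f y"] by (cases "f y = 0") (auto simp: mult.assoc)
  qed
  then show ?thesis unfolding L2_real_form[OF f f] using pos by simp
qed

text \<open>The shift by a lower bound of the zero-order coefficient makes the quadratic form nonnegative on functions supported where that bound holds.\<close>

definition shifted_op :: "real \<Rightarrow> (real^'m) tfun \<Rightarrow> (real^'m) tfun" where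
  "shifted_op C f = Abs_tfun (\<lambda>y. L2_real b b0 (ap f) y + C * ap f y)"

lemma ap_shifted_op: "ap (shifted_op C f) y = L2_real b b0 (ap f) y + C * ap f y"
proof -
  have "is_test (\<lambda>y. L2_real b b0 (ap f) y + C * ap f y)"
    by (intro is_test_add is_test_L2_real is_test_mult smooth_on_const is_test_ap)
  then show ?thesis unfolding shifted_op_def by (subst ap_Abs) auto
qed

lemma inner_shifted_op: "inner (shifted_op C f) h = (LINT y|lborel. L2_real b b0 (ap f) y * ap h y) + C * inner f h"
proof -
  have "integrable lborel (\<lambda>y. L2_real b b0 (ap f) y * ap h y)"
    using is_test_integrable[OF is_test_mult[OF smooth_ap is_test_L2_real[OF is_test_ap]]] by (simp add: mult.commute)
  moreover have "integrable lborel (\<lambda>y. ap f y * ap h y)" by (rule ap_mult_integrable[OF smooth_ap])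
  ultimately show ?thesis by (simp add: inner_tfun_def ap_shifted_op distrib_right mult.assoc)
qed

lemma shifted_op_nonneg_symmetric:
  assumes sym: "\<And>j k y. b j k y = b k j y"
    and nonneg: "\<And>y \<eta>. (\<Sum>j\<in>UNIV. \<Sum>k\<in>UNIV. b j k y * (\<eta> $ j) * (\<eta> $ k)) \<ge> 0"
    and C: "\<And>y. y \<in> U \<Longrightarrow> - C \<le> b0 y"
  shows "nonneg_symmetric (supported_in U) (shifted_op C)"
proof
  show "subspace (supported_in U :: (real^'m) tfun set)" by (rule subspace_supported_in)
  fix f h :: "(real^'m) tfun" and r :: real assume f: "f \<in> supported_in U"
  show "shifted_op C f \<in> supported_in U"
    by (rule supported_inI[of "supp (ap f)"])
      (use f in \<open>auto simp: supported_in_def ap_shifted_op not_in_supp intro!: L2_real_outside[of "supp (ap f)"]\<close>)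
  show "shifted_op C (r *\<^sub>R f) = r *\<^sub>R shifted_op C f"
    by (rule tfun_eqI) (simp add: ap_shifted_op ap_simps L2_real_cmult[OF is_test_ap] distrib_left mult.left_commute)
  show "0 \<le> inner (shifted_op C f) f"
  proof -
    have "- C \<le> b0 y" if "ap f y \<noteq> 0" for y using C supported_in_outside[OF f, of y] that by blast
    then have "- C * (LINT y|lborel. ap f y * ap f y) \<le> (LINT y|lborel. L2_real b b0 (ap f) y * ap f y)"
      by (rule L2_real_semibounded[OF nonneg is_test_ap])
    then show ?thesis unfolding inner_shifted_op by (simp add: inner_tfun_def[of f f])
  qed
  assume h: "h \<in> supported_in U"
  show "shifted_op C (f + h) = shifted_op C f + shifted_op C h"
    by (rule tfun_eqI) (simp add: ap_shifted_op ap_simps L2_real_add[OF is_test_ap is_test_ap] distrib_left)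
  show "inner (shifted_op C f) h = inner f (shifted_op C h)"
  proof -
    have "inner f (shifted_op C h) = (LINT y|lborel. ap f y * L2_real b b0 (ap h) y) + C * inner h f"
      by (simp only: inner_commute[of f "shifted_op C h"] inner_shifted_op mult.commute[of "ap f _"])
    then show ?thesis
      by (simp only: inner_shifted_op L2_real_symmetric[OF sym is_test_ap is_test_ap] inner_commute[of h f])
  qed
qed

end

section \<open>Weak flows along moving test functions\<close>

text \<open>Turns the Taylor inequality in the definition of a weak flow into a derivative.\<close>

lemma quadratic_remainder_derivative:
  fixes f :: "real \<Rightarrow> real"
  assumes "\<And>y. y \<in> S \<Longrightarrow> \<bar>f y - f x - (y - x) * d\<bar> \<le> K * (y - x)\<^sup>2"
  shows "(f has_real_derivative d) (at x within S)"
proof -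
  have "((\<lambda>y. (f y - f x) / (y - x) - d) \<longlongrightarrow> 0) (at x within S)"
  proof (rule Lim_null_comparison)
    show "((\<lambda>y. K * \<bar>y - x\<bar>) \<longlongrightarrow> 0) (at x within S)" by (auto intro!: tendsto_eq_intros)
    show "eventually (\<lambda>y. norm ((f y - f x) / (y - x) - d) \<le> K * \<bar>y - x\<bar>) (at x within S)"
      unfolding eventually_at_filter
    proof (intro always_eventually allI impI)
      fix y assume y: "y \<noteq> x" "y \<in> S"
      have "norm ((f y - f x) / (y - x) - d) = \<bar>f y - f x - (y - x) * d\<bar> / \<bar>y - x\<bar>"
      proof -
        have "(f y - f x) / (y - x) - d = (f y - f x - (y - x) * d) / (y - x)" using y by (simp add: diff_divide_distrib)
        then show ?thesis by (simp only: real_norm_def abs_divide)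
      qed
      also have "\<dots> \<le> K * (y - x)\<^sup>2 / \<bar>y - x\<bar>" by (rule divide_right_mono[OF assms[OF y(2)]]) simp
      also have "\<dots> = K * \<bar>y - x\<bar>" 
      proof -
        have cancel: "K * (a * a) / a = K * a" if "a \<noteq> 0" for a :: real using that by simp
        have "(y - x)\<^sup>2 = \<bar>y - x\<bar> * \<bar>y - x\<bar>" by (simp add: power2_eq_square)
        then show ?thesis using cancel[of "\<bar>y - x\<bar>"] y(1) by (simp only: abs_eq_0 right_minus_eq not_False_eq_True)
      qed
      finally show "norm ((f y - f x) / (y - x) - d) \<le> K * \<bar>y - x\<bar>" .
    qed
  qed
  then show ?thesis unfolding has_field_derivative_iff by (rule LIM_zero_cancel)
qed

context nonneg_symmetric
begin

lemma weak_flow_linear: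
  assumes "weak_flow S c l" "x \<in> D" "y \<in> D"
  shows "l t (x + y) = l t x + l t y" "l t (r *\<^sub>R x) = r * l t x" "l t 0 = 0" "l t (x - y) = l t x - l t y"
proof -
  have add: "l t (x + y) = l t x + l t y" if "x \<in> D" "y \<in> D" for x y using assms(1) that unfolding weak_flow_def by blast
  have sc: "l t (r *\<^sub>R x) = r * l t x" if "x \<in> D" for x r using assms(1) that unfolding weak_flow_def by blast
  show "l t (x + y) = l t x + l t y" "l t (r *\<^sub>R x) = r * l t x" using add sc assms by auto
  show "l t 0 = 0" using sc[OF assms(2), of 0] by simp
  show "l t (x - y) = l t x - l t y"
    using add[OF assms(2) subspace_scale[OF D assms(3)], of "-1"] sc[OF assms(3), of "-1"] by simp
qed

lemma weak_flow_derivative: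
  assumes wf: "weak_flow S c l" and t: "t \<in> {-S..S}" and x: "x \<in> D"
  shows "((\<lambda>t. l t x) has_real_derivative - l t (A x)) (at t within {-S..S})"
proof (rule quadratic_remainder_derivative)
  fix s assume "s \<in> {-S..S}"
  then have "\<bar>l s x - l t x + (s - t) * l t (A x)\<bar> \<le> c * ((s - t)\<^sup>2 * norm (A (A x)))"
    using wf t x unfolding weak_flow_def by blast
  then show "\<bar>l s x - l t x - (s - t) * - l t (A x)\<bar> \<le> c * norm (A (A x)) * (s - t)\<^sup>2"
    by (simp add: mult_ac)
qed

text \<open>Product rule for the pairing with a moving vector. The expansion of \<open>X\<close> is used in the norm only, where its remainder is controlled by the boundedness of \<open>l\<close>; the time derivative of \<open>l\<close> costs powers of \<open>A\<close> and is therefore applied to the frozen vectors \<open>X t\<close> and \<open>w\<close>.\<close>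

lemma weak_flow_moving:
  assumes wf: "weak_flow S c l" and T: "open T" "t \<in> T"
    and G: "\<And>s. s \<in> T \<Longrightarrow> G s \<in> {-S..S}" "(G has_real_derivative g) (at t)"
    and X: "\<And>s. s \<in> T \<Longrightarrow> X s \<in> D" and w: "w \<in> D"
    and K: "\<And>s. s \<in> T \<Longrightarrow> norm (X s - X t - (s - t) *\<^sub>R w) \<le> K * (s - t)\<^sup>2"
  shows "((\<lambda>s. l (G s) (X s)) has_real_derivative l (G t) w - g * l (G t) (A (X t))) (at t)"
proof -
  have chain: "((\<lambda>s. l (G s) x) has_real_derivative - l (G t) (A x) * g) (at t within T)" if "x \<in> D" for x
  proof -
    have "((\<lambda>\<tau>. l \<tau> x) has_real_derivative - l (G t) (A x)) (at (G t) within G ` T)"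
      by (rule has_field_derivative_subset[OF weak_flow_derivative[OF wf G(1)[OF T(2)] that]]) (use G(1) in auto)
    then have "((\<lambda>\<tau>. l \<tau> x) \<circ> G has_real_derivative - l (G t) (A x) * g) (at t within T)"
      by (rule DERIV_image_chain) (rule has_field_derivative_at_within[OF G(2)])
    then show ?thesis by (simp add: o_def)
  qed
  have Xt: "X t \<in> D" using X T by blast
  have 1: "((\<lambda>s. l (G s) (X t)) has_real_derivative - l (G t) (A (X t)) * g) (at t within T)" by (rule chain[OF Xt])
  have 2: "((\<lambda>s. (s - t) * l (G s) w) has_real_derivative l (G t) w) (at t within T)"
    using DERIV_mult[OF DERIV_diff[OF DERIV_ident DERIV_const[of t]] chain[OF w]] by simp
  have rest: "X s - X t - (s - t) *\<^sub>R w \<in> D" if "s \<in> T" for s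
    by (intro subspace_diff[OF D] subspace_scale[OF D] X w Xt that)
  have 3: "((\<lambda>s. l (G s) (X s - X t - (s - t) *\<^sub>R w)) has_real_derivative 0) (at t within T)"
  proof (rule quadratic_remainder_derivative)
    fix s assume s: "s \<in> T"
    have "\<bar>l (G s) (X s - X t - (s - t) *\<^sub>R w)\<bar> \<le> c * norm (X s - X t - (s - t) *\<^sub>R w)"
      using wf G(1)[OF s] rest[OF s] unfolding weak_flow_def by blast
    also have "\<dots> \<le> \<bar>c\<bar> * (K * (s - t)\<^sup>2)" using K[OF s] by (intro mult_mono) auto
    finally show "\<bar>l (G s) (X s - X t - (s - t) *\<^sub>R w) - l (G t) (X t - X t - (t - t) *\<^sub>R w) - (s - t) * 0\<bar> \<le> \<bar>c\<bar> * K * (s - t)\<^sup>2"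
      using weak_flow_linear(3)[OF wf w w] by (simp add: mult_ac)
  qed
  have split: "l (G s) (X s) = l (G s) (X t) + (s - t) * l (G s) w + l (G s) (X s - X t - (s - t) *\<^sub>R w)" if "s \<in> T" for s
    using weak_flow_linear(1)[OF wf subspace_add[OF D Xt subspace_scale[OF D w, of "s - t"]] rest[OF that], of "G s"]
      weak_flow_linear(1)[OF wf Xt subspace_scale[OF D w, of "s - t"], of "G s"] weak_flow_linear(2)[OF wf w w]
    by simp
  have "((\<lambda>s. l (G s) (X t) + (s - t) * l (G s) w + l (G s) (X s - X t - (s - t) *\<^sub>R w)) has_real_derivative
     - l (G t) (A (X t)) * g + l (G t) w + 0) (at t within T)"
    by (intro DERIV_add 1 2 3)
  then have "((\<lambda>s. l (G s) (X t) + (s - t) * l (G s) w + l (G s) (X s - X t - (s - t) *\<^sub>R w)) has_real_derivative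
     - l (G t) (A (X t)) * g + l (G t) w + 0) (at t)"
    using at_within_open[OF T(2,1)] by simp
  then have "((\<lambda>s. l (G s) (X s)) has_real_derivative - l (G t) (A (X t)) * g + l (G t) w + 0) (at t)"
    by (rule has_field_derivative_transform_within_open[OF _ T]) (simp add: split)
  then show ?thesis by (simp add: mult.commute)
qed

end

lemma tfun_norm_bound:
  assumes f: "f \<in> supported_in U" and U: "bounded U" "U \<in> sets borel" and M: "\<And>x. \<bar>ap f x\<bar> \<le> M"
  shows "norm f \<le> M * sqrt (measure lborel U)"
proof (rule power2_le_imp_le)
  have M0: "M \<ge> 0" using M[of 0] by linarith
  have "(norm f)\<^sup>2 = (LINT x|lborel. ap f x * ap f x)" by (simp add: power2_norm_eq_inner inner_tfun_def)
  also have "\<dots> \<le> (LINT x|lborel. M\<^sup>2 * indicat_real U x)"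
  proof (rule integral_mono)
    show "integrable lborel (\<lambda>x. ap f x * ap f x)" by (rule ap_mult_integrable[OF smooth_ap])
    show "integrable lborel (\<lambda>x. M\<^sup>2 * indicat_real U x)"
      using U by (intro integrable_mult_right integrable_real_indicator emeasure_bounded_finite) auto
    show "ap f x * ap f x \<le> M\<^sup>2 * indicat_real U x" for x
    proof (cases "x \<in> U")
      case True
      have "ap f x * ap f x = \<bar>ap f x\<bar> * \<bar>ap f x\<bar>" by simp
      also have "\<dots> \<le> M * M" by (intro mult_mono M M0) auto
      finally show ?thesis using True by (simp add: power2_eq_square)
    qed (simp add: supported_in_outside[OF f])
  qed
  also have "\<dots> = (M * sqrt (measure lborel U))\<^sup>2" using U by (simp add: power_mult_distrib)
  finally show "(norm f)\<^sup>2 \<le> (M * sqrt (measure lborel U))\<^sup>2" .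
qed (use M[of 0] in auto)

definition slice :: "(real \<times> 'a::euclidean_space \<Rightarrow> real) \<Rightarrow> real \<Rightarrow> 'a tfun" where
  "slice \<Phi> t = Abs_tfun (\<lambda>y. \<Phi> (t, y))"

lemma bounded_linear_Pair0: "bounded_linear (\<lambda>y. (0, y))"
  by (rule bounded_linear_Pair[OF bounded_linear_zero bounded_linear_ident])

lemma slice_derivative:
  fixes \<Phi> :: "real \<times> 'a::euclidean_space \<Rightarrow> real"
  assumes "smooth_on UNIV \<Phi>"
  shows "dir_deriv v (\<lambda>y. \<Phi> (t, y)) y = dir_deriv (0, v) \<Phi> (t, y)"
proof -
  have "((\<lambda>y. (t, y)) has_derivative (\<lambda>v. (0, v))) (at y)"
    by (intro has_derivative_Pair has_derivative_const has_derivative_ident)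
  from has_derivative_compose[OF this smooth_on_has_derivative[OF assms UNIV_I]]
  show ?thesis by (rule dir_deriv_eq)
qed

lemma smooth_slice:
  fixes \<Phi> :: "real \<times> 'a::euclidean_space \<Rightarrow> 'b::real_normed_vector"
  assumes "smooth_on S \<Phi>" "open S" "open T" "\<And>y. y \<in> T \<Longrightarrow> (t, y) \<in> S"
  shows "smooth_on T (\<lambda>y. \<Phi> (t, y))"
  using smooth_on_affine[OF bounded_linear_Pair0 assms(2,1,3), of "(t, 0)"] assms(4) by simp

lemma not_in_supp_slice: "y \<notin> snd ` supp \<Phi> \<Longrightarrow> \<Phi> (t, y) = 0"
  using not_in_supp[of "(t, y)" \<Phi>] imageI[of "(t, y)" "supp \<Phi>" snd] by auto

lemma is_test_slice:
  fixes \<Phi> :: "real \<times> 'a::euclidean_space \<Rightarrow> real"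
  assumes "is_test \<Phi>" shows "is_test (\<lambda>y. \<Phi> (t, y))"
proof (rule is_testI)
  show "smooth_on UNIV (\<lambda>y. \<Phi> (t, y))"
    by (rule smooth_slice[of UNIV]) (use assms in \<open>auto simp: is_test_def\<close>)
  show "compact (snd ` supp \<Phi>)" using assms by (intro compact_continuous_image continuous_intros) (auto simp: is_test_def)
  show "\<Phi> (t, y) = 0" if "y \<notin> snd ` supp \<Phi>" for y
    using that by (rule not_in_supp_slice)
qed

lemma ap_slice: "is_test \<Phi> \<Longrightarrow> ap (slice \<Phi> t) y = \<Phi> (t, y)"
  unfolding slice_def by (subst ap_Abs[OF is_test_slice]) auto

definition cyl_test :: "real \<Rightarrow> 'a::euclidean_space \<Rightarrow> (real \<times> 'a \<Rightarrow> real) \<Rightarrow> bool" where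
  "cyl_test t0 y0 \<Phi> \<longleftrightarrow> is_test \<Phi> \<and> supp \<Phi> \<subseteq> {t0 - 1<..<t0 + 1} \<times> ball y0 1"

lemma cyl_test_outside:
  assumes "cyl_test t0 y0 \<Phi>" "t \<notin> {t0 - 1<..<t0 + 1} \<or> y \<notin> ball y0 1"
  shows "\<Phi> (t, y) = 0"
  using assms by (intro not_in_supp) (auto simp: cyl_test_def)

lemma slice_supported:
  assumes "cyl_test t0 y0 \<Phi>" shows "slice \<Phi> t \<in> supported_in (ball y0 1)"
proof (rule supported_inI[of "snd ` supp \<Phi>"])
  have "compact (snd ` supp \<Phi>)" using assms by (intro compact_continuous_image continuous_intros) (auto simp: is_test_def cyl_test_def)
  then show "closed (snd ` supp \<Phi>)" by (rule compact_imp_closed)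
  show "snd ` supp \<Phi> \<subseteq> ball y0 1" using assms by (auto simp: cyl_test_def)
  show "ap (slice \<Phi> t) y = 0" if "y \<notin> snd ` supp \<Phi>" for y
    using assms not_in_supp_slice[OF that] by (subst ap_slice) (auto simp: cyl_test_def)
qed

lemma cyl_test_mono:
  assumes "cyl_test t0 y0 \<Phi>" "is_test \<Psi>" "\<And>x. x \<notin> supp \<Phi> \<Longrightarrow> \<Psi> x = 0"
  shows "cyl_test t0 y0 \<Psi>"
  using assms supp_subsetI[of "supp \<Phi>" \<Psi>] by (auto simp: cyl_test_def)

lemma cyl_test_add: "cyl_test t0 y0 \<Phi> \<Longrightarrow> cyl_test t0 y0 \<Psi> \<Longrightarrow> cyl_test t0 y0 (\<lambda>x. \<Phi> x + \<Psi> x)"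
proof -
  assume a: "cyl_test t0 y0 \<Phi>" "cyl_test t0 y0 \<Psi>"
  have "supp (\<lambda>x. \<Phi> x + \<Psi> x) \<subseteq> supp \<Phi> \<union> supp \<Psi>"
    by (rule supp_subsetI) (auto simp: not_in_supp)
  then show ?thesis using a is_test_add[of \<Phi> \<Psi>] unfolding cyl_test_def by blast
qed

lemma cyl_test_mult: "smooth_on UNIV h \<Longrightarrow> cyl_test t0 y0 \<Phi> \<Longrightarrow> cyl_test t0 y0 (\<lambda>x. h x * \<Phi> x)"
  by (rule cyl_test_mono, assumption) (auto simp: cyl_test_def is_test_mult not_in_supp)

lemma cyl_test_dir_deriv: "cyl_test t0 y0 \<Phi> \<Longrightarrow> cyl_test t0 y0 (dir_deriv v \<Phi>)"
  by (rule cyl_test_mono, assumption) (auto simp: cyl_test_def is_test_dir_deriv not_in_supp intro: dir_deriv_outside[of "supp \<Phi>"])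

lemma taylor_two_bound:
  fixes h h' h'' :: "real \<Rightarrow> real"
  assumes "\<And>s. (h has_real_derivative h' s) (at s)" "\<And>s. (h' has_real_derivative h'' s) (at s)"
    and B: "\<And>s. \<bar>h'' s\<bar> \<le> B"
  shows "\<bar>h s - h t - (s - t) * h' t\<bar> \<le> B * (s - t)\<^sup>2"
proof -
  have B0: "B \<ge> 0" using B[of 0] by linarith
  have h': "\<bar>h' r - h' t\<bar> \<le> B * \<bar>r - t\<bar>" for r
    using field_differentiable_bound[of UNIV h' h'' B r t] assms by auto
  have "norm ((h s - s * h' t) - (h t - t * h' t)) \<le> (B * \<bar>s - t\<bar>) * norm (s - t)"
  proof (rule field_differentiable_bound[of "closed_segment s t" "\<lambda>r. h r - r * h' t" "\<lambda>r. h' r - h' t"])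
    fix r assume r: "r \<in> closed_segment s t"
    show "((\<lambda>r. h r - r * h' t) has_real_derivative h' r - h' t) (at r within closed_segment s t)"
      using DERIV_diff[OF has_field_derivative_at_within[OF assms(1)[of r]] DERIV_cmult_right[OF DERIV_ident, of "h' t"]] by simp
    have "\<bar>r - t\<bar> \<le> \<bar>s - t\<bar>" using r by (auto simp: closed_segment_eq_real_ivl split: if_splits)
    then show "norm (h' r - h' t) \<le> B * \<bar>s - t\<bar>" using order.trans[OF h' mult_left_mono[OF _ B0]] by simp
  qed auto
  moreover have "(B * \<bar>s - t\<bar>) * norm (s - t) = B * (s - t)\<^sup>2" by (simp add: mult.assoc power2_eq_square)
  moreover have "(h s - s * h' t) - (h t - t * h' t) = h s - h t - (s - t) * h' t" by (simp add: left_diff_distrib)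
  ultimately show ?thesis by (simp only: real_norm_def)
qed

text \<open>The remainder is uniformly quadratic in the supremum norm, and all slices are supported in one ball of finite measure.\<close>

lemma slice_taylor:
  fixes \<Phi> :: "real \<times> 'a::euclidean_space \<Rightarrow> real"
  assumes \<Phi>: "cyl_test t0 y0 \<Phi>"
  shows "\<exists>K. \<forall>s t. norm (slice \<Phi> s - slice \<Phi> t - (s - t) *\<^sub>R slice (dir_deriv (1, 0) \<Phi>) t) \<le> K * (s - t)\<^sup>2"
proof -
  let ?D = "dir_deriv (1, 0) :: (real \<times> 'a \<Rightarrow> real) \<Rightarrow> _"
  have t: "is_test \<Phi>" "is_test (?D \<Phi>)" "is_test (?D (?D \<Phi>))" using \<Phi> by (auto simp: cyl_test_def is_test_dir_deriv)
  have sm: "smooth_on UNIV \<Phi>" "smooth_on UNIV (?D \<Phi>)" using t by (auto simp: is_test_def)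
  have c: "compact (supp (?D (?D \<Phi>)))" using t by (simp add: is_test_def)
  obtain B where B: "\<forall>x. norm (?D (?D \<Phi>) x) \<le> B"
    using continuous_compact_support_bounded[OF is_test_continuous[OF t(3)] c not_in_supp[of _ "?D (?D \<Phi>)"]] by blast
  have der: "((\<lambda>s. h (s, y)) has_real_derivative ?D h (s, y)) (at s)" if "smooth_on UNIV h" for h y s
    using smooth_line_derivative[OF that, of "(0, y)" "(1, 0)" s] by simp
  let ?U = "ball y0 1"
  have "norm (slice \<Phi> s - slice \<Phi> t - (s - t) *\<^sub>R slice (?D \<Phi>) t) \<le> (B * (s - t)\<^sup>2) * sqrt (measure lborel ?U)" for s t
  proof (rule tfun_norm_bound)
    show "slice \<Phi> s - slice \<Phi> t - (s - t) *\<^sub>R slice (?D \<Phi>) t \<in> supported_in ?U"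
      by (intro subspace_diff subspace_scale subspace_supported_in slice_supported[OF \<Phi>] slice_supported[OF cyl_test_dir_deriv[OF \<Phi>]])
    show "\<bar>ap (slice \<Phi> s - slice \<Phi> t - (s - t) *\<^sub>R slice (?D \<Phi>) t) y\<bar> \<le> B * (s - t)\<^sup>2" for y
      using taylor_two_bound[of "\<lambda>s. \<Phi> (s, y)" "\<lambda>s. ?D \<Phi> (s, y)" "\<lambda>s. ?D (?D \<Phi>) (s, y)" B s t] der sm B
      by (simp add: ap_simps ap_slice t)
  qed auto
  then show ?thesis by (intro exI[of _ "B * sqrt (measure lborel ?U)"]) (simp add: mult_ac)
qed

section \<open>From weak flows to distribution solutions\<close>

text \<open>The function \<open>G\<close> is the time variable of the weak flow, and \<open>m\<close> absorbs the coefficient \<open>a0\<close> and the shift \<open>C0\<close>, so that \<open>m t * l (G t)\<close> solves the parabolic equation whenever \<open>l\<close> is a weak flow. Both are controlled on an interval larger than the time axis of the cylinder, so that derivatives at its end points are two-sided.\<close>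

locale parabolic_flow =
  fixes a0 g :: "real \<Rightarrow> real" and b :: "'m::finite \<Rightarrow> 'm \<Rightarrow> real^'m \<Rightarrow> real" and b0 :: "real^'m \<Rightarrow> real"
    and t0 :: real and y0 :: "real^'m" and C0 S :: real and G m :: "real \<Rightarrow> real"
  assumes a0_smooth: "smooth_on UNIV a0" and g_smooth: "smooth_on UNIV g"
    and b_smooth: "\<And>j k. smooth_on UNIV (b j k)" and b0_smooth: "smooth_on UNIV b0"
    and b_sym: "\<And>j k y. b j k y = b k j y"
    and b_nonneg: "\<And>y \<eta>. (\<Sum>j\<in>UNIV. \<Sum>k\<in>UNIV. b j k y * (\<eta> $ j) * (\<eta> $ k)) \<ge> 0"
    and C0: "\<And>y. y \<in> ball y0 1 \<Longrightarrow> - C0 \<le> b0 y"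
    and G: "\<And>t. \<bar>t - t0\<bar> < 2 \<Longrightarrow> (G has_real_derivative g t) (at t)" "G t0 = 0"
      "\<And>t. \<bar>t - t0\<bar> < 2 \<Longrightarrow> \<bar>G t\<bar> \<le> S"
    and m: "\<And>t. \<bar>t - t0\<bar> < 2 \<Longrightarrow> (m has_real_derivative m t * (C0 * g t - a0 t)) (at t)" "m t0 = 1"

sublocale parabolic_flow \<subseteq> nonneg_symmetric "supported_in (ball y0 1)" "shifted_op b b0 C0"
  by (rule shifted_op_nonneg_symmetric[OF b_smooth b0_smooth b_sym b_nonneg C0])

context parabolic_flow
begin

abbreviation "cyl \<equiv> cyl_test t0 y0"
abbreviation "time \<equiv> {t0 - 1..t0 + 1}"

definition flow_pairing :: "(real \<Rightarrow> (real^'m) tfun \<Rightarrow> real) \<Rightarrow> (real \<times> (real^'m) \<Rightarrow> real) \<Rightarrow> real \<Rightarrow> real" where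
  "flow_pairing l \<Phi> t = m t * l (G t) (slice \<Phi> t)"

definition flow_dist :: "(real \<Rightarrow> (real^'m) tfun \<Rightarrow> real) \<Rightarrow> (real \<times> (real^'m) \<Rightarrow> real) \<Rightarrow> real" where
  "flow_dist l \<Phi> = integral time (flow_pairing l \<Phi>)"

text \<open>The formal transpose of \<open>L2_real\<close> in the space variables: the indices of the two derivatives are exchanged, which the symmetry of the coefficients undoes.\<close>

definition cylinder_op :: "(real \<times> (real^'m) \<Rightarrow> real) \<Rightarrow> real \<times> (real^'m) \<Rightarrow> real" where
  "cylinder_op \<Phi> = (\<lambda>(t, y). - (\<Sum>j\<in>UNIV. \<Sum>k\<in>UNIV. dir_deriv (0, axis k 1) (\<lambda>x. b j k (snd x) * dir_deriv (0, axis j 1) \<Phi> x) (t, y))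
     + b0 y * \<Phi> (t, y))"

lemma flow_pairing_derivative:
  assumes wf: "weak_flow S c l" and \<Phi>: "cyl \<Phi>" and t: "\<bar>t - t0\<bar> < 2"
  shows "(flow_pairing l \<Phi> has_real_derivative
    m t * (l (G t) (slice (dir_deriv (1, 0) \<Phi>) t) - g t * l (G t) (shifted_op b b0 C0 (slice \<Phi> t)) + (C0 * g t - a0 t) * l (G t) (slice \<Phi> t))) (at t)"
proof -
  obtain K where K: "\<forall>s t. norm (slice \<Phi> s - slice \<Phi> t - (s - t) *\<^sub>R slice (dir_deriv (1, 0) \<Phi>) t) \<le> K * (s - t)\<^sup>2"
    using slice_taylor[OF \<Phi>] by (elim exE)
  have "((\<lambda>s. l (G s) (slice \<Phi> s)) has_real_derivative
     l (G t) (slice (dir_deriv (1, 0) \<Phi>) t) - g t * l (G t) (shifted_op b b0 C0 (slice \<Phi> t))) (at t)"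
  proof (rule weak_flow_moving[OF wf, where T = "{t0 - 2<..<t0 + 2}"])
    show "G s \<in> {-S..S}" if "s \<in> {t0 - 2<..<t0 + 2}" for s
    proof -
      have "\<bar>s - t0\<bar> < 2" using that by (auto simp: abs_less_iff)
      then show ?thesis using G(3)[of s] by (auto simp: abs_le_iff)
    qed
    show "slice (dir_deriv (1, 0) \<Phi>) t \<in> supported_in (ball y0 1)"
      by (rule slice_supported[OF cyl_test_dir_deriv[OF \<Phi>]])
    show "norm (slice \<Phi> s - slice \<Phi> t - (s - t) *\<^sub>R slice (dir_deriv (1, 0) \<Phi>) t) \<le> K * (s - t)\<^sup>2" for s
      using K by blast
  qed (use t G(1)[OF t] slice_supported[OF \<Phi>] in \<open>auto simp: abs_less_iff\<close>)
  from DERIV_mult[OF m(1)[OF t] this] show ?thesis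
    unfolding flow_pairing_def[abs_def] by (simp add: algebra_simps)
qed

lemma flow_pairing_continuous:
  assumes "weak_flow S c l" "cyl \<Phi>"
  shows "continuous_on time (flow_pairing l \<Phi>)"
proof (rule continuous_at_imp_continuous_on, rule ballI)
  fix t assume "t \<in> time"
  then have "\<bar>t - t0\<bar> < 2" by (auto simp: abs_less_iff)
  then show "isCont (flow_pairing l \<Phi>) t" using flow_pairing_derivative[OF assms] DERIV_isCont by blast
qed

lemma flow_pairing_integrable:
  assumes "weak_flow S c l" "cyl \<Phi>"
  shows "flow_pairing l \<Phi> integrable_on time"
  by (rule integrable_continuous_real[OF flow_pairing_continuous[OF assms]])

lemma slice_add: "cyl \<Phi> \<Longrightarrow> cyl \<Psi> \<Longrightarrow> slice (\<lambda>x. \<Phi> x + \<Psi> x) t = slice \<Phi> t + slice \<Psi> t"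
  by (rule tfun_eqI) (simp add: ap_simps ap_slice is_test_add cyl_test_def)

lemma slice_cmult: "cyl \<Phi> \<Longrightarrow> slice (\<lambda>x. r * \<Phi> x) t = r *\<^sub>R slice \<Phi> t"
  by (rule tfun_eqI) (simp add: ap_simps ap_slice is_test_mult cyl_test_def)

lemma flow_dist_add:
  assumes wf: "weak_flow S c l" and "cyl \<Phi>" "cyl \<Psi>"
  shows "flow_dist l (\<lambda>x. \<Phi> x + \<Psi> x) = flow_dist l \<Phi> + flow_dist l \<Psi>"
proof -
  have "flow_pairing l (\<lambda>x. \<Phi> x + \<Psi> x) = (\<lambda>t. flow_pairing l \<Phi> t + flow_pairing l \<Psi> t)"
    using weak_flow_linear(1)[OF wf slice_supported[OF assms(2)] slice_supported[OF assms(3)]]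
    by (simp add: fun_eq_iff flow_pairing_def slice_add[OF assms(2,3)] distrib_left)
  then show ?thesis unfolding flow_dist_def
    by (simp add: Henstock_Kurzweil_Integration.integral_add flow_pairing_integrable[OF wf] assms)
qed

lemma flow_dist_cmult:
  assumes wf: "weak_flow S c l" and "cyl \<Phi>"
  shows "flow_dist l (\<lambda>x. r * \<Phi> x) = r * flow_dist l \<Phi>"
proof -
  have "flow_pairing l (\<lambda>x. r * \<Phi> x) = (\<lambda>t. r * flow_pairing l \<Phi> t)"
    using weak_flow_linear(2)[OF wf slice_supported[OF assms(2)] slice_supported[OF assms(2)]]
    by (simp add: fun_eq_iff flow_pairing_def slice_cmult[OF assms(2)])
  then show ?thesis unfolding flow_dist_def by simp
qed

lemma flow_dist_sum:
  assumes wf: "weak_flow S c l" and "finite I" "\<And>i. i \<in> I \<Longrightarrow> cyl (\<Phi> i)"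
  shows "cyl (\<lambda>x. \<Sum>i\<in>I. \<Phi> i x) \<and> flow_dist l (\<lambda>x. \<Sum>i\<in>I. \<Phi> i x) = (\<Sum>i\<in>I. flow_dist l (\<Phi> i))"
  using assms(2,3)
proof (induction I rule: finite_induct)
  case empty
  have c: "cyl (\<lambda>x. 0)" by (auto simp: cyl_test_def is_test_zero supp_def)
  then show ?case using flow_dist_cmult[OF wf c, of 0] by simp
next
  case (insert i I)
  then show ?case using flow_dist_add[OF wf, of "\<Phi> i" "\<lambda>x. \<Sum>i\<in>I. \<Phi> i x"] by (simp add: cyl_test_add)
qed

lemma m_bounded: "\<exists>M\<ge>0. \<forall>t\<in>time. \<bar>m t\<bar> \<le> M"
proof -
  have "continuous_on time m"
  proof (rule continuous_at_imp_continuous_on, rule ballI)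
    fix t assume "t \<in> time"
    then have "\<bar>t - t0\<bar> < 2" by (auto simp: abs_less_iff)
    then show "isCont m t" using m(1) DERIV_isCont by blast
  qed
  then have "compact (m ` time)" by (intro compact_continuous_image) auto
  then obtain M where "\<forall>x\<in>m ` time. norm x \<le> M" using compact_imp_bounded bounded_iff by blast
  then show ?thesis by (intro exI[of _ "max M 0"]) auto
qed

lemma flow_dist_bounded:
  assumes wf: "weak_flow S c l"
  shows "\<exists>K. \<forall>\<Phi> B. cyl \<Phi> \<longrightarrow> (\<forall>x. \<bar>\<Phi> x\<bar> \<le> B) \<longrightarrow> \<bar>flow_dist l \<Phi>\<bar> \<le> K * B"
proof -
  obtain M where M: "M \<ge> 0" "\<And>t. t \<in> time \<Longrightarrow> \<bar>m t\<bar> \<le> M" using m_bounded by blast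
  let ?k = "sqrt (measure lborel (ball y0 1))"
  have "\<bar>flow_dist l \<Phi>\<bar> \<le> (2 * (M * (\<bar>c\<bar> * ?k))) * B" if \<Phi>: "cyl \<Phi>" and B: "\<forall>x. \<bar>\<Phi> x\<bar> \<le> B" for \<Phi> B
  proof -
    have B0: "B \<ge> 0" using B abs_ge_zero order.trans by blast
    have "norm (flow_pairing l \<Phi> t) \<le> M * (\<bar>c\<bar> * (B * ?k))" if t: "t \<in> time" for t
    proof -
      have "\<bar>t - t0\<bar> < 2" using t by (auto simp: abs_less_iff)
      then have "G t \<in> {-S..S}" using G(3)[of t] by (auto simp: abs_le_iff)
      then have "\<bar>l (G t) (slice \<Phi> t)\<bar> \<le> c * norm (slice \<Phi> t)"
        using wf slice_supported[OF \<Phi>] unfolding weak_flow_def by blast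
      also have "\<dots> \<le> \<bar>c\<bar> * norm (slice \<Phi> t)" by (intro mult_right_mono) auto
      also have "norm (slice \<Phi> t) \<le> B * ?k"
        by (rule tfun_norm_bound[OF slice_supported[OF \<Phi>]]) (use B \<Phi> in \<open>auto simp: ap_slice cyl_test_def\<close>)
      finally have "\<bar>l (G t) (slice \<Phi> t)\<bar> \<le> \<bar>c\<bar> * (B * ?k)" by (simp add: mult_left_mono)
      then show ?thesis unfolding flow_pairing_def real_norm_def abs_mult
        by (intro mult_mono M t) (use M in auto)
    qed
    then have "norm (integral time (flow_pairing l \<Phi>)) \<le> (M * (\<bar>c\<bar> * (B * ?k))) * (t0 + 1 - (t0 - 1))"
      by (intro integral_bound flow_pairing_continuous[OF wf \<Phi>]) auto
    then show ?thesis by (simp add: flow_dist_def mult_ac)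
  qed
  then show ?thesis by blast
qed

lemma slice_cylinder_op:
  assumes \<Phi>: "cyl \<Phi>"
  shows "L2_real b b0 (ap (slice \<Phi> t)) y = cylinder_op \<Phi> (t, y)"
proof -
  have t: "is_test \<Phi>" and sm: "smooth_on UNIV \<Phi>" using \<Phi> by (auto simp: cyl_test_def is_test_def)
  have bs: "smooth_on UNIV (\<lambda>x::real \<times> (real^'m). b j k (snd x))" for j k
    using smooth_on_affine[OF bounded_linear_snd open_UNIV b_smooth open_UNIV, of 0] by simp
  have ap: "ap (slice \<Phi> t) = (\<lambda>y. \<Phi> (t, y))" by (rule ext) (rule ap_slice[OF t])
  have d: "dir_deriv v (\<lambda>y. \<Phi> (t, y)) = (\<lambda>y. dir_deriv (0, v) \<Phi> (t, y))" for v
    by (rule ext) (rule slice_derivative[OF sm])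
  have dd: "dir_deriv w (\<lambda>z. b j k z * dir_deriv (0, v) \<Phi> (t, z)) y = dir_deriv (0, w) (\<lambda>x. b j k (snd x) * dir_deriv (0, v) \<Phi> x) (t, y)" for j k v w
    using slice_derivative[of "\<lambda>x. b j k (snd x) * dir_deriv (0, v) \<Phi> x" w t y]
      smooth_on_mult[OF open_UNIV bs smooth_on_dir_deriv[OF sm]] by simp
  have "(\<Sum>j\<in>UNIV. \<Sum>k\<in>UNIV. dir_deriv (0, axis j 1) (\<lambda>x. b j k (snd x) * dir_deriv (0, axis k 1) \<Phi> x) (t, y))
    = (\<Sum>j\<in>UNIV. \<Sum>k\<in>UNIV. dir_deriv (0, axis k 1) (\<lambda>x. b j k (snd x) * dir_deriv (0, axis j 1) \<Phi> x) (t, y))"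
    by (subst sum.swap) (simp only: b_sym)
  then show ?thesis unfolding L2_real_def ap d dd cylinder_op_def by simp
qed

text \<open>The transpose of the parabolic operator; only the time derivative changes sign.\<close>

definition adjoint_op :: "(real \<times> (real^'m) \<Rightarrow> real) \<Rightarrow> real \<times> (real^'m) \<Rightarrow> real" where
  "adjoint_op \<Phi> x = - dir_deriv (1, 0) \<Phi> x + a0 (fst x) * \<Phi> x + g (fst x) * cylinder_op \<Phi> x"

text \<open>Up to sign the integrand is the time derivative of the pairing with \<open>\<Phi>\<close>, and the pairing vanishes at both ends of the time interval.\<close>

lemma flow_dist_adjoint:
  assumes wf: "weak_flow S c l" and \<Phi>: "cyl \<Phi>" and adj: "cyl (adjoint_op \<Phi>)"
  shows "flow_dist l (adjoint_op \<Phi>) = 0"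
proof -
  let ?A = "shifted_op b b0 C0" and ?D = "dir_deriv (1, 0) \<Phi>"
  have t: "is_test \<Phi>" "is_test ?D" "is_test (adjoint_op \<Phi>)" using \<Phi> adj by (auto simp: cyl_test_def is_test_dir_deriv)
  note sup = slice_supported[OF \<Phi>] slice_supported[OF cyl_test_dir_deriv[OF \<Phi>]]
  have As: "?A (slice \<Phi> s) \<in> supported_in (ball y0 1)" for s by (rule A_in[OF sup(1)])
  have eq: "slice (adjoint_op \<Phi>) s = g s *\<^sub>R ?A (slice \<Phi> s) - (slice ?D s + (C0 * g s - a0 s) *\<^sub>R slice \<Phi> s)" for s
  proof (rule tfun_eqI)
    fix y
    show "ap (slice (adjoint_op \<Phi>) s) y = ap (g s *\<^sub>R ?A (slice \<Phi> s) - (slice ?D s + (C0 * g s - a0 s) *\<^sub>R slice \<Phi> s)) y"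
      unfolding ap_simps ap_slice[OF t(3)] ap_slice[OF t(1)] ap_slice[OF t(2)] adjoint_op_def
        ap_shifted_op[OF b_smooth b0_smooth] slice_cylinder_op[OF \<Phi>]
      by (simp add: algebra_simps)
  qed
  have l_eq: "l \<tau> (slice (adjoint_op \<Phi>) s) = g s * l \<tau> (?A (slice \<Phi> s)) - (l \<tau> (slice ?D s) + (C0 * g s - a0 s) * l \<tau> (slice \<Phi> s))" for \<tau> s
    unfolding eq weak_flow_linear(4)[OF wf subspace_scale[OF D As] subspace_add[OF D sup(2) subspace_scale[OF D sup(1)]]]
      weak_flow_linear(1)[OF wf sup(2) subspace_scale[OF D sup(1)]] weak_flow_linear(2)[OF wf As As] weak_flow_linear(2)[OF wf sup(1) sup(1)] ..
  have "(flow_pairing l \<Phi> has_vector_derivative - flow_pairing l (adjoint_op \<Phi>) t) (at t within time)" if "t \<in> time" for t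
  proof -
    have t2: "\<bar>t - t0\<bar> < 2" using that by (auto simp: abs_less_iff)
    have "- flow_pairing l (adjoint_op \<Phi>) t = m t * (l (G t) (slice ?D t) - g t * l (G t) (?A (slice \<Phi> t)) + (C0 * g t - a0 t) * l (G t) (slice \<Phi> t))"
      unfolding flow_pairing_def l_eq by (simp add: algebra_simps)
    then show ?thesis using flow_pairing_derivative[OF wf \<Phi> t2]
      by (simp add: has_real_derivative_iff_has_vector_derivative has_vector_derivative_at_within)
  qed
  then have "((\<lambda>t. - flow_pairing l (adjoint_op \<Phi>) t) has_integral flow_pairing l \<Phi> (t0 + 1) - flow_pairing l \<Phi> (t0 - 1)) time"
    by (intro fundamental_theorem_of_calculus) auto
  moreover have "flow_pairing l \<Phi> s = 0" if "s \<notin> {t0 - 1<..<t0 + 1}" for s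
  proof -
    have "slice \<Phi> s = 0"
      by (rule tfun_eqI) (use cyl_test_outside[OF \<Phi>, of s] that in \<open>auto simp: ap_slice[OF t(1)] ap_simps\<close>)
    then show ?thesis using weak_flow_linear(3)[OF wf sup(1) sup(1)] by (simp add: flow_pairing_def)
  qed
  ultimately have "((\<lambda>t. - flow_pairing l (adjoint_op \<Phi>) t) has_integral 0) time" by simp
  then have "integral time (\<lambda>t. - flow_pairing l (adjoint_op \<Phi>) t) = 0" by (rule integral_unique)
  then show ?thesis by (simp add: flow_dist_def)
qed

definition flow_functional :: "(real \<Rightarrow> (real^'m) tfun \<Rightarrow> real) \<Rightarrow> (real \<times> (real^'m)) functional" where
  "flow_functional l \<Phi> = of_real (flow_dist l (\<lambda>x. Re (\<Phi> x))) + \<i> * of_real (flow_dist l (\<lambda>x. Im (\<Phi> x)))"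

abbreviation "cylinder \<equiv> {t0 - 1<..<t0 + 1} \<times> ball y0 1"

lemma test_functions_cyl:
  assumes "\<Phi> \<in> test_functions cylinder"
  shows "cyl (\<lambda>x. Re (\<Phi> x))" "cyl (\<lambda>x. Im (\<Phi> x))"
proof -
  have sm: "smooth_on UNIV \<Phi>" and c: "compact (supp \<Phi>)" "supp \<Phi> \<subseteq> cylinder" using assms by (auto simp: test_functions_def)
  have "smooth_on UNIV (\<lambda>x. Re (\<Phi> x))" "smooth_on UNIV (\<lambda>x. Im (\<Phi> x))"
    by (intro smooth_on_linear[OF bounded_linear_Re] smooth_on_linear[OF bounded_linear_Im] sm open_UNIV)+
  moreover have z: "Re (\<Phi> x) = 0" "Im (\<Phi> x) = 0" if "x \<notin> supp \<Phi>" for x using not_in_supp[OF that] by auto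
  ultimately have "is_test (\<lambda>x. Re (\<Phi> x))" "is_test (\<lambda>x. Im (\<Phi> x))"
    by (simp_all add: is_testI[OF _ c(1)])
  moreover have "supp (\<lambda>x. Re (\<Phi> x)) \<subseteq> supp \<Phi>" "supp (\<lambda>x. Im (\<Phi> x)) \<subseteq> supp \<Phi>"
    by (rule supp_subsetI[OF closed_supp z(1)], assumption, rule supp_subsetI[OF closed_supp z(2)], assumption)
  ultimately show "cyl (\<lambda>x. Re (\<Phi> x))" "cyl (\<lambda>x. Im (\<Phi> x))" using c by (auto simp: cyl_test_def)
qed

text \<open>Pairings are bounded by the \<open>L\<^sup>2\<close> norms of the slices, hence by the supremum norm: the distribution has order \<open>0\<close>.\<close>

lemma flow_functional_distribution:
  assumes wf: "weak_flow S c l"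
  shows "distribution_on cylinder (flow_functional l)"
  unfolding distribution_on_def
proof (intro conjI ballI allI impI)
  fix \<Phi> \<Psi> assume a: "\<Phi> \<in> test_functions cylinder" "\<Psi> \<in> test_functions cylinder"
  show "flow_functional l (\<lambda>x. \<Phi> x + \<Psi> x) = flow_functional l \<Phi> + flow_functional l \<Psi>"
    unfolding flow_functional_def plus_complex.sel
      flow_dist_add[OF wf test_functions_cyl(1)[OF a(1)] test_functions_cyl(1)[OF a(2)]]
      flow_dist_add[OF wf test_functions_cyl(2)[OF a(1)] test_functions_cyl(2)[OF a(2)]]
    by (simp add: algebra_simps)
next
  fix k \<Phi> assume a: "\<Phi> \<in> test_functions cylinder"
  note c = test_functions_cyl[OF a]
  have mc: "cyl (\<lambda>x. r * Re (\<Phi> x))" "cyl (\<lambda>x. r * Im (\<Phi> x))" for r by (intro cyl_test_mult smooth_on_const c)+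
  have "flow_dist l (\<lambda>x. Re k * Re (\<Phi> x) + (- Im k) * Im (\<Phi> x)) = Re k * flow_dist l (\<lambda>x. Re (\<Phi> x)) + (- Im k) * flow_dist l (\<lambda>x. Im (\<Phi> x))"
    unfolding flow_dist_add[OF wf mc] flow_dist_cmult[OF wf c(1)] flow_dist_cmult[OF wf c(2)] ..
  moreover have "flow_dist l (\<lambda>x. Re k * Im (\<Phi> x) + Im k * Re (\<Phi> x)) = Re k * flow_dist l (\<lambda>x. Im (\<Phi> x)) + Im k * flow_dist l (\<lambda>x. Re (\<Phi> x))"
    unfolding flow_dist_add[OF wf mc(2) mc(1)] flow_dist_cmult[OF wf c(1)] flow_dist_cmult[OF wf c(2)] ..
  ultimately show "flow_functional l (\<lambda>x. k * \<Phi> x) = k * flow_functional l \<Phi>"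
    by (simp add: flow_functional_def complex_eq_iff)
next
  fix K :: "(real \<times> (real^'m)) set" assume K: "compact K \<and> K \<subseteq> cylinder"
  obtain B where B: "\<And>\<Phi> M. cyl \<Phi> \<Longrightarrow> (\<forall>x. \<bar>\<Phi> x\<bar> \<le> M) \<Longrightarrow> \<bar>flow_dist l \<Phi>\<bar> \<le> B * M"
    using flow_dist_bounded[OF wf] by blast
  show "\<exists>C N. \<forall>\<phi>\<in>test_functions K. cmod (flow_functional l \<phi>) \<le> C * (\<Sum>vs | set vs \<subseteq> Basis \<and> length vs \<le> N. SUP x. cmod (fold dir_deriv vs \<phi> x))"
  proof (intro exI[of _ "2 * B"] exI[of _ "0::nat"] ballI)
    fix \<phi> assume \<phi>: "\<phi> \<in> test_functions K"
    then have \<phi>': "\<phi> \<in> test_functions cylinder" using K by (auto simp: test_functions_def)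
    have sm: "continuous_on UNIV \<phi>" "compact (supp \<phi>)" using \<phi> by (auto simp: test_functions_def intro: smooth_on_continuous)
    obtain M where "\<forall>x. cmod (\<phi> x) \<le> M"
      using continuous_compact_support_bounded[OF sm not_in_supp[of _ \<phi>]] by blast
    then have "bdd_above (range (\<lambda>x. cmod (\<phi> x)))" by (intro bdd_aboveI2[of _ _ M]) blast
    then have sup: "cmod (\<phi> x) \<le> (SUP x. cmod (\<phi> x))" for x by (intro cSUP_upper) auto
    have "{vs :: (real \<times> (real^'m)) list. set vs \<subseteq> Basis \<and> length vs \<le> 0} = {[]}" by auto
    then have e: "(\<Sum>vs | set vs \<subseteq> Basis \<and> length vs \<le> 0. SUP x. cmod (fold dir_deriv vs \<phi> x)) = (SUP x. cmod (\<phi> x))" by simp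
    have "cmod (flow_functional l \<phi>) \<le> \<bar>flow_dist l (\<lambda>x. Re (\<phi> x))\<bar> + \<bar>flow_dist l (\<lambda>x. Im (\<phi> x))\<bar>"
      unfolding flow_functional_def by (rule order.trans[OF norm_triangle_ineq]) (simp add: norm_mult)
    also have "\<dots> \<le> B * (SUP x. cmod (\<phi> x)) + B * (SUP x. cmod (\<phi> x))"
      by (intro add_mono B test_functions_cyl[OF \<phi>'] allI order.trans[OF abs_Re_le_cmod sup] order.trans[OF abs_Im_le_cmod sup])
    finally show "cmod (flow_functional l \<phi>) \<le> 2 * B * (\<Sum>vs | set vs \<subseteq> Basis \<and> length vs \<le> 0. SUP x. cmod (fold dir_deriv vs \<phi> x))"
      unfolding e by simp
  qed
qed

lemma smooth_time: "smooth_on UNIV h \<Longrightarrow> smooth_on UNIV (\<lambda>x::real \<times> (real^'m). h (fst x) :: real)"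
  using smooth_on_affine[OF bounded_linear_fst open_UNIV _ open_UNIV, of h 0] by simp

lemma smooth_space: "smooth_on UNIV h \<Longrightarrow> smooth_on UNIV (\<lambda>x::real \<times> (real^'m). h (snd x) :: real)"
  using smooth_on_affine[OF bounded_linear_snd open_UNIV _ open_UNIV, of h 0] by simp

text \<open>The value of the parabolic operator on the distribution, expanded term by term as the definitions of the distributional operations produce it.\<close>

definition transposed_value :: "(real \<Rightarrow> (real^'m) tfun \<Rightarrow> real) \<Rightarrow> (real \<times> (real^'m) \<Rightarrow> real) \<Rightarrow> real" where
  "transposed_value l \<Phi> = - flow_dist l (dir_deriv (1, 0) \<Phi>) + flow_dist l (\<lambda>x. a0 (fst x) * \<Phi> x)
    + (- (\<Sum>j\<in>UNIV. \<Sum>k\<in>UNIV. flow_dist l (dir_deriv (0, axis k 1) (\<lambda>x. b j k (snd x) * dir_deriv (0, axis j 1) (\<lambda>x. g (fst x) * \<Phi> x) x)))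
       + flow_dist l (\<lambda>x. b0 (snd x) * (g (fst x) * \<Phi> x)))"

lemma time_factor_derivative:
  assumes "smooth_on UNIV \<Phi>"
  shows "dir_deriv (0, v) (\<lambda>x::real \<times> (real^'m). g (fst x) * \<Phi> x) x = g (fst x) * dir_deriv (0, v) \<Phi> x"
proof -
  have "((\<lambda>x::real \<times> (real^'m). g (fst x)) has_derivative (\<lambda>v. dir_deriv (fst v) g (fst x))) (at x)"
    by (rule has_derivative_compose[OF has_derivative_fst[OF has_derivative_ident] smooth_on_has_derivative[OF g_smooth UNIV_I]])
  then have "dir_deriv (0, v) (\<lambda>x::real \<times> (real^'m). g (fst x)) x = dir_deriv 0 g (fst x)" by (rule dir_deriv_eq[THEN trans]) simp
  also have "\<dots> = 0"
    using linear_0[OF has_derivative_linear[OF smooth_on_has_derivative[OF g_smooth, of "fst x"]]] by simp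
  finally show ?thesis using dir_deriv_mult[OF smooth_time[OF g_smooth] assms, of "(0, v)" x] by simp
qed

lemma transposed_value_zero:
  assumes wf: "weak_flow S c l" and \<Phi>: "cyl \<Phi>"
  shows "transposed_value l \<Phi> = 0"
proof -
  have sm: "smooth_on UNIV \<Phi>" using \<Phi> by (auto simp: cyl_test_def is_test_def)
  let ?F = "\<lambda>j k. dir_deriv (0, axis k 1) (\<lambda>x. b j k (snd x) * dir_deriv (0, axis j 1) (\<lambda>x. g (fst x) * \<Phi> x) x)"
  have cF: "cyl (?F j k)" for j k
    by (intro cyl_test_dir_deriv cyl_test_mult smooth_space smooth_time b_smooth g_smooth \<Phi>)
  have F_eq: "?F j k x = g (fst x) * dir_deriv (0, axis k 1) (\<lambda>x. b j k (snd x) * dir_deriv (0, axis j 1) \<Phi> x) x" for j k x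
  proof -
    have "(\<lambda>x. b j k (snd x) * dir_deriv (0, axis j 1) (\<lambda>x. g (fst x) * \<Phi> x) x) = (\<lambda>x. g (fst x) * (b j k (snd x) * dir_deriv (0, axis j 1) \<Phi> x))"
      by (rule ext) (simp add: time_factor_derivative[OF sm] mult.left_commute)
    then show ?thesis
      using time_factor_derivative[OF smooth_on_mult[OF open_UNIV smooth_space[OF b_smooth[of j k]] smooth_on_dir_deriv[OF sm]]] by simp
  qed
  have inner: "cyl (\<lambda>x. \<Sum>k\<in>UNIV. ?F j k x) \<and> flow_dist l (\<lambda>x. \<Sum>k\<in>UNIV. ?F j k x) = (\<Sum>k\<in>UNIV. flow_dist l (?F j k))" for j
    by (rule flow_dist_sum[OF wf]) (auto intro: cF)
  have outer: "cyl (\<lambda>x. \<Sum>j\<in>UNIV. \<Sum>k\<in>UNIV. ?F j k x) \<and> flow_dist l (\<lambda>x. \<Sum>j\<in>UNIV. \<Sum>k\<in>UNIV. ?F j k x) = (\<Sum>j\<in>UNIV. flow_dist l (\<lambda>x. \<Sum>k\<in>UNIV. ?F j k x))"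
    by (rule flow_dist_sum[OF wf]) (use inner in auto)
  let ?S = "\<lambda>x. \<Sum>j\<in>UNIV. \<Sum>k\<in>UNIV. ?F j k x"
  have cS: "cyl ?S" using outer by blast
  have fS: "flow_dist l ?S = (\<Sum>j\<in>UNIV. \<Sum>k\<in>UNIV. flow_dist l (?F j k))" using outer inner by simp
  let ?D = "dir_deriv (1, 0) \<Phi>" and ?a = "\<lambda>x. a0 (fst x) * \<Phi> x" and ?b = "\<lambda>x. b0 (snd x) * (g (fst x) * \<Phi> x)"
  have cD: "cyl ?D" by (rule cyl_test_dir_deriv[OF \<Phi>])
  have ca: "cyl ?a" by (intro cyl_test_mult smooth_time a0_smooth \<Phi>)
  have cb: "cyl ?b" by (intro cyl_test_mult smooth_space smooth_time b0_smooth g_smooth \<Phi>)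
  have cD': "cyl (\<lambda>x. (-1) * ?D x)" and cS': "cyl (\<lambda>x. (-1) * ?S x)" by (intro cyl_test_mult smooth_on_const cD cS)+
  let ?T = "\<lambda>x. ((-1) * ?D x + ?a x) + ((-1) * ?S x + ?b x)"
  have cT: "cyl ?T" by (intro cyl_test_add cD' ca cS' cb)
  have "transposed_value l \<Phi> = flow_dist l ?T"
    unfolding flow_dist_add[OF wf cyl_test_add[OF cD' ca] cyl_test_add[OF cS' cb]] flow_dist_add[OF wf cD' ca] flow_dist_add[OF wf cS' cb]
      flow_dist_cmult[OF wf cD] flow_dist_cmult[OF wf cS] fS transposed_value_def by simp
  also have "?T = adjoint_op \<Phi>"
    by (rule ext) (simp only: F_eq adjoint_op_def cylinder_op_def split_beta prod.collapse sum_distrib_left[symmetric], simp add: algebra_simps)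
  finally have 1: "transposed_value l \<Phi> = flow_dist l (adjoint_op \<Phi>)" .
  have "?T = adjoint_op \<Phi>"
    by (rule ext) (simp only: F_eq adjoint_op_def cylinder_op_def split_beta prod.collapse sum_distrib_left[symmetric], simp add: algebra_simps)
  then have "cyl (adjoint_op \<Phi>)" using cT by simp
  then show ?thesis using 1 flow_dist_adjoint[OF wf \<Phi>] by simp
qed

lemma flow_functional_solves:
  assumes wf: "weak_flow S c l"
  shows "dist_eq_on cylinder (L_dist a0 g b b0 (flow_functional l)) (dist_of_fun (\<lambda>_. 0))"
  unfolding dist_eq_on_def
proof
  fix \<Phi> assume \<Phi>: "\<Phi> \<in> test_functions cylinder"
  have sm: "smooth_on UNIV \<Phi>" using \<Phi> by (simp add: test_functions_def)
  have Rd: "Re (dir_deriv v h x) = dir_deriv v (\<lambda>x. Re (h x)) x" "Im (dir_deriv v h x) = dir_deriv v (\<lambda>x. Im (h x)) x"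
    if "smooth_on UNIV h" for v x and h :: "real \<times> (real^'m) \<Rightarrow> complex"
    using dir_deriv_linear[OF bounded_linear_Re that, of v x] dir_deriv_linear[OF bounded_linear_Im that, of v x] by auto
  have ofr: "smooth_on UNIV (\<lambda>x. complex_of_real (h x))" if "smooth_on UNIV h" for h :: "real \<times> (real^'m) \<Rightarrow> real"
    by (rule smooth_on_linear[OF bounded_linear_of_real open_UNIV that])
  have g\<Phi>: "smooth_on UNIV (\<lambda>x. complex_of_real (g (fst x)) * \<Phi> x)"
    by (intro smooth_on_mult ofr smooth_time g_smooth sm open_UNIV)
  have b\<Phi>: "smooth_on UNIV (\<lambda>x. complex_of_real (b j k (snd x)) * dir_deriv v (\<lambda>x. complex_of_real (g (fst x)) * \<Phi> x) x)" for j k v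
    by (intro smooth_on_mult ofr smooth_space b_smooth smooth_on_dir_deriv g\<Phi> open_UNIV)
  have "L_dist a0 g b b0 (flow_functional l) \<Phi>
     = of_real (transposed_value l (\<lambda>x. Re (\<Phi> x))) + \<i> * of_real (transposed_value l (\<lambda>x. Im (\<Phi> x)))"
    unfolding L_dist_def L2_dist_def dist_deriv_def dist_mult_def flow_functional_def transposed_value_def split_beta
    by (simp add: Rd sm g\<Phi> b\<Phi> complex_eq_iff)
  then show "L_dist a0 g b b0 (flow_functional l) \<Phi> = dist_of_fun (\<lambda>_. 0) \<Phi>"
    by (simp add: transposed_value_zero[OF wf] test_functions_cyl[OF \<Phi>] dist_of_fun_def)
qed

end

section \<open>Hypoellipticity makes weak flows regular\<close>

text \<open>The fundamental lemma of the calculus of variations at a single point: near a point where \<open>F\<close> is nonzero it has constant sign.\<close>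

lemma zero_if_tests_vanish:
  fixes F :: "real \<Rightarrow> real"
  assumes r: "r > 0" and F: "continuous_on {t0 - r..t0 + r} F"
    and tests: "\<And>\<eta> \<alpha>. \<lbrakk>0 < \<eta>; \<eta> \<le> r; smooth_on UNIV \<alpha>; \<And>t. 0 \<le> \<alpha> t; \<And>t. t \<notin> ball t0 \<eta> \<Longrightarrow> \<alpha> t = 0\<rbrakk>
      \<Longrightarrow> integral {t0 - \<eta>..t0 + \<eta>} (\<lambda>t. \<alpha> t * F t) = 0"
  shows "F t0 = 0"
proof (rule ccontr)
  assume nz: "F t0 \<noteq> 0"
  define \<sigma> where "\<sigma> = sgn (F t0)"
  have \<sigma>F: "\<sigma> * F t0 = \<bar>F t0\<bar>" by (simp add: \<sigma>_def abs_sgn mult.commute)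
  have t0: "t0 \<in> {t0 - r..t0 + r}" using r by auto
  obtain d where d: "d > 0" "\<And>t. t \<in> {t0 - r..t0 + r} \<Longrightarrow> dist t t0 < d \<Longrightarrow> dist (F t) (F t0) < \<bar>F t0\<bar>"
    using F[unfolded continuous_on_iff, rule_format, OF t0, of "\<bar>F t0\<bar>"] nz by auto
  define \<eta> where "\<eta> = min r (d / 2)"
  have \<eta>: "0 < \<eta>" "\<eta> \<le> r" "\<eta> < d" using r d(1) by (auto simp: \<eta>_def)
  have sub: "{t0 - \<eta>..t0 + \<eta>} \<subseteq> {t0 - r..t0 + r}" using \<eta> by auto
  have pos: "\<sigma> * F t \<ge> 0" if "t \<in> {t0 - \<eta>..t0 + \<eta>}" for t
  proof -
    have "dist t t0 < d" using that \<eta> by (auto simp: dist_real_def abs_less_iff)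
    then have "\<bar>F t - F t0\<bar> < \<bar>F t0\<bar>" using d(2) that sub by (auto simp: dist_real_def)
    then show ?thesis unfolding \<sigma>_def by (auto simp: sgn_if split: if_splits)
  qed
  obtain \<alpha> :: "real \<Rightarrow> real" where \<alpha>: "smooth_on UNIV \<alpha>" "\<And>x. 0 \<le> \<alpha> x" "\<And>x. \<alpha> x \<le> 1"
    "\<And>x. x \<in> cball t0 (\<eta> / 2) \<Longrightarrow> \<alpha> x = 1" "\<And>x. x \<notin> ball t0 \<eta> \<Longrightarrow> \<alpha> x = 0"
    using cutoff_exists[of "\<eta> / 2" \<eta> t0] \<eta> by auto
  let ?f = "\<lambda>t. \<sigma> * (\<alpha> t * F t)"
  have cont: "continuous_on {t0 - \<eta>..t0 + \<eta>} ?f"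
    by (intro continuous_intros continuous_on_subset[OF F sub] continuous_on_subset[OF smooth_on_continuous[OF \<alpha>(1)]]) auto
  have "integral {t0 - \<eta>..t0 + \<eta>} ?f = 0"
    using tests[OF \<eta>(1,2) \<alpha>(1,2,5)] by simp
  moreover have "?f t \<ge> 0" if "t \<in> {t0 - \<eta>..t0 + \<eta>}" for t
    using mult_nonneg_nonneg[OF \<alpha>(2)[of t] pos[OF that]] by (simp add: mult.left_commute)
  ultimately have "\<forall>t\<in>{t0 - \<eta>..t0 + \<eta>}. ?f t = 0"
    using integral_eq_0_iff[OF cont] \<eta> by simp
  then have "?f t0 = 0" using \<eta> by auto
  then show False using \<sigma>F \<alpha>(4)[of t0] \<eta> nz by simp
qed

lemma parametric_integral_continuous:
  fixes H :: "real \<times> 'a::euclidean_space \<Rightarrow> real"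
  assumes H: "continuous_on (T \<times> UNIV) H" and J: "compact J" "J \<subseteq> T" and K: "compact K"
    and zero: "\<And>t y. \<lbrakk>t \<in> T; y \<notin> K\<rbrakk> \<Longrightarrow> H (t, y) = 0"
  shows "continuous_on J (\<lambda>t. LINT y|lborel. H (t, y))"
  unfolding continuous_on_sequentially
proof (intro allI ballI impI)
  fix x a assume a: "a \<in> J" and x: "(\<forall>n. x n \<in> J) \<and> x \<longlonglongrightarrow> a"
  have "compact (H ` (J \<times> K))"
    using J K by (intro compact_continuous_image continuous_on_subset[OF H] compact_Times) auto
  then obtain B where "\<forall>z\<in>H ` (J \<times> K). norm z \<le> B" using compact_imp_bounded bounded_iff by blast
  then have B: "norm (H (t, y)) \<le> B" if "t \<in> J" "y \<in> K" for t y using that by blast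
  have slice_cont: "continuous_on UNIV (\<lambda>y. H (t, y))" if "t \<in> J" for t
    by (rule continuous_on_compose2[OF H]) (use that J in \<open>auto intro!: continuous_intros\<close>)
  have "(\<lambda>n. LINT y|lborel. H (x n, y)) \<longlonglongrightarrow> (LINT y|lborel. H (a, y))"
  proof (rule integral_dominated_convergence[where w = "\<lambda>y. B * indicat_real K y"])
    show "integrable lborel (\<lambda>y. B * indicat_real K y)"
      using K by (intro integrable_mult_right integrable_real_indicator emeasure_bounded_finite compact_imp_bounded) (auto intro: borel_compact)
    show "(\<lambda>y. H (a, y)) \<in> borel_measurable lborel" using slice_cont[OF a] by (simp add: borel_measurable_continuous_onI)
    show "(\<lambda>y. H (x n, y)) \<in> borel_measurable lborel" for n using slice_cont[of "x n"] x by (simp add: borel_measurable_continuous_onI)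
    show "AE y in lborel. (\<lambda>n. H (x n, y)) \<longlonglongrightarrow> H (a, y)"
    proof (rule AE_I2)
      fix y
      have "continuous_on J (\<lambda>t. H (t, y))"
        by (rule continuous_on_compose2[OF H]) (use J in \<open>auto intro!: continuous_intros\<close>)
      then show "(\<lambda>n. H (x n, y)) \<longlonglongrightarrow> H (a, y)"
        using a x unfolding continuous_on_sequentially o_def by blast
    qed
    show "AE y in lborel. norm (H (x n, y)) \<le> B * indicat_real K y" for n
    proof (rule AE_I2)
      fix y
      have xn: "x n \<in> J" using x by blast
      show "norm (H (x n, y)) \<le> B * indicat_real K y"
        using B[OF xn, of y] zero[of "x n" y] xn J by (cases "y \<in> K") auto
    qed
  qed
  then show "((\<lambda>t. LINT y|lborel. H (t, y)) \<circ> x) \<longlonglongrightarrow> (LINT y|lborel. H (a, y))" by (simp add: o_def)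
qed

lemma integral_product_space:
  fixes P :: "real \<times> 'a::euclidean_space \<Rightarrow> real"
  assumes "integrable lborel P"
  shows "(LINT x|lborel. P x) = (LINT t|lborel. (LINT y|lborel. P (t, y)))"
proof -
  have "integrable (lborel \<Otimes>\<^sub>M lborel) P" using assms by (simp add: lborel_prod)
  then have "(LINT t|lborel. (LINT y|lborel. P (t, y))) = integral\<^sup>L (lborel \<Otimes>\<^sub>M lborel) P"
    by (rule lborel_pair.integral_fst')
  then show ?thesis by (simp add: lborel_prod)
qed

lemma compactly_supported_line_integral:
  fixes f :: "real \<Rightarrow> real"
  assumes f: "continuous_on {a..b} f" and z: "\<And>t. t \<notin> {a..b} \<Longrightarrow> f t = 0"
  shows "(LINT t|lborel. f t) = integral {a..b} f"
proof -
  have "(LINT t:{a..b}|lborel. f t) = integral {a..b} f"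
    by (rule set_borel_integral_eq_integral(2)[OF borel_integrable_atLeastAtMost'[OF f]])
  moreover have "(\<lambda>t. indicator {a..b} t *\<^sub>R f t) = f"
  proof
    show "indicator {a..b} t *\<^sub>R f t = f t" for t using z[of t] by (cases "t \<in> {a..b}") auto
  qed
  ultimately show ?thesis by (simp add: set_lebesgue_integral_def)
qed

context parabolic_flow
begin

lemma flow_pairing_fixed_derivative:
  assumes wf: "weak_flow S c l" and \<psi>: "\<psi> \<in> supported_in (ball y0 1)" and t: "\<bar>t - t0\<bar> < 2"
  shows "isCont (\<lambda>t. m t * l (G t) \<psi>) t"
proof -
  have "((\<lambda>s. l (G s) \<psi>) has_real_derivative l (G t) 0 - g t * l (G t) (shifted_op b b0 C0 \<psi>)) (at t)"
  proof (rule weak_flow_moving[OF wf, where T = "{t0 - 2<..<t0 + 2}" and X = "\<lambda>_. \<psi>" and w = 0 and K = 0])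
    show "G s \<in> {-S..S}" if "s \<in> {t0 - 2<..<t0 + 2}" for s
    proof -
      have "\<bar>s - t0\<bar> < 2" using that by (auto simp: abs_less_iff)
      then show ?thesis using G(3)[of s] by (auto simp: abs_le_iff)
    qed
  qed (use t G(1)[OF t] \<psi> D in \<open>auto simp: abs_less_iff subspace_0\<close>)
  then show ?thesis using DERIV_mult[OF m(1)[OF t]] DERIV_isCont by blast
qed

text \<open>Hypoellipticity is applied with right-hand side \<open>0\<close> only, so the neighbourhood does not depend on the flow. The distribution of the flow is then a smooth function \<open>w\<close> there; testing with products of a function of time and \<open>\<psi>\<close> compares the two continuous functions \<open>m t * l (G t) \<psi>\<close> and \<open>\<integral> Re w (t, y) * \<psi> y\<close> of time, which therefore agree at \<open>t\<^sub>0\<close>.\<close>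

theorem hypoelliptic_flow_regular:
  assumes hypo: "locally_hypoelliptic_near (L_dist a0 g b b0) (t0, y0)"
  shows "\<exists>\<rho>>0. \<rho> < 1 \<and> (\<forall>c l. weak_flow S c l \<longrightarrow>
    (\<exists>W. smooth_on (ball y0 \<rho>) W \<and> (\<forall>\<psi>\<in>supported_in (ball y0 \<rho>). l 0 \<psi> = (LINT y|lborel. W y * ap \<psi> y))))"
proof -
  have "open cylinder" "(t0, y0) \<in> cylinder" by (auto intro: open_Times)
  moreover have "smooth_on cylinder (\<lambda>_. 0 :: complex)" by simp
  ultimately obtain \<Omega>' where \<Omega>': "open \<Omega>'" "(t0, y0) \<in> \<Omega>'" "closure \<Omega>' \<subseteq> cylinder"
    and smooth: "\<And>u. distribution_on cylinder u \<and> dist_eq_on cylinder (L_dist a0 g b b0 u) (dist_of_fun (\<lambda>_. 0)) \<Longrightarrow> dist_smooth_on \<Omega>' u"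
    using hypo unfolding locally_hypoelliptic_near_def by blast
  have \<Omega>'_cyl: "\<Omega>' \<subseteq> cylinder" using \<Omega>'(3) closure_subset by blast
  obtain U V where UV: "open U" "open V" "(t0, y0) \<in> U \<times> V" "U \<times> V \<subseteq> \<Omega>'" by (rule open_prod_elim[OF \<Omega>'(1,2)])
  obtain e1 where e1: "e1 > 0" "cball t0 e1 \<subseteq> U" using UV open_contains_cball by (metis mem_Sigma_iff)
  obtain e2 where e2: "e2 > 0" "cball y0 e2 \<subseteq> V" using UV open_contains_cball by (metis mem_Sigma_iff)
  define \<rho> where "\<rho> = min (min e1 e2) (1 / 2)"
  have \<rho>: "\<rho> > 0" "\<rho> < 1" "\<rho> \<le> e1" "\<rho> \<le> e2" using e1 e2 by (auto simp: \<rho>_def)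
  have box: "(t, y) \<in> \<Omega>'" if "\<bar>t - t0\<bar> \<le> \<rho>" "y \<in> cball y0 \<rho>" for t y
  proof -
    have "t \<in> cball t0 e1" using that \<rho> by (auto simp: dist_real_def abs_minus_commute)
    moreover have "y \<in> cball y0 e2" using that \<rho> by auto
    ultimately show ?thesis using e1 e2 UV by blast
  qed
  have "\<exists>W. smooth_on (ball y0 \<rho>) W \<and> (\<forall>\<psi>\<in>supported_in (ball y0 \<rho>). l 0 \<psi> = (LINT y|lborel. W y * ap \<psi> y))"
    if wf: "weak_flow S c l" for c l
  proof -
    obtain w where w: "smooth_on \<Omega>' w" "\<And>\<Phi>. \<Phi> \<in> test_functions \<Omega>' \<Longrightarrow> flow_functional l \<Phi> = dist_of_fun w \<Phi>"
      using smooth[OF conjI[OF flow_functional_distribution[OF wf] flow_functional_solves[OF wf]]]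
      unfolding dist_smooth_on_def dist_eq_on_def by blast
    have wR: "smooth_on \<Omega>' (\<lambda>x. Re (w x))" by (rule smooth_on_linear[OF bounded_linear_Re \<Omega>'(1) w(1)])
    have "smooth_on (ball y0 \<rho>) (\<lambda>y. Re (w (t0, y)))"
      by (rule smooth_slice[OF wR \<Omega>'(1) open_ball]) (use box \<rho> in auto)
    moreover have "l 0 \<psi> = (LINT y|lborel. Re (w (t0, y)) * ap \<psi> y)" if \<psi>: "\<psi> \<in> supported_in (ball y0 \<rho>)" for \<psi>
    proof -
      let ?K = "supp (ap \<psi>)"
      have K: "compact ?K" using is_test_ap[of \<psi>] by (simp add: is_test_def)
      have K\<rho>: "?K \<subseteq> ball y0 \<rho>" using \<psi> by (simp add: supported_in_def)
      have \<psi>1: "\<psi> \<in> supported_in (ball y0 1)" using \<psi> \<rho> by (auto simp: supported_in_def)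
      define H where "H = (\<lambda>x. Re (w x) * ap \<psi> (snd x))"
      define q where "q = (\<lambda>t. LINT y|lborel. H (t, y))"
      let ?T = "{t0 - \<rho><..<t0 + \<rho>}"
      have c\<psi>: "continuous_on X (\<lambda>x. ap \<psi> (snd x))" for X :: "(real \<times> (real^'m)) set"
        by (rule continuous_on_compose2[OF smooth_on_continuous[OF smooth_ap]]) (auto intro!: continuous_intros)
      have "continuous_on (?T \<times> ball y0 \<rho> \<union> ?T \<times> - ?K) H"
      proof (rule continuous_on_open_Un)
        show "open (?T \<times> ball y0 \<rho>)" "open (?T \<times> - ?K)" by (auto intro!: open_Times)
        have "?T \<times> ball y0 \<rho> \<subseteq> \<Omega>'" using box by (auto simp: abs_le_iff)
        then show "continuous_on (?T \<times> ball y0 \<rho>) H"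
          unfolding H_def by (intro continuous_on_mult c\<psi> continuous_on_subset[OF smooth_on_continuous[OF wR]])
        have "H x = 0" if "x \<in> ?T \<times> - ?K" for x using that not_in_supp[of "snd x" "ap \<psi>"] by (auto simp: H_def)
        then show "continuous_on (?T \<times> - ?K) H" using continuous_on_cong[of "?T \<times> - ?K" "?T \<times> - ?K" H "\<lambda>_. 0"] by simp
      qed
      moreover have "?T \<times> ball y0 \<rho> \<union> ?T \<times> - ?K = ?T \<times> UNIV" using K\<rho> by blast
      ultimately have Hc: "continuous_on (?T \<times> UNIV) H" by simp
      have q_cont: "continuous_on {t0 - \<rho> / 2..t0 + \<rho> / 2} q"
        unfolding q_def by (rule parametric_integral_continuous[OF Hc _ _ K]) (use \<rho> in \<open>auto simp: H_def not_in_supp\<close>)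
      have p_cont: "continuous_on {t0 - \<rho> / 2..t0 + \<rho> / 2} (\<lambda>t. m t * l (G t) \<psi>)"
        by (rule continuous_at_imp_continuous_on, rule ballI, rule flow_pairing_fixed_derivative[OF wf \<psi>1])
          (use \<rho> in \<open>auto simp: abs_less_iff\<close>)
      have "m t0 * l (G t0) \<psi> - q t0 = 0"
      proof (rule zero_if_tests_vanish[where r = "\<rho> / 2" and F = "\<lambda>t. m t * l (G t) \<psi> - q t"])
        show "\<rho> / 2 > 0" using \<rho> by simp
        show "continuous_on {t0 - \<rho> / 2..t0 + \<rho> / 2} (\<lambda>t. m t * l (G t) \<psi> - q t)"
          by (intro continuous_on_diff p_cont q_cont)
        fix \<eta> :: real and \<alpha> :: "real \<Rightarrow> real"
        assume \<eta>: "0 < \<eta>" "\<eta> \<le> \<rho> / 2" and \<alpha>: "smooth_on UNIV \<alpha>" "\<And>t. t \<notin> ball t0 \<eta> \<Longrightarrow> \<alpha> t = 0"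
        let ?J = "{t0 - \<eta>..t0 + \<eta>}"
        have J_sub: "?J \<subseteq> {t0 - \<rho> / 2..t0 + \<rho> / 2}" "?J \<subseteq> time" using \<eta> \<rho> by auto
        have \<alpha>J: "\<alpha> t = 0" if "t \<notin> ?J" for t using that by (intro \<alpha>(2)) (auto simp: dist_real_def)
        have \<alpha>c: "continuous_on X \<alpha>" for X using smooth_on_continuous[OF \<alpha>(1)] continuous_on_subset by blast
        define \<Phi> where "\<Phi> = (\<lambda>x. \<alpha> (fst x) * ap \<psi> (snd x))"
        have \<Phi>0: "\<Phi> x = 0" if "x \<notin> ?J \<times> ?K" for x
        proof -
          have "fst x \<notin> ?J \<or> snd x \<notin> ?K" using that by (metis mem_Times_iff)
          then show ?thesis using \<alpha>J[of "fst x"] not_in_supp[of "snd x" "ap \<psi>"] by (auto simp: \<Phi>_def)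
        qed
        have JK: "compact (?J \<times> ?K)" using K by (intro compact_Times) auto
        have JK\<Omega>: "?J \<times> ?K \<subseteq> \<Omega>'"
        proof
          fix x assume x: "x \<in> ?J \<times> ?K"
          then have "\<bar>fst x - t0\<bar> \<le> \<rho>" using \<eta> \<rho> by (auto simp: abs_le_iff)
          moreover have "snd x \<in> cball y0 \<rho>" using x K\<rho> by (auto simp: less_imp_le)
          ultimately have "(fst x, snd x) \<in> \<Omega>'" by (rule box)
          then show "x \<in> \<Omega>'" by simp
        qed
        have sm\<Phi>: "smooth_on UNIV \<Phi>" unfolding \<Phi>_def
          by (intro smooth_on_mult open_UNIV smooth_time \<alpha>(1) smooth_space smooth_ap)
        have t\<Phi>: "is_test \<Phi>" by (rule is_testI[OF sm\<Phi> JK \<Phi>0])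
        have s\<Phi>: "supp \<Phi> \<subseteq> ?J \<times> ?K" by (rule supp_subsetI[OF compact_imp_closed[OF JK] \<Phi>0])
        have cyl\<Phi>: "cyl \<Phi>" using t\<Phi> s\<Phi> JK\<Omega> \<Omega>'_cyl by (auto simp: cyl_test_def)
        let ?\<Phi>c = "\<lambda>x. complex_of_real (\<Phi> x)"
        have "supp ?\<Phi>c \<subseteq> ?J \<times> ?K" by (rule supp_subsetI[OF compact_imp_closed[OF JK]]) (simp add: \<Phi>0)
        moreover have "compact (supp ?\<Phi>c)" by (rule compact_suppI[OF JK]) (simp add: \<Phi>0)
        moreover have "smooth_on UNIV ?\<Phi>c" by (rule smooth_on_linear[OF bounded_linear_of_real open_UNIV sm\<Phi>])
        ultimately have test: "?\<Phi>c \<in> test_functions \<Omega>'" using JK\<Omega> by (auto simp: test_functions_def)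
        have fl0: "flow_dist l (\<lambda>x. 0) = 0" using flow_dist_cmult[OF wf cyl\<Phi>, of 0] by simp
        have "flow_functional l ?\<Phi>c = of_real (flow_dist l \<Phi>)" by (simp add: flow_functional_def fl0)
        then have eq1: "of_real (flow_dist l \<Phi>) = (LINT x|lborel. w x * ?\<Phi>c x)"
          using w(2)[OF test] by (simp add: dist_of_fun_def)
        have cont: "continuous_on UNIV (\<lambda>x. w x * ?\<Phi>c x)"
        proof -
          have "continuous_on (\<Omega>' \<union> - (?J \<times> ?K)) (\<lambda>x. w x * ?\<Phi>c x)"
          proof (rule continuous_on_open_Un[OF \<Omega>'(1)])
            show "open (- (?J \<times> ?K))" using compact_imp_closed[OF JK] by auto
            show "continuous_on \<Omega>' (\<lambda>x. w x * ?\<Phi>c x)"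
              by (intro continuous_on_mult smooth_on_continuous[OF w(1)] continuous_on_of_real continuous_on_subset[OF smooth_on_continuous[OF sm\<Phi>]]) auto
            show "continuous_on (- (?J \<times> ?K)) (\<lambda>x. w x * ?\<Phi>c x)"
              using continuous_on_cong[of "- (?J \<times> ?K)" "- (?J \<times> ?K)" "\<lambda>x. w x * ?\<Phi>c x" "\<lambda>_. 0"] \<Phi>0 by simp
          qed
          moreover have "\<Omega>' \<union> - (?J \<times> ?K) = UNIV" using JK\<Omega> by blast
          ultimately show ?thesis by simp
        qed
        have int: "integrable lborel (\<lambda>x. w x * ?\<Phi>c x)"
          by (rule continuous_compact_support_integrable[OF cont JK]) (simp add: \<Phi>0)
        have ReP: "Re (w x * ?\<Phi>c x) = \<alpha> (fst x) * H x" for x by (simp add: H_def \<Phi>_def)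
        have "flow_dist l \<Phi> = Re (LINT x|lborel. w x * ?\<Phi>c x)" using eq1 by (metis Re_complex_of_real)
        also have "\<dots> = (LINT x|lborel. Re (w x * ?\<Phi>c x))"
          by (rule integral_bounded_linear[OF bounded_linear_Re int, symmetric])
        also have "\<dots> = (LINT t|lborel. (LINT y|lborel. Re (w (t, y) * ?\<Phi>c (t, y))))"
          by (rule integral_product_space) (use int in \<open>rule integrable_Re\<close>)
        also have "\<dots> = (LINT t|lborel. \<alpha> t * q t)" by (simp only: ReP q_def fst_conv integral_mult_right_zero)
        also have "\<dots> = integral ?J (\<lambda>t. \<alpha> t * q t)"
          by (rule compactly_supported_line_integral) (use \<alpha>J in \<open>auto intro!: continuous_on_mult \<alpha>c continuous_on_subset[OF q_cont J_sub(1)]\<close>)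
        finally have 1: "flow_dist l \<Phi> = integral ?J (\<lambda>t. \<alpha> t * q t)" .
        have pairing: "flow_pairing l \<Phi> = (\<lambda>t. \<alpha> t * (m t * l (G t) \<psi>))"
        proof
          fix t
          have "slice \<Phi> t = \<alpha> t *\<^sub>R \<psi>" by (rule tfun_eqI) (simp add: ap_slice[OF t\<Phi>] ap_simps, simp add: \<Phi>_def)
          then show "flow_pairing l \<Phi> t = \<alpha> t * (m t * l (G t) \<psi>)"
            using weak_flow_linear(2)[OF wf \<psi>1 \<psi>1] by (simp add: flow_pairing_def)
        qed
        have pc: "continuous_on ?J (\<lambda>t. \<alpha> t * (m t * l (G t) \<psi>))"
          by (intro continuous_on_mult[OF \<alpha>c] continuous_on_subset[OF p_cont J_sub(1)])
        have "((\<lambda>t. \<alpha> t * (m t * l (G t) \<psi>)) has_integral integral ?J (\<lambda>t. \<alpha> t * (m t * l (G t) \<psi>))) time"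
          by (rule has_integral_on_superset[OF integrable_integral[OF integrable_continuous_real[OF pc]] _ J_sub(2)]) (use \<alpha>J in auto)
        then have 2: "flow_dist l \<Phi> = integral ?J (\<lambda>t. \<alpha> t * (m t * l (G t) \<psi>))"
          unfolding flow_dist_def pairing by (rule integral_unique)
        have qc: "continuous_on ?J (\<lambda>t. \<alpha> t * q t)"
          by (intro continuous_on_mult[OF \<alpha>c] continuous_on_subset[OF q_cont J_sub(1)])
        show "integral ?J (\<lambda>t. \<alpha> t * (m t * l (G t) \<psi> - q t)) = 0"
          using 1 2 Henstock_Kurzweil_Integration.integral_diff[OF integrable_continuous_real[OF pc] integrable_continuous_real[OF qc]]
          by (simp add: right_diff_distrib)
      qed
      then show ?thesis by (simp add: m(2) G(2) q_def H_def)
    qed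
    ultimately show ?thesis by (intro exI[of _ "\<lambda>y. Re (w (t0, y))"] conjI ballI)
  qed
  then show ?thesis using \<rho> by (intro exI[of _ \<rho>]) blast
qed

end

section \<open>The estimate for real functions\<close>

lemma local_antiderivative:
  fixes f :: "real \<Rightarrow> real"
  assumes "continuous_on UNIV f"
  shows "\<exists>F. F t0 = 0 \<and> (\<forall>t. \<bar>t - t0\<bar> < 2 \<longrightarrow> (F has_real_derivative f t) (at t)) \<and> (\<exists>S. \<forall>t. \<bar>t - t0\<bar> < 2 \<longrightarrow> \<bar>F t\<bar> \<le> S)"
proof -
  let ?I = "{t0 - 2..t0 + 2}"
  obtain F where F: "\<And>t. t \<in> ?I \<Longrightarrow> (F has_vector_derivative f t) (at t within ?I)"
    using antiderivative_continuous[OF continuous_on_subset[OF assms subset_UNIV], of "t0 - 2" "t0 + 2"] by blast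
  have "continuous_on ?I F"
    using F by (intro continuous_on_vector_derivative) auto
  then have "compact ((\<lambda>t. F t - F t0) ` ?I)" by (intro compact_continuous_image continuous_intros) auto
  then obtain S where S: "\<forall>x\<in>(\<lambda>t. F t - F t0) ` ?I. norm x \<le> S" using compact_imp_bounded bounded_iff by blast
  have in_I: "t \<in> ?I" "t \<in> interior ?I" if "\<bar>t - t0\<bar> < 2" for t
    using that by (auto simp: abs_less_iff interior_atLeastAtMost_real)
  have "((\<lambda>t. F t - F t0) has_real_derivative f t) (at t)" if "\<bar>t - t0\<bar> < 2" for t
  proof -
    have "(F has_real_derivative f t) (at t)"
      using F[OF in_I(1)[OF that]] at_within_interior[OF in_I(2)[OF that]] by (simp add: has_real_derivative_iff_has_vector_derivative)
    then show ?thesis by (auto intro!: derivative_eq_intros)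
  qed
  moreover have "\<bar>F t - F t0\<bar> \<le> S" if "\<bar>t - t0\<bar> < 2" for t using S in_I(1)[OF that] by auto
  ultimately show ?thesis by (intro exI[of _ "\<lambda>t. F t - F t0"]) auto
qed

lemma fourier_test_add:
  assumes "is_test f" "is_test h"
  shows "fourier (\<lambda>x. of_real (f x + h x)) \<xi> = fourier (\<lambda>x. of_real (f x)) \<xi> + fourier (\<lambda>x. of_real (h x)) \<xi>"
proof -
  have i: "integrable lborel (\<lambda>x. f x * wave c \<xi> x)" if "is_test f" for c and f :: "'a \<Rightarrow> real"
    using is_test_integrable[OF is_test_mult[OF smooth_wave that]] by (simp add: mult.commute)
  show ?thesis
    unfolding fourier_wave[OF assms(1)] fourier_wave[OF assms(2)] fourier_wave[OF is_test_add[OF assms]]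
    by (simp add: distrib_right i assms algebra_simps)
qed

lemma bracket_ge: "exp 1 \<le> bracket \<xi>" "norm \<xi> \<le> bracket \<xi>"
  unfolding bracket_def by (auto intro: real_le_rsqrt)

lemma bracket_pos: "bracket \<xi> > 0"
  using bracket_ge(1)[of \<xi>] exp_gt_zero[of "1::real"] by linarith

lemma ln_bracket_ge_1: "1 \<le> ln (bracket \<xi>)"
  using bracket_ge(1)[of \<xi>] by (subst ln_ge_iff[OF bracket_pos])

lemma bracket_measurable [measurable]: "bracket \<in> borel_measurable borel"
  unfolding bracket_def[abs_def] by measurable

lemma dyadic_shell: "1 \<le> x \<Longrightarrow> \<exists>i. 2 ^ i \<le> x \<and> x < 2 ^ Suc i" for x :: real
proof -
  assume x: "1 \<le> x"
  obtain n where n: "x < 2 ^ n" using real_arch_pow[of 2 x] by auto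
  define k where "k = (LEAST n. x < 2 ^ n)"
  have k: "x < 2 ^ k" unfolding k_def using n by (rule LeastI)
  then have "k \<noteq> 0" using x by (cases k) auto
  then obtain i where i: "k = Suc i" by (cases k) auto
  have "\<not> x < 2 ^ i" using not_less_Least[of i "\<lambda>n. x < 2 ^ n"] i by (simp add: k_def)
  then show ?thesis using k i by (intro exI[of _ i]) auto
qed

text \<open>From \<open>exp x \<ge> x\<^sup>2 / 2\<close> each summand is at most \<open>2 / 2 ^ i\<close>.\<close>

lemma dyadic_exp_sum: "(\<Sum>i<I. 2 ^ i * exp (- (2 ^ i))) \<le> (4::real)"
proof -
  have term_le: "(2::real) ^ i * exp (- (2 ^ i)) \<le> 2 * (1 / 2) ^ i" for i :: nat
  proof -
    define x :: real where "x = 2 ^ i"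
    have x: "x > 0" by (simp add: x_def)
    have "x\<^sup>2 / 2 \<le> exp x" using exp_lower_Taylor_quadratic[of x] x by simp
    then have "x * exp (- x) \<le> 2 / x" using x by (simp add: exp_minus field_simps power2_eq_square)
    then show ?thesis by (simp add: x_def power_one_over)
  qed
  have "(\<Sum>i<I. 2 ^ i * exp (- (2 ^ i))) \<le> (\<Sum>i<I. 2 * (1 / 2 :: real) ^ i)" by (intro sum_mono term_le)
  also have "\<dots> = 2 * (\<Sum>i<I. (1 / 2 :: real) ^ i)" by (simp add: sum_distrib_left)
  also have "\<dots> \<le> 2 * 2"
  proof -
    have "(\<Sum>i<I. (1 / 2 :: real) ^ i) = 2 - 2 * (1 / 2) ^ I" by (induction I) auto
    then show ?thesis by simp
  qed
  finally show ?thesis by simp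
qed

definition cut_mult :: "('a::euclidean_space \<Rightarrow> real) \<Rightarrow> 'a tfun \<Rightarrow> 'a tfun" where
  "cut_mult h f = Abs_tfun (\<lambda>y. h y * ap f y)"

lemma ap_cut_mult: "smooth_on UNIV h \<Longrightarrow> ap (cut_mult h f) y = h y * ap f y"
  unfolding cut_mult_def by (subst ap_Abs[OF is_test_mult[OF _ is_test_ap]]) auto

lemma norm_cut_mult_le:
  assumes h: "smooth_on UNIV h" "\<And>x. 0 \<le> h x" "\<And>x. h x \<le> 1"
  shows "norm (cut_mult h f) \<le> norm f"
proof (rule power2_le_imp_le)
  have "(norm (cut_mult h f))\<^sup>2 = (LINT y|lborel. ap (cut_mult h f) y * ap (cut_mult h f) y)"
    by (simp add: power2_norm_eq_inner inner_tfun_def)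
  also have "\<dots> \<le> (LINT y|lborel. ap f y * ap f y)"
  proof (rule integral_mono)
    show "integrable lborel (\<lambda>y. ap (cut_mult h f) y * ap (cut_mult h f) y)" "integrable lborel (\<lambda>y. ap f y * ap f y)"
      by (rule ap_mult_integrable[OF smooth_ap])+
    show "ap (cut_mult h f) y * ap (cut_mult h f) y \<le> ap f y * ap f y" for y
    proof -
      have "(h y)\<^sup>2 \<le> 1" using h by (simp add: power_le_one)
      then have "(h y)\<^sup>2 * (ap f y)\<^sup>2 \<le> 1 * (ap f y)\<^sup>2" by (rule mult_right_mono) simp
      then show ?thesis by (simp add: ap_cut_mult[OF h(1)] power2_eq_square mult_ac)
    qed
  qed
  also have "\<dots> = (norm f)\<^sup>2" by (simp add: power2_norm_eq_inner inner_tfun_def)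
  finally show "(norm (cut_mult h f))\<^sup>2 \<le> (norm f)\<^sup>2" .
qed simp

text \<open>On the shell the logarithm is at most \<open>2 ^ (i + 1)\<close>. The decay of \<open>W\<close> is evaluated at the inner radius \<open>exp (2 ^ i)\<close> and integrated over the ball of radius \<open>exp (2 ^ (i + 1))\<close>; the other part is left to the Plancherel bound. One factor \<open>2\<close> of \<open>2 ^ (i + 2)\<close> stems from the square of the sum.\<close>

lemma shell_integral_bound:
  fixes f W h :: "'a::euclidean_space tfun"
  assumes split: "f = W + h" and decay: "\<And>c \<xi>. bracket \<xi> ^ (2 * k) * \<bar>LINT y|lborel. ap W y * wave c \<xi> y\<bar> \<le> Q" and Q: "Q \<ge> 0"
  shows "(\<integral>\<^sup>+\<xi>. indicator {\<xi>. 2 ^ i \<le> ln (bracket \<xi>) \<and> ln (bracket \<xi>) < 2 ^ Suc i} \<xi> *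
      ennreal (ln (bracket \<xi>) * (cmod (fourier (\<lambda>x. of_real (ap f x)) \<xi>))\<^sup>2) \<partial>lborel)
    \<le> ennreal (2 ^ (i + 2) * (4 * Q\<^sup>2 * exp (- (4 * real k * 2 ^ i)) * (unit_ball_vol (real DIM('a)) * exp (2 * real DIM('a) * 2 ^ i)) + (2 * pi) ^ DIM('a) * (norm h)\<^sup>2))"
proof -
  let ?S = "{\<xi>::'a. 2 ^ i \<le> ln (bracket \<xi>) \<and> ln (bracket \<xi>) < 2 ^ Suc i}"
  let ?F = "\<lambda>(g::'a tfun) \<xi>. cmod (fourier (\<lambda>x. of_real (ap g x)) \<xi>)"
  let ?q = "4 * Q\<^sup>2 * exp (- (4 * real k * 2 ^ i))"
  let ?V = "unit_ball_vol (real DIM('a)) * exp (2 * real DIM('a) * 2 ^ i)"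
  have m [measurable]: "(\<lambda>x. complex_of_real (ap g x)) \<in> borel_measurable borel" for g :: "'a tfun"
    by (intro borel_measurable_continuous_onI continuous_on_of_real is_test_continuous is_test_ap)
  have Sm [measurable]: "?S \<in> sets borel" by measurable
  have Wdecay: "(?F W \<xi>)\<^sup>2 \<le> ?q" if \<xi>: "\<xi> \<in> ?S" for \<xi>
  proof -
    have "exp (2 ^ i) \<le> bracket \<xi>" using \<xi> by (simp add: ln_ge_iff[OF bracket_pos])
    then have br: "exp (2 ^ i) ^ (2 * k) \<le> bracket \<xi> ^ (2 * k)" by (rule power_mono) simp
    have e: "exp (2 ^ i) ^ (2 * k) = exp (2 * real k * 2 ^ i)" by (simp add: exp_of_nat_mult[symmetric] mult_ac)
    have b: "\<bar>LINT y|lborel. ap W y * wave c \<xi> y\<bar> \<le> Q * exp (- (2 * real k * 2 ^ i))" for c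
    proof -
      have "exp (2 * real k * 2 ^ i) * \<bar>LINT y|lborel. ap W y * wave c \<xi> y\<bar> \<le> Q"
        using mult_right_mono[OF br, of "\<bar>LINT y|lborel. ap W y * wave c \<xi> y\<bar>"] decay[of \<xi> c] unfolding e by simp
      then show ?thesis by (simp add: exp_minus field_simps)
    qed
    have "?F W \<xi> \<le> \<bar>LINT y|lborel. ap W y * wave 0 \<xi> y\<bar> + \<bar>LINT y|lborel. ap W y * wave (- pi / 2) \<xi> y\<bar>"
      unfolding fourier_wave[OF is_test_ap] by (rule order.trans[OF norm_triangle_ineq4]) (simp add: norm_mult)
    also have "\<dots> \<le> 2 * (Q * exp (- (2 * real k * 2 ^ i)))" using b[of 0] b[of "- pi / 2"] by simp
    finally have "(?F W \<xi>)\<^sup>2 \<le> (2 * (Q * exp (- (2 * real k * 2 ^ i))))\<^sup>2" by (rule power_mono) simp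
    also have "\<dots> = ?q" by (simp add: power_mult_distrib exp_of_nat_mult[symmetric])
    finally show ?thesis .
  qed
  have "(\<integral>\<^sup>+\<xi>. indicator ?S \<xi> * ennreal (ln (bracket \<xi>) * (?F f \<xi>)\<^sup>2) \<partial>lborel)
     \<le> (\<integral>\<^sup>+\<xi>. ennreal (2 ^ (i + 2)) * (ennreal ?q * indicator ?S \<xi> + ennreal ((?F h \<xi>)\<^sup>2)) \<partial>lborel)"
  proof (rule nn_integral_mono)
    fix \<xi> :: 'a
    show "indicator ?S \<xi> * ennreal (ln (bracket \<xi>) * (?F f \<xi>)\<^sup>2) \<le> ennreal (2 ^ (i + 2)) * (ennreal ?q * indicator ?S \<xi> + ennreal ((?F h \<xi>)\<^sup>2))"
    proof (cases "\<xi> \<in> ?S")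
      case True
      have "ap f = (\<lambda>x. ap W x + ap h x)" by (simp add: split ap_simps fun_eq_iff)
      then have "?F f \<xi> \<le> ?F W \<xi> + ?F h \<xi>"
        using fourier_test_add[OF is_test_ap[of W] is_test_ap[of h], of \<xi>] norm_triangle_ineq by simp
      then have "(?F f \<xi>)\<^sup>2 \<le> (?F W \<xi> + ?F h \<xi>)\<^sup>2" by (rule power_mono) simp
      also have "\<dots> \<le> 2 * (?F W \<xi>)\<^sup>2 + 2 * (?F h \<xi>)\<^sup>2"
        using zero_le_power2[of "?F W \<xi> - ?F h \<xi>"] by (simp add: power2_eq_square algebra_simps)
      also have "\<dots> \<le> 2 * (?q + (?F h \<xi>)\<^sup>2)" using Wdecay[OF True] by simp
      finally have 1: "(?F f \<xi>)\<^sup>2 \<le> 2 * (?q + (?F h \<xi>)\<^sup>2)" .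
      have "ln (bracket \<xi>) * (?F f \<xi>)\<^sup>2 \<le> 2 ^ Suc i * (2 * (?q + (?F h \<xi>)\<^sup>2))"
        by (rule mult_mono) (use True 1 in auto)
      then have "ennreal (ln (bracket \<xi>) * (?F f \<xi>)\<^sup>2) \<le> ennreal (2 ^ (i + 2) * (?q + (?F h \<xi>)\<^sup>2))"
      proof (intro ennreal_leI)
        have "2 ^ Suc i * (2 * x) = 2 ^ (i + 2) * x" for x :: real by simp
        then show "ln (bracket \<xi>) * (?F f \<xi>)\<^sup>2 \<le> 2 ^ (i + 2) * (?q + (?F h \<xi>)\<^sup>2)"
          using \<open>ln (bracket \<xi>) * (?F f \<xi>)\<^sup>2 \<le> 2 ^ Suc i * (2 * (?q + (?F h \<xi>)\<^sup>2))\<close> by (simp only:)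
      qed
      also have "\<dots> = ennreal (2 ^ (i + 2)) * (ennreal ?q + ennreal ((?F h \<xi>)\<^sup>2))"
        by (subst ennreal_mult'') (auto simp: ennreal_plus)
      finally show ?thesis using True by simp
    qed simp
  qed
  also have "\<dots> = ennreal (2 ^ (i + 2)) * (ennreal ?q * emeasure lborel ?S + (\<integral>\<^sup>+\<xi>. ennreal ((?F h \<xi>)\<^sup>2) \<partial>lborel))"
    by (simp add: nn_integral_cmult nn_integral_add)
  also have "\<dots> \<le> ennreal (2 ^ (i + 2)) * (ennreal ?q * ennreal ?V + ennreal ((2 * pi) ^ DIM('a) * (norm h)\<^sup>2))"
  proof (intro mult_left_mono add_mono)
    have "?S \<subseteq> ball 0 (exp (2 ^ Suc i))"
    proof
      fix \<xi> :: 'a assume "\<xi> \<in> ?S"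
      then have "bracket \<xi> < exp (2 ^ Suc i)" using bracket_pos[of \<xi>] by (metis exp_less_mono exp_ln mem_Collect_eq)
      then show "\<xi> \<in> ball 0 (exp (2 ^ Suc i))" using bracket_ge(2)[of \<xi>] by simp
    qed
    then have "emeasure lborel ?S \<le> emeasure lborel (ball (0::'a) (exp (2 ^ Suc i)))" by (rule emeasure_mono) simp
    also have "\<dots> = ennreal (unit_ball_vol (real DIM('a)) * exp (2 ^ Suc i) ^ DIM('a))" by (rule emeasure_ball) simp
    also have "exp (2 ^ Suc i) ^ DIM('a) = exp (2 * real DIM('a) * 2 ^ i)" by (simp add: exp_of_nat_mult[symmetric] mult_ac)
    finally show "emeasure lborel ?S \<le> ennreal ?V" .
    show "(\<integral>\<^sup>+\<xi>. ennreal ((?F h \<xi>)\<^sup>2) \<partial>lborel) \<le> ennreal ((2 * pi) ^ DIM('a) * (norm h)\<^sup>2)"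
    proof -
      have "(norm h)\<^sup>2 = (LINT x|lborel. (ap h x)\<^sup>2)"
        unfolding power2_norm_eq_inner inner_tfun_def by (simp only: power2_eq_square)
      then show ?thesis using plancherel_bound[OF is_test_ap[of h]] by (simp only:)
    qed
  qed auto
  also have "\<dots> = ennreal (2 ^ (i + 2) * (?q * ?V + (2 * pi) ^ DIM('a) * (norm h)\<^sup>2))"
    by (simp add: ennreal_mult'[symmetric] ennreal_plus[symmetric] del: ennreal_plus)
  finally show ?thesis .
qed

context parabolic_flow
begin

text \<open>The weak flow \<open>l i\<close> started from \<open>f\<close> yields, after cutting off by \<open>\<phi>\<close>, a test function \<open>w i\<close> that represents the spectral part of \<open>f\<close> below the level \<open>M * 2 ^ i\<close>. It decays in frequency by the uniform boundedness principle applied to cut-off waves, while the dyadic sum of the squares of \<open>h i = f - w i\<close> is bounded by the quadratic form: the norm of \<open>h i\<close> is recovered by testing \<open>h i\<close> against \<open>\<phi> * h i\<close>.\<close>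

theorem real_superlogarithmic_estimate:
  assumes hypo: "locally_hypoelliptic_near (L_dist a0 g b b0) (t0, y0)"
  shows "\<exists>r>0. \<forall>\<epsilon>>0. \<exists>C\<ge>0. \<forall>f\<in>supported_in (ball y0 r).
    (\<integral>\<^sup>+\<xi>. ennreal (ln (bracket \<xi>) * (cmod (fourier (\<lambda>x. of_real (ap f x)) \<xi>))\<^sup>2) \<partial>lborel)
      \<le> ennreal (\<epsilon> * inner (shifted_op b b0 C0 f) f + C * (norm f)\<^sup>2)"
proof -
  let ?A = "shifted_op b b0 C0" and ?N = "DIM(real^'m)"
  obtain \<rho> where \<rho>: "\<rho> > 0" "\<rho> < 1" and reg: "\<And>c l. weak_flow S c l \<Longrightarrow>
    \<exists>W. smooth_on (ball y0 \<rho>) W \<and> (\<forall>\<psi>\<in>supported_in (ball y0 \<rho>). l 0 \<psi> = (LINT y|lborel. W y * ap \<psi> y))"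
    using hypoelliptic_flow_regular[OF hypo] by blast
  have S0: "S \<ge> 0" using G(3)[of t0] by simp
  obtain \<phi> :: "real^'m \<Rightarrow> real" where \<phi>: "smooth_on UNIV \<phi>" "\<And>x. 0 \<le> \<phi> x" "\<And>x. \<phi> x \<le> 1"
    "\<And>x. x \<in> cball y0 (\<rho> / 3) \<Longrightarrow> \<phi> x = 1" "\<And>x. x \<notin> ball y0 (\<rho> / 2) \<Longrightarrow> \<phi> x = 0"
    using cutoff_exists[of "\<rho> / 3" "\<rho> / 2" y0] \<rho> by auto
  have cut_sub: "cball y0 (\<rho> / 2) \<subseteq> ball y0 \<rho>" "ball y0 \<rho> \<subseteq> ball y0 1" using \<rho> by auto
  have \<phi>0: "\<phi> x = 0" if "x \<notin> cball y0 (\<rho> / 2)" for x using \<phi>(5) that by simp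
  have cut_test: "is_test (\<lambda>y. \<phi> y * h y)" if "smooth_on UNIV h" for h
    by (rule is_testI[of _ "cball y0 (\<rho> / 2)"]) (use \<phi>0 in \<open>auto intro: smooth_on_mult \<phi> that\<close>)
  have cut_sup: "cut_mult \<phi> f \<in> supported_in (ball y0 \<rho>)" "cut_mult \<phi> f \<in> supported_in (ball y0 1)" for f
    using cut_sub \<phi>0 by (auto intro!: supported_inI[of "cball y0 (\<rho> / 2)"] simp: ap_cut_mult[OF \<phi>(1)])
  have localized: "is_test (\<lambda>y. \<phi> y * W y)" if W: "smooth_on (ball y0 \<rho>) W" for W
  proof (rule is_testI[of _ "cball y0 (\<rho> / 2)"])
    have 1: "smooth_on (ball y0 \<rho>) (\<lambda>y. \<phi> y * W y)" by (intro smooth_on_mult W smooth_on_subset[OF \<phi>(1)]) auto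
    have 2: "smooth_on (- cball y0 (\<rho> / 2)) (\<lambda>y. \<phi> y * W y)"
      by (rule smooth_on_cong[of _ "\<lambda>_. 0"]) (use \<phi>0 in auto)
    have "smooth_on (ball y0 \<rho> \<union> - cball y0 (\<rho> / 2)) (\<lambda>y. \<phi> y * W y)" by (rule smooth_on_Un[OF _ _ 1 2]) auto
    moreover have "ball y0 \<rho> \<union> - cball y0 (\<rho> / 2) = UNIV" using cut_sub by blast
    ultimately show "smooth_on UNIV (\<lambda>y. \<phi> y * W y)" by simp
  qed (use \<phi>0 in auto)
  \<comment> \<open>waves cut off by \<open>\<phi>\<close> and normalized by the decay rate to be proved; \<open>j\<close> is the pair of phase and frequency\<close>
  define packet where "packet = (\<lambda>k j. Abs_tfun (\<lambda>y. \<phi> y * (bracket (snd j) ^ (2 * k) * wave (fst j) (snd j) y)) :: (real^'m) tfun)"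
  have ap_packet: "ap (packet k j) y = \<phi> y * (bracket (snd j) ^ (2 * k) * wave (fst j) (snd j) y)" for k j y
    unfolding packet_def by (subst ap_Abs[OF cut_test]) (auto intro!: smooth_on_mult smooth_wave)
  have packet_sup: "packet k j \<in> supported_in (ball y0 \<rho>)" "packet k j \<in> supported_in (ball y0 1)" for k j
    using cut_sub \<phi>0 by (auto intro!: supported_inI[of "cball y0 (\<rho> / 2)"] simp: ap_packet)
  have packet_value: "l 0 (packet k j) = bracket (snd j) ^ (2 * k) * (LINT y|lborel. (\<phi> y * W y) * wave (fst j) (snd j) y)"
    if "\<forall>\<psi>\<in>supported_in (ball y0 \<rho>). l 0 \<psi> = (LINT y|lborel. W y * ap \<psi> y)" for l :: "real \<Rightarrow> _" and W k j
  proof -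
    have "l 0 (packet k j) = (LINT y|lborel. bracket (snd j) ^ (2 * k) * ((\<phi> y * W y) * wave (fst j) (snd j) y))"
      using that packet_sup(1)[of k j] by (simp add: ap_packet mult_ac)
    then show ?thesis by simp
  qed
  have packets: "\<exists>C\<ge>0. \<forall>c l. weak_flow S c l \<longrightarrow> c \<ge> 0 \<longrightarrow> (\<forall>j\<in>UNIV. \<bar>l 0 (packet k j)\<bar> \<le> C * c)" for k
  proof (rule weak_flow_uniform_bound[OF packet_sup(2) S0])
    fix c l assume "weak_flow S c l"
    then obtain W where W: "smooth_on (ball y0 \<rho>) W" "\<forall>\<psi>\<in>supported_in (ball y0 \<rho>). l 0 \<psi> = (LINT y|lborel. W y * ap \<psi> y)"
      using reg by blast
    obtain B where B: "\<forall>c \<xi>. bracket \<xi> ^ (2 * k) * \<bar>LINT y|lborel. (\<phi> y * W y) * wave c \<xi> y\<bar> \<le> B"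
      using wave_integral_decay[OF localized[OF W(1)], of k] by blast
    have "\<bar>l 0 (packet k j)\<bar> \<le> B" for j
      using B bracket_pos[of "snd j"] unfolding packet_value[where l = l and W = W, OF W(2)] by (simp add: abs_mult)
    then show "\<exists>B. \<forall>j\<in>UNIV. \<bar>l 0 (packet k j)\<bar> \<le> B" by blast
  qed
  have main: "\<exists>C\<ge>0. \<forall>f\<in>supported_in (ball y0 (\<rho> / 3)).
    (\<integral>\<^sup>+\<xi>. ennreal (ln (bracket \<xi>) * (cmod (fourier (\<lambda>x. of_real (ap f x)) \<xi>))\<^sup>2) \<partial>lborel)
      \<le> ennreal (\<epsilon> * inner (?A f) f + C * (norm f)\<^sup>2)" if \<epsilon>: "\<epsilon> > 0" for \<epsilon>
  proof -
    define P :: real where "P = (2 * pi) ^ ?N"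
    have P: "P > 0" by (simp add: P_def)
    \<comment> \<open>the shells cost a factor \<open>4\<close>, Plancherel the factor \<open>P\<close>, and the dyadic sum the factor \<open>2 / M\<close>\<close>
    define M where "M = 8 * P / \<epsilon>"
    have M: "M > 0" using P \<epsilon> by (simp add: M_def)
    define V :: real where "V = unit_ball_vol (real ?N)"
    have V: "V \<ge> 0" by (simp add: V_def)
    \<comment> \<open>squared decay \<open>4 * k\<close> against squared growth \<open>6 * M * S\<close> of the flow and \<open>2 * ?N\<close> for the volume of the shell\<close>
    obtain k :: nat where k: "6 * M * S + 2 * real ?N + 1 \<le> 4 * real k"
    proof -
      obtain k :: nat where "6 * M * S + 2 * real ?N + 1 \<le> real k" using real_arch_simple by blast
      then show ?thesis by (intro that[of k]) simp
    qed
    obtain Ck where Ck: "Ck \<ge> 0" "\<And>c l j. weak_flow S c l \<Longrightarrow> c \<ge> 0 \<Longrightarrow> \<bar>l 0 (packet k j)\<bar> \<le> Ck * c"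
      using packets[of k] by blast
    define C where "C = 64 * (Ck\<^sup>2 * V)"
    have C: "C \<ge> 0" using V by (simp add: C_def)
    have "(\<integral>\<^sup>+\<xi>. ennreal (ln (bracket \<xi>) * (cmod (fourier (\<lambda>x. of_real (ap f x)) \<xi>))\<^sup>2) \<partial>lborel)
      \<le> ennreal (\<epsilon> * inner (?A f) f + C * (norm f)\<^sup>2)" if f: "f \<in> supported_in (ball y0 (\<rho> / 3))" for f
    proof -
      have f1: "f \<in> supported_in (ball y0 1)" using f \<rho> by (auto simp: supported_in_def)
      obtain l where wf: "\<forall>i. weak_flow S (exp (3 * (M * 2 ^ i) * S) * norm f) (l i)"
        and low: "\<forall>I h. (\<forall>i. h i \<in> supported_in (ball y0 1)) \<longrightarrow>
          2 * (\<Sum>i<I. 2 ^ i * (inner f (h i) - l i 0 (h i))) \<le> 2 / M * inner (?A f) f + (\<Sum>i<I. 2 ^ i * (norm (h i))\<^sup>2)"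
        using spectral_weak_flows[OF f1 M S0] by blast
      have "\<forall>i. \<exists>W. smooth_on (ball y0 \<rho>) W \<and> (\<forall>\<psi>\<in>supported_in (ball y0 \<rho>). l i 0 \<psi> = (LINT y|lborel. W y * ap \<psi> y))"
        using reg wf by blast
      then obtain W where W: "\<And>i. smooth_on (ball y0 \<rho>) (W i)"
        "\<And>i. \<forall>\<psi>\<in>supported_in (ball y0 \<rho>). l i 0 \<psi> = (LINT y|lborel. W i y * ap \<psi> y)" by metis
      define w where "w = (\<lambda>i. Abs_tfun (\<lambda>y. \<phi> y * W i y) :: (real^'m) tfun)"
      have ap_w: "ap (w i) y = \<phi> y * W i y" for i y unfolding w_def by (subst ap_Abs[OF localized[OF W(1)]]) auto
      define h where "h = (\<lambda>i. f - w i)"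
      have w_inner: "inner (w i) v = l i 0 (cut_mult \<phi> v)" for i v
        using W(2) cut_sup(1) by (simp add: inner_tfun_def ap_w ap_cut_mult[OF \<phi>(1)] mult_ac)
      have f_inner: "inner f (cut_mult \<phi> v) = inner f v" for v
      proof -
        have "ap f y * ap (cut_mult \<phi> v) y = ap f y * ap v y" for y
          using supported_in_outside[OF f, of y] \<phi>(4)[of y] by (cases "y \<in> ball y0 (\<rho> / 3)") (auto simp: ap_cut_mult[OF \<phi>(1)])
        then show ?thesis unfolding inner_tfun_def by (simp only:)
      qed
      have high: "(\<Sum>i<I. 2 ^ i * (norm (h i))\<^sup>2) \<le> 2 / M * inner (?A f) f" for I
      proof -
        have "2 * (\<Sum>i<I. 2 ^ i * (norm (h i))\<^sup>2) = 2 * (\<Sum>i<I. 2 ^ i * (inner f (cut_mult \<phi> (h i)) - l i 0 (cut_mult \<phi> (h i))))"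
          by (simp add: f_inner w_inner[symmetric] inner_diff_left[symmetric] h_def power2_norm_eq_inner)
        also have "\<dots> \<le> 2 / M * inner (?A f) f + (\<Sum>i<I. 2 ^ i * (norm (cut_mult \<phi> (h i)))\<^sup>2)"
          using low[rule_format, of "\<lambda>i. cut_mult \<phi> (h i)"] cut_sup(2) by simp
        also have "(\<Sum>i<I. 2 ^ i * (norm (cut_mult \<phi> (h i)))\<^sup>2) \<le> (\<Sum>i<I. 2 ^ i * (norm (h i))\<^sup>2)"
          by (intro sum_mono mult_left_mono power_mono norm_cut_mult_le \<phi>) auto
        finally show ?thesis by simp
      qed
      define Q where "Q = (\<lambda>i::nat. Ck * (exp (3 * (M * 2 ^ i) * S) * norm f))"
      have Q: "Q i \<ge> 0" for i using Ck(1) by (simp add: Q_def)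
      have decay: "bracket \<xi> ^ (2 * k) * \<bar>LINT y|lborel. ap (w i) y * wave c \<xi> y\<bar> \<le> Q i" for i c \<xi>
      proof -
        have "\<bar>l i 0 (packet k (c, \<xi>))\<bar> \<le> Q i" unfolding Q_def using wf by (intro Ck(2)) auto
        moreover have "\<bar>l i 0 (packet k (c, \<xi>))\<bar> = bracket \<xi> ^ (2 * k) * \<bar>LINT y|lborel. ap (w i) y * wave c \<xi> y\<bar>"
          unfolding packet_value[where l = "l i" and W = "W i", OF W(2)[of i]] using bracket_pos[of \<xi>] by (simp add: ap_w abs_mult)
        ultimately show ?thesis by simp
      qed
      let ?S = "\<lambda>i. {\<xi>::real^'m. 2 ^ i \<le> ln (bracket \<xi>) \<and> ln (bracket \<xi>) < 2 ^ Suc i}"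
      let ?g = "\<lambda>\<xi>. ln (bracket \<xi>) * (cmod (fourier (\<lambda>x. complex_of_real (ap f x)) \<xi>))\<^sup>2"
      define T where "T = (\<lambda>i. 2 ^ (i + 2) * (4 * (Q i)\<^sup>2 * exp (- (4 * real k * 2 ^ i)) * (V * exp (2 * real ?N * 2 ^ i)) + P * (norm (h i))\<^sup>2))"
      have T0: "T i \<ge> 0" for i using V P by (auto simp: T_def intro!: mult_nonneg_nonneg add_nonneg_nonneg)
      have shell: "(\<integral>\<^sup>+\<xi>. indicator (?S i) \<xi> * ennreal (?g \<xi>) \<partial>lborel) \<le> ennreal (T i)" for i
        unfolding T_def V_def P_def by (rule shell_integral_bound[OF _ decay Q]) (simp add: h_def)
      have low_term: "2 ^ (i + 2) * (4 * (Q i)\<^sup>2 * exp (- (4 * real k * 2 ^ i)) * (V * exp (2 * real ?N * 2 ^ i)))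
          \<le> (16 * (Ck\<^sup>2 * V) * (norm f)\<^sup>2) * (2 ^ i * exp (- (2 ^ i)))" for i :: nat
      proof -
        have Qsq: "(Q i)\<^sup>2 = Ck\<^sup>2 * (norm f)\<^sup>2 * exp (6 * M * S * 2 ^ i)"
        proof -
          have "(exp (3 * (M * 2 ^ i) * S))\<^sup>2 = exp (6 * M * S * 2 ^ i)"
            by (simp add: exp_double[symmetric] mult_ac)
          then show ?thesis unfolding Q_def power_mult_distrib by (simp only: mult_ac)
        qed
        have gen: "4 * x * (4 * (a * n * e1) * e2 * (v * e3)) = (16 * (a * v) * n * x) * (e1 * e2 * e3)"
          for x a n e1 e2 v e3 :: real by simp
        have four: "2 ^ (i + 2) = (4::real) * 2 ^ i" by simp
        have "2 ^ (i + 2) * (4 * (Q i)\<^sup>2 * exp (- (4 * real k * 2 ^ i)) * (V * exp (2 * real ?N * 2 ^ i)))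
          = (16 * (Ck\<^sup>2 * V) * (norm f)\<^sup>2 * 2 ^ i) * (exp (6 * M * S * 2 ^ i) * exp (- (4 * real k * 2 ^ i)) * exp (2 * real ?N * 2 ^ i))"
          by (simp only: Qsq four gen)
        also have "exp (6 * M * S * 2 ^ i) * exp (- (4 * real k * 2 ^ i)) * exp (2 * real ?N * 2 ^ i)
          = exp ((6 * M * S + 2 * real ?N - 4 * real k) * 2 ^ i)"
        proof -
          have "exp p * exp q * exp r = exp (p + q + r)" for p q r :: real by (simp only: exp_add)
          moreover have "6 * M * S * 2 ^ i + - (4 * real k * 2 ^ i) + 2 * real ?N * 2 ^ i = (6 * M * S + 2 * real ?N - 4 * real k) * 2 ^ i"
            by (simp add: left_diff_distrib distrib_right)
          ultimately show ?thesis by (simp only:)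
        qed
        also have "(16 * (Ck\<^sup>2 * V) * (norm f)\<^sup>2 * 2 ^ i) * exp ((6 * M * S + 2 * real ?N - 4 * real k) * 2 ^ i)
          \<le> (16 * (Ck\<^sup>2 * V) * (norm f)\<^sup>2 * 2 ^ i) * exp (- (2 ^ i))"
        proof (intro mult_left_mono)
          have "(6 * M * S + 2 * real ?N - 4 * real k) * 2 ^ i \<le> (- 1) * 2 ^ i" using k by (intro mult_right_mono) auto
          then show "exp ((6 * M * S + 2 * real ?N - 4 * real k) * 2 ^ i) \<le> exp (- (2 ^ i))" by simp
        qed (use V in auto)
        finally show ?thesis by (simp only: mult.assoc)
      qed
      have T_sum: "(\<Sum>i<I. T i) \<le> \<epsilon> * inner (?A f) f + C * (norm f)\<^sup>2" for I
      proof -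
        have "(\<Sum>i<I. T i) \<le> (\<Sum>i<I. (16 * (Ck\<^sup>2 * V) * (norm f)\<^sup>2) * (2 ^ i * exp (- (2 ^ i))) + 4 * P * (2 ^ i * (norm (h i))\<^sup>2))"
        proof (rule sum_mono)
          fix i
          show "T i \<le> (16 * (Ck\<^sup>2 * V) * (norm f)\<^sup>2) * (2 ^ i * exp (- (2 ^ i))) + 4 * P * (2 ^ i * (norm (h i))\<^sup>2)"
            unfolding T_def distrib_left by (rule add_mono[OF low_term]) simp
        qed
        also have "\<dots> = (16 * (Ck\<^sup>2 * V) * (norm f)\<^sup>2) * (\<Sum>i<I. 2 ^ i * exp (- (2 ^ i))) + 4 * P * (\<Sum>i<I. 2 ^ i * (norm (h i))\<^sup>2)"
          by (simp only: sum.distrib sum_distrib_left)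
        also have "\<dots> \<le> (16 * (Ck\<^sup>2 * V) * (norm f)\<^sup>2) * 4 + 4 * P * (2 / M * inner (?A f) f)"
          using V P by (intro add_mono mult_left_mono dyadic_exp_sum high) auto
        also have "4 * P * (2 / M * inner (?A f) f) = \<epsilon> * inner (?A f) f" using P \<epsilon> by (simp add: M_def)
        finally show ?thesis by (simp add: C_def mult_ac)
      qed
      have fm [measurable]: "(\<lambda>x. complex_of_real (ap f x)) \<in> borel_measurable borel"
        by (intro borel_measurable_continuous_onI continuous_on_of_real is_test_continuous is_test_ap)
      have "(\<integral>\<^sup>+\<xi>. ennreal (?g \<xi>) \<partial>lborel) \<le> (\<integral>\<^sup>+\<xi>. (\<Sum>i. indicator (?S i) \<xi> * ennreal (?g \<xi>)) \<partial>lborel)"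
      proof (rule nn_integral_mono)
        fix \<xi> :: "real^'m"
        obtain i where i: "2 ^ i \<le> ln (bracket \<xi>)" "ln (bracket \<xi>) < 2 ^ Suc i" using dyadic_shell[OF ln_bracket_ge_1] by blast
        define X where "X = (\<lambda>j. indicator (?S j) \<xi> * ennreal (?g \<xi>))"
        have "sum X {i} \<le> suminf X" by (rule sum_le_suminf) auto
        moreover have "sum X {i} = X i" by simp
        moreover have "X i = ennreal (?g \<xi>)" using i by (simp add: X_def)
        ultimately show "ennreal (?g \<xi>) \<le> (\<Sum>j. indicator (?S j) \<xi> * ennreal (?g \<xi>))" by (simp only: X_def)
      qed
      also have "\<dots> = (\<Sum>i. \<integral>\<^sup>+\<xi>. indicator (?S i) \<xi> * ennreal (?g \<xi>) \<partial>lborel)" by (rule nn_integral_suminf) measurable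
      also have "\<dots> \<le> ennreal (\<epsilon> * inner (?A f) f + C * (norm f)\<^sup>2)"
      proof (rule suminf_le_const[OF summableI])
        fix I
        have "(\<Sum>i<I. \<integral>\<^sup>+\<xi>. indicator (?S i) \<xi> * ennreal (?g \<xi>) \<partial>lborel) \<le> (\<Sum>i<I. ennreal (T i))" by (intro sum_mono shell)
        also have "\<dots> = ennreal (\<Sum>i<I. T i)" using T0 by (rule sum_ennreal)
        also have "\<dots> \<le> ennreal (\<epsilon> * inner (?A f) f + C * (norm f)\<^sup>2)" by (rule ennreal_leI[OF T_sum])
        finally show "(\<Sum>i<I. \<integral>\<^sup>+\<xi>. indicator (?S i) \<xi> * ennreal (?g \<xi>) \<partial>lborel) \<le> ennreal (\<epsilon> * inner (?A f) f + C * (norm f)\<^sup>2)" .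
      qed
      finally show ?thesis .
    qed
    then show ?thesis using C by blast
  qed
  have "\<rho> / 3 > 0" using \<rho> by simp
  then show ?thesis using main by blast
qed

end

section \<open>The estimate for complex functions\<close>

lemma complex_parts_test:
  assumes "u \<in> test_functions K"
  shows "is_test (\<lambda>y. Re (u y))" "is_test (\<lambda>y. Im (u y))"
    "supp (\<lambda>y. Re (u y)) \<subseteq> K" "supp (\<lambda>y. Im (u y)) \<subseteq> K"
proof -
  have sm: "smooth_on UNIV u" and c: "compact (supp u)" "supp u \<subseteq> K" using assms by (auto simp: test_functions_def)
  have z: "Re (u x) = 0" "Im (u x) = 0" if "x \<notin> supp u" for x using not_in_supp[OF that] by auto
  show "is_test (\<lambda>y. Re (u y))"
    by (rule is_testI[OF smooth_on_linear[OF bounded_linear_Re open_UNIV sm] c(1) z(1)])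
  show "is_test (\<lambda>y. Im (u y))"
    by (rule is_testI[OF smooth_on_linear[OF bounded_linear_Im open_UNIV sm] c(1) z(2)])
  show "supp (\<lambda>y. Re (u y)) \<subseteq> K" using supp_subsetI[OF closed_supp z(1)] c(2) by (rule subset_trans)
  show "supp (\<lambda>y. Im (u y)) \<subseteq> K" using supp_subsetI[OF closed_supp z(2)] c(2) by (rule subset_trans)
qed

text \<open>Real and imaginary parts decouple because the coefficients are real.\<close>

lemma L2_op_parts:
  fixes u :: "real^'m::finite \<Rightarrow> complex"
  assumes b: "\<And>j k. smooth_on UNIV (b j k)" and u: "smooth_on UNIV u"
  shows "L2_op b b0 u y = of_real (L2_real b b0 (\<lambda>y. Re (u y)) y) + \<i> * of_real (L2_real b b0 (\<lambda>y. Im (u y)) y)"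
proof -
  have Rd: "Re (dir_deriv v h x) = dir_deriv v (\<lambda>x. Re (h x)) x" "Im (dir_deriv v h x) = dir_deriv v (\<lambda>x. Im (h x)) x"
    if "smooth_on UNIV h" for v x and h :: "real^'m \<Rightarrow> complex"
    using dir_deriv_linear[OF bounded_linear_Re that, of v x] dir_deriv_linear[OF bounded_linear_Im that, of v x] by auto
  have "smooth_on UNIV (\<lambda>z. complex_of_real (b j k z) * dir_deriv v u z)" for j k v
    by (intro smooth_on_mult smooth_on_linear[OF bounded_linear_of_real] b smooth_on_dir_deriv u open_UNIV)
  then show ?thesis
    unfolding L2_op_def L2_real_def by (simp add: Rd u complex_eq_iff)
qed

lemma real_imag_integral:
  assumes "integrable M p" "integrable M q"
  shows "Re (LINT x|M. of_real (p x) + \<i> * of_real (q x)) = (LINT x|M. p x)"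
  using assms by simp

lemma integral_bound_from_nn_integral:
  fixes f :: "'a \<Rightarrow> real"
  assumes "f \<in> borel_measurable M" "\<And>x. 0 \<le> f x" "(\<integral>\<^sup>+x. ennreal (f x) \<partial>M) \<le> ennreal B" "0 \<le> B"
  shows "integrable M f" "(LINT x|M. f x) \<le> B"
proof -
  have fin: "(\<integral>\<^sup>+x. ennreal (f x) \<partial>M) < \<infinity>" using le_less_trans[OF assms(3) ennreal_less_top] by simp
  show i: "integrable M f"
    by (rule integrableI_bounded) (use assms(1,2) fin in auto)
  have "ennreal (LINT x|M. f x) = (\<integral>\<^sup>+x. ennreal (f x) \<partial>M)"
    using nn_integral_eq_integral[OF i] assms(2) by simp
  then show "(LINT x|M. f x) \<le> B" using assms(3,4) ennreal_le_iff[of B "LINT x|M. f x"] by simp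
qed

theorem theorem7:
  fixes a0 g :: "real \<Rightarrow> real"
    and b :: "'m::finite \<Rightarrow> 'm \<Rightarrow> real^'m \<Rightarrow> real"
    and b0 :: "real^'m \<Rightarrow> real"
    and t0 :: real and y0 :: "real^'m"
  assumes a0_smooth: "smooth_on UNIV a0"
    and g_smooth: "smooth_on UNIV g"
    and g_nonneg: "\<And>t. g t \<ge> 0"
    and b_smooth: "\<And>j k. smooth_on UNIV (b j k)"
    and b0_smooth: "smooth_on UNIV b0"
    and b_sym: "\<And>j k y. b j k y = b k j y"
    and b_nonneg: "\<And>y \<eta>. (\<Sum>j\<in>UNIV. \<Sum>k\<in>UNIV. b j k y * (\<eta> $ j) * (\<eta> $ k)) \<ge> 0"
    and hypo: "locally_hypoelliptic_near (L_dist a0 g b b0) (t0, y0)"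
  shows "superlogarithmic_estimate_near (1/2) (L2_op b b0) y0"
proof -
  have "compact (b0 ` cball y0 1)"
    by (intro compact_continuous_image continuous_on_subset[OF smooth_on_continuous[OF b0_smooth]]) auto
  then obtain C0 where "\<forall>x\<in>b0 ` cball y0 1. norm x \<le> C0" using compact_imp_bounded bounded_iff by blast
  then have "\<forall>y\<in>cball y0 1. \<bar>b0 y\<bar> \<le> C0" by simp
  then have C0: "- C0 \<le> b0 y" if "y \<in> ball y0 1" for y
    using that ball_subset_cball[of y0 1] by (auto simp: abs_le_iff minus_le_iff subset_iff)
  obtain G S where G: "G t0 = 0" "\<And>t. \<bar>t - t0\<bar> < 2 \<Longrightarrow> (G has_real_derivative g t) (at t)" "\<And>t. \<bar>t - t0\<bar> < 2 \<Longrightarrow> \<bar>G t\<bar> \<le> S"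
    using local_antiderivative[OF smooth_on_continuous[OF g_smooth], of t0] by blast
  obtain F where F: "F t0 = 0" "\<And>t. \<bar>t - t0\<bar> < 2 \<Longrightarrow> (F has_real_derivative a0 t) (at t)"
    using local_antiderivative[OF smooth_on_continuous[OF a0_smooth], of t0] by blast
  define m where "m = (\<lambda>t. exp (C0 * G t - F t))"
  have "(m has_real_derivative m t * (C0 * g t - a0 t)) (at t)" if "\<bar>t - t0\<bar> < 2" for t
    unfolding m_def by (auto intro!: derivative_eq_intros G(2) F(2) that)
  then interpret parabolic_flow a0 g b b0 t0 y0 C0 S G m
    by unfold_locales (use a0_smooth g_smooth b_smooth b0_smooth b_sym b_nonneg C0 G F in \<open>auto simp: m_def\<close>)
  let ?A = "shifted_op b b0 C0"
  obtain r where r: "r > 0" and est: "\<And>\<epsilon>. \<epsilon> > 0 \<Longrightarrow> \<exists>C\<ge>0. \<forall>f\<in>supported_in (ball y0 r).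
    (\<integral>\<^sup>+\<xi>. ennreal (ln (bracket \<xi>) * (cmod (fourier (\<lambda>x. of_real (ap f x)) \<xi>))\<^sup>2) \<partial>lborel)
      \<le> ennreal (\<epsilon> * inner (?A f) f + C * (norm f)\<^sup>2)"
    using real_superlogarithmic_estimate[OF hypo] by blast
  \<comment> \<open>the radius \<open>1\<close> is that of the ball on which \<open>shifted_op\<close> is nonnegative\<close>
  define r' where "r' = min r 1"
  have r': "r' > 0" "ball y0 r' \<subseteq> ball y0 r" "ball y0 r' \<subseteq> ball y0 1" using r by (auto simp: r'_def)
  show ?thesis
    unfolding superlogarithmic_estimate_near_def
  proof (intro exI[of _ "ball y0 r'"] conjI allI impI)
    show "open (ball y0 r')" "y0 \<in> ball y0 r'" using r' by auto
    fix K \<epsilon> assume K: "compact K \<and> K \<subseteq> ball y0 r'" and \<epsilon>: "(0::real) < \<epsilon>"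
    have "\<epsilon> / 2 > 0" using \<epsilon> by simp
    from est[OF this] obtain C where C: "C \<ge> 0" and real_est: "\<forall>f\<in>supported_in (ball y0 r).
      (\<integral>\<^sup>+\<xi>. ennreal (ln (bracket \<xi>) * (cmod (fourier (\<lambda>x. of_real (ap f x)) \<xi>))\<^sup>2) \<partial>lborel)
        \<le> ennreal (\<epsilon> / 2 * inner (?A f) f + C * (norm f)\<^sup>2)"
      by (elim exE conjE)
    have bound: "square_integrable (\<lambda>\<xi>. of_real (ln (bracket \<xi>) powr (1/2)) * fourier u \<xi>) \<and>
        (L2_norm (\<lambda>\<xi>. of_real (ln (bracket \<xi>) powr (1/2)) * fourier u \<xi>))\<^sup>2
          \<le> \<epsilon> * Re (L2_inner (L2_op b b0 u) u) + (\<epsilon> * C0 + 2 * C) * (L2_norm u)\<^sup>2"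
      if u: "u \<in> test_functions K" for u
    proof -
      have us: "smooth_on UNIV u" using u by (simp add: test_functions_def)
      note parts = complex_parts_test[OF u]
      define f1 where "f1 = Abs_tfun (\<lambda>y. Re (u y))"
      define f2 where "f2 = Abs_tfun (\<lambda>y. Im (u y))"
      have ap12: "ap f1 = (\<lambda>y. Re (u y))" "ap f2 = (\<lambda>y. Im (u y))"
        unfolding f1_def f2_def using parts by (auto intro: ap_Abs)
      have sup: "f1 \<in> supported_in (ball y0 r)" "f2 \<in> supported_in (ball y0 r)"
        "f1 \<in> supported_in (ball y0 1)" "f2 \<in> supported_in (ball y0 1)"
        using parts(3,4) K r'(2,3) by (simp_all add: supported_in_def ap12 subset_iff)
      have u_eq: "u y = of_real (ap f1 y) + \<i> * of_real (ap f2 y)" for y by (simp add: ap12 complex_eq_iff)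
      let ?F = "\<lambda>(f::(real^'m) tfun) \<xi>. fourier (\<lambda>x. complex_of_real (ap f x)) \<xi>"
      let ?E = "\<lambda>f. \<epsilon> / 2 * inner (?A f) f + C * (norm f)\<^sup>2"
      have [measurable]: "(\<lambda>x. complex_of_real (ap f x)) \<in> borel_measurable borel" for f :: "(real^'m) tfun"
        by (intro borel_measurable_continuous_onI continuous_on_of_real is_test_continuous is_test_ap)
      have [measurable]: "u \<in> borel_measurable borel"
        by (intro borel_measurable_continuous_onI smooth_on_continuous us)
      have F_sum: "fourier u \<xi> = ?F f1 \<xi> + \<i> * ?F f2 \<xi>" for \<xi>
      proof -
        have int: "integrable lborel (\<lambda>y. exp (- \<i> * of_real (y \<bullet> \<xi>)) * of_real (ap f y))" for f :: "(real^'m) tfun"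
          by (rule Bochner_Integration.integrable_bound[OF is_test_integrable[OF is_test_ap[of f]]]) (auto simp: norm_mult)
        have "fourier u \<xi> = (LINT y|lborel. exp (- \<i> * of_real (y \<bullet> \<xi>)) * of_real (ap f1 y) + \<i> * (exp (- \<i> * of_real (y \<bullet> \<xi>)) * of_real (ap f2 y)))"
          unfolding fourier_def by (intro Bochner_Integration.integral_cong) (auto simp: u_eq distrib_left)
        also have "\<dots> = (LINT y|lborel. exp (- \<i> * of_real (y \<bullet> \<xi>)) * of_real (ap f1 y)) + (LINT y|lborel. \<i> * (exp (- \<i> * of_real (y \<bullet> \<xi>)) * of_real (ap f2 y)))"
          by (rule Bochner_Integration.integral_add[OF int integrable_mult_right[OF int]])
        finally show ?thesis unfolding fourier_def by (simp only: integral_mult_right_zero)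
      qed
      let ?g = "\<lambda>\<xi>. ln (bracket \<xi>) * (cmod (fourier u \<xi>))\<^sup>2"
      have g_eq: "(cmod (of_real (ln (bracket \<xi>) powr (1/2)) * fourier u \<xi>))\<^sup>2 = ?g \<xi>" for \<xi>
        using ln_bracket_ge_1[of \<xi>] by (simp add: norm_mult power_mult_distrib powr_half_sqrt)
      have g0: "0 \<le> ?g \<xi>" for \<xi> using ln_bracket_ge_1[of \<xi>] by simp
      have E0: "0 \<le> ?E f" if "f \<in> supported_in (ball y0 1)" for f
        using A_nonneg[OF that] C \<epsilon> by simp
      have "(\<integral>\<^sup>+\<xi>. ennreal (?g \<xi>) \<partial>lborel)
        \<le> (\<integral>\<^sup>+\<xi>. ennreal 2 * ennreal (ln (bracket \<xi>) * (cmod (?F f1 \<xi>))\<^sup>2) + ennreal 2 * ennreal (ln (bracket \<xi>) * (cmod (?F f2 \<xi>))\<^sup>2) \<partial>lborel)"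
      proof (rule nn_integral_mono)
        fix \<xi> :: "real^'m"
        have ln0: "ln (bracket \<xi>) \<ge> 0" using ln_bracket_ge_1[of \<xi>] by simp
        have "cmod (fourier u \<xi>) \<le> cmod (?F f1 \<xi>) + cmod (?F f2 \<xi>)"
          unfolding F_sum by (rule order.trans[OF norm_triangle_ineq]) (simp add: norm_mult)
        then have "(cmod (fourier u \<xi>))\<^sup>2 \<le> (cmod (?F f1 \<xi>) + cmod (?F f2 \<xi>))\<^sup>2" by (rule power_mono) simp
        also have "\<dots> \<le> 2 * (cmod (?F f1 \<xi>))\<^sup>2 + 2 * (cmod (?F f2 \<xi>))\<^sup>2"
          using zero_le_power2[of "cmod (?F f1 \<xi>) - cmod (?F f2 \<xi>)"] by (simp add: power2_eq_square algebra_simps)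
        finally have "?g \<xi> \<le> ln (bracket \<xi>) * (2 * (cmod (?F f1 \<xi>))\<^sup>2 + 2 * (cmod (?F f2 \<xi>))\<^sup>2)" using ln0 by (rule mult_left_mono)
        also have "\<dots> = 2 * (ln (bracket \<xi>) * (cmod (?F f1 \<xi>))\<^sup>2) + 2 * (ln (bracket \<xi>) * (cmod (?F f2 \<xi>))\<^sup>2)" by (simp add: distrib_left)
        finally have "ennreal (?g \<xi>) \<le> ennreal (2 * (ln (bracket \<xi>) * (cmod (?F f1 \<xi>))\<^sup>2) + 2 * (ln (bracket \<xi>) * (cmod (?F f2 \<xi>))\<^sup>2))" by (rule ennreal_leI)
        then show "ennreal (?g \<xi>) \<le> ennreal 2 * ennreal (ln (bracket \<xi>) * (cmod (?F f1 \<xi>))\<^sup>2) + ennreal 2 * ennreal (ln (bracket \<xi>) * (cmod (?F f2 \<xi>))\<^sup>2)"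
          using ln0 by (simp only: ennreal_mult ennreal_plus mult_nonneg_nonneg zero_le_power2 zero_le_numeral)
      qed
      also have "\<dots> = ennreal 2 * (\<integral>\<^sup>+\<xi>. ennreal (ln (bracket \<xi>) * (cmod (?F f1 \<xi>))\<^sup>2) \<partial>lborel)
          + ennreal 2 * (\<integral>\<^sup>+\<xi>. ennreal (ln (bracket \<xi>) * (cmod (?F f2 \<xi>))\<^sup>2) \<partial>lborel)"
        by (subst nn_integral_add) (auto simp: nn_integral_cmult)
      also have "\<dots> \<le> ennreal 2 * ennreal (?E f1) + ennreal 2 * ennreal (?E f2)"
        by (intro add_mono mult_left_mono bspec[OF real_est] sup) auto
      also have "\<dots> = ennreal (2 * ?E f1 + 2 * ?E f2)"
        using E0[OF sup(3)] E0[OF sup(4)] by (simp only: ennreal_mult ennreal_plus mult_nonneg_nonneg zero_le_numeral)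
      finally have nn: "(\<integral>\<^sup>+\<xi>. ennreal (?g \<xi>) \<partial>lborel) \<le> ennreal (2 * ?E f1 + 2 * ?E f2)" .
      have B0: "0 \<le> 2 * ?E f1 + 2 * ?E f2"
        by (rule add_nonneg_nonneg[OF mult_nonneg_nonneg[OF zero_le_numeral E0[OF sup(3)]] mult_nonneg_nonneg[OF zero_le_numeral E0[OF sup(4)]]])
      have gm: "?g \<in> borel_measurable lborel" by measurable
      note g_int = integral_bound_from_nn_integral[OF gm g0 nn B0]
      have sq: "square_integrable (\<lambda>\<xi>. of_real (ln (bracket \<xi>) powr (1/2)) * fourier u \<xi>)"
        unfolding square_integrable_def g_eq using g_int(1) by simp
      have "(L2_norm (\<lambda>\<xi>. of_real (ln (bracket \<xi>) powr (1/2)) * fourier u \<xi>))\<^sup>2 = (LINT \<xi>|lborel. ?g \<xi>)"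
        unfolding L2_norm_def g_eq using g0 by (simp add: Bochner_Integration.integral_nonneg)
      then have le: "(L2_norm (\<lambda>\<xi>. of_real (ln (bracket \<xi>) powr (1/2)) * fourier u \<xi>))\<^sup>2 \<le> 2 * ?E f1 + 2 * ?E f2"
        using g_int(2) by simp
      have norm_u: "(L2_norm u)\<^sup>2 = (norm f1)\<^sup>2 + (norm f2)\<^sup>2"
      proof -
        have "(L2_norm u)\<^sup>2 = (LINT y|lborel. (cmod (u y))\<^sup>2)" unfolding L2_norm_def by (simp add: Bochner_Integration.integral_nonneg)
        also have "\<dots> = (LINT y|lborel. ap f1 y * ap f1 y + ap f2 y * ap f2 y)"
          by (simp only: ap12 cmod_power2) (simp only: power2_eq_square)
        also have "\<dots> = (LINT y|lborel. ap f1 y * ap f1 y) + (LINT y|lborel. ap f2 y * ap f2 y)"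
          by (rule Bochner_Integration.integral_add) (rule ap_mult_integrable[OF smooth_ap])+
        finally show ?thesis by (simp add: power2_norm_eq_inner inner_tfun_def)
      qed
      let ?L = "\<lambda>f y. L2_real b b0 (ap f) y"
      have iL: "integrable lborel (\<lambda>y. ?L f y * ap h y)" for f h :: "(real^'m) tfun"
        using is_test_integrable[OF is_test_mult[OF smooth_ap is_test_L2_real[OF b_smooth b0_smooth is_test_ap]]] by (simp add: mult.commute)
      have form_u: "Re (L2_inner (L2_op b b0 u) u) = (LINT y|lborel. ?L f1 y * ap f1 y) + (LINT y|lborel. ?L f2 y * ap f2 y)"
      proof -
        have "L2_op b b0 u y * cnj (u y) = of_real (?L f1 y * ap f1 y + ?L f2 y * ap f2 y) + \<i> * of_real (?L f2 y * ap f1 y - ?L f1 y * ap f2 y)" for y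
          unfolding L2_op_parts[OF b_smooth us] ap12 by (simp add: complex_eq_iff)
        then have "Re (L2_inner (L2_op b b0 u) u) = (LINT y|lborel. ?L f1 y * ap f1 y + ?L f2 y * ap f2 y)"
          unfolding L2_inner_def by (simp only: real_imag_integral[OF Bochner_Integration.integrable_add[OF iL iL] Bochner_Integration.integrable_diff[OF iL iL]])
        also have "\<dots> = (LINT y|lborel. ?L f1 y * ap f1 y) + (LINT y|lborel. ?L f2 y * ap f2 y)"
          by (rule Bochner_Integration.integral_add[OF iL iL])
        finally show ?thesis .
      qed
      have "inner (?A f) f = (LINT y|lborel. ?L f y * ap f y) + C0 * (norm f)\<^sup>2" for f
        by (simp only: inner_shifted_op[OF b_smooth b0_smooth] power2_norm_eq_inner)
      then have "2 * ?E f1 + 2 * ?E f2 = \<epsilon> * Re (L2_inner (L2_op b b0 u) u) + (\<epsilon> * C0 + 2 * C) * (L2_norm u)\<^sup>2"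
        unfolding form_u norm_u by (simp add: algebra_simps)
      then show ?thesis using sq le by simp
    qed
    then show "\<exists>C. \<forall>u\<in>test_functions K.
        square_integrable (\<lambda>\<xi>. of_real (ln (bracket \<xi>) powr (1/2)) * fourier u \<xi>) \<and>
        (L2_norm (\<lambda>\<xi>. of_real (ln (bracket \<xi>) powr (1/2)) * fourier u \<xi>))\<^sup>2
          \<le> \<epsilon> * Re (L2_inner (L2_op b b0 u) u) + C * (L2_norm u)\<^sup>2" by blast
  qed
qed

end
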